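(* Let $k$ be a field, $G$ a finite group, and $X$ a set of representatives of the conjugacy classes of $G$. There is a homotopy deformation retract of complexes $$\widehat\rho:\mathcal D^*(kG,kG)\to\bigoplus_{x\in X}\widehat C^*(C_G(x),k),\qquad\widehat\iota:\bigoplus_{x\in X}\widehat C^*(C_G(x),k)\to\mathcal D^*(kG,kG),\qquad\widehat s:\mathcal D^*(kG,kG)\to\mathcal D^{*-1}(kG,kG),$$ where for $m\ge0$ $$\widehat\iota^{\,m}=\rho^m,\quad\widehat\iota^{\,-m-1}=\iota_m,\quad\widehat\rho^{\,m}=\iota^m,\quad\widehat\rho^{\,-m-1}=\rho_m,\quad\widehat s^{\,m}=s^m,\quad\widehat s^{\,-m-1}=s_m;$$ that is, $\widehat\rho$ and $\widehat\iota$ are morphisms of complexes, $\widehat\rho\circ\widehat\iota=\mathrm{id}$, and $\mathrm{id}-\widehat\iota\circ\widehat\rho=\partial\circ\widehat s+\widehat s\circ\partial$, where $\partial$ is the differential of $\mathcal D^*(kG,kG)$.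
   Context: Notation. $\overline G=G\setminus\{1\}$; $g_{i,j}$ denotes $g_i,\dots,g_j$ (empty if $j<i$). $C^n(kG,kG)=\mathrm{Map}(\overline G^{\times n},kG)$ and $C_n(kG,kG)=k[G\times\overline G^{\times n}]$, $n\ge0$; cochains are extended by $0$ to tuples having an entry $1$, and a chain $(g_0,g_{1,n})$ with some $g_i=1$, $i\ge1$, is $0$. Differentials: $\delta(\varphi)(g_{1,n+1})=g_1\varphi(g_{2,n+1})+\sum_{i=1}^n(-1)^i\varphi(g_{1,i-1},g_ig_{i+1},g_{i+2,n+1})+(-1)^{n+1}\varphi(g_{1,n})g_{n+1}$, $\partial_n(g_0,g_{1,n})=(g_0g_1,g_{2,n})+\sum_{i=1}^{n-1}(-1)^i(g_0,g_{1,i-1},g_ig_{i+1},g_{i+2,n})+(-1)^n(g_ng_0,g_{1,n-1})$. $\mathcal D^*(kG,kG)$ is the complex with $\mathcal D^m=C^m(kG,kG)$ $(m\ge0)$, $\mathcal D^{-m-1}=C_m(kG,kG)$ $(m\ge0)$, and differential $\delta$ in degrees $\ge0$, $\partial_m$ on $C_m$ for $m\ge1$, and $\tau:C_0=kG\to C^0=kG$, $\tau(h)=\sum_{g\in G}ghg^{-1}$ in degree $-1$. For a finite group $H$, $\widehat C^*(H,k)$ is the Tate cochain complex: $\widehat C^n=C^n(H,k)=\mathrm{Map}(\overline H^{\times n},k)$ and $\widehat C^{-n-1}=C_n(H,k)=k[\overline H^{\times n}]$ for $n\ge0$, with normalized group cohomology and homology differentials for trivial coefficients, $\delta(\psi)(h_{1,n+1})=\psi(h_{2,n+1})+\sum_{i=1}^n(-1)^i\psi(h_{1,i-1},h_ih_{i+1},h_{i+2,n+1})+(-1)^{n+1}\psi(h_{1,n})$,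 $\partial_n(h_{1,n})=(h_{2,n})+\sum_{i=1}^{n-1}(-1)^i(h_{1,i-1},h_ih_{i+1},h_{i+2,n})+(-1)^n(h_{1,n-1})$, and multiplication by $|H|$ from degree $-1$ ($=k$) to degree $0$ ($=k$). For $x\in X$: $C_x$ is its conjugacy class, $C_G(x)$ its centralizer. $\mathcal H_x^n=\{\varphi\in C^n(kG,kG):\varphi(g_{1,n})\in k[g_1\cdots g_nC_x]\}$ and $\mathcal H_{x,n}=k[(g_n^{-1}\cdots g_1^{-1}u,g_{1,n}):u\in C_x,g_i\in\overline G]$, so that $C^*(kG,kG)=\bigoplus_x\mathcal H_x^*$ and $C_*(kG,kG)=\bigoplus_x\mathcal H_{x,*}$. Fix $G=C_G(x)\gamma_{1,x}\cup\dots\cup C_G(x)\gamma_{n_x,x}$ (right cosets) with $\gamma_{1,x}=1$, and $x_i=\gamma_{i,x}^{-1}x\gamma_{i,x}$. Given $i$ and $g_1,\dots,g_n$, define $h_{i_1},\dots,h_{i_n}\in C_G(x)$ and indices $s_i^j$ by $s_i^0=i$ and $\gamma_{s_i^{j-1},x}g_j=h_{i_j}\gamma_{s_i^j,x}$. Cohomological maps, summed over $x\in X$ to give $\iota^m,\rho^m,s^m$: $\iota^x:\mathcal H_x^n\to C^n(C_G(x),k)$, $\iota^x(\varphi)(h_{1,n})=$ coefficient of $x$ in $\varphi(h_{1,n})h_n^{-1}\cdots h_1^{-1}$; $\rho^x:C^n(C_G(x),k)\to\mathcal H_x^n$, $\rho^x(\psi)(g_{1,n})=\sum_{i=1}^{n_x}\psi(h_{i_1},\dots,h_{i_n})x_ig_1\cdots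 g_n$; $s^x:\mathcal H_x^n\to\mathcal H_x^{n-1}$ (zero for $n=0$), $s^x(\varphi)(g_{1,n-1})=\sum_{j=0}^{n-1}\sum_{i=1}^{n_x}(-1)^ja_{i,j}x_ig_1\cdots g_{n-1}$, with $a_{i,j}$ the coefficient of $x$ in $\varphi(h_{i_1},\dots,h_{i_j},\gamma_{s_i^j,x},g_{j+1},\dots,g_{n-1})g_{n-1}^{-1}\cdots g_1^{-1}\gamma_{i,x}^{-1}$. Homological maps, summed over $x\in X$ to give $\iota_m,\rho_m,s_m$: $\iota_x:C_n(C_G(x),k)\to\mathcal H_{x,n}$, $(h_{1,n})\mapsto(h_n^{-1}\cdots h_1^{-1}x,h_{1,n})$; $\rho_x:\mathcal H_{x,n}\to C_n(C_G(x),k)$, $(g_n^{-1}\cdots g_1^{-1}g_0^{-1}xg_0,g_{1,n})\mapsto(h_{i_1},\dots,h_{i_n})$, where $g_0=h\gamma_{i,x}$, $h\in C_G(x)$; $s_x:\mathcal H_{x,n}\to\mathcal H_{x,n+1}$, $(g_n^{-1}\cdots g_1^{-1}g_0^{-1}xg_0,g_{1,n})\mapsto\sum_{j=0}^n(-1)^j(g_n^{-1}\cdots g_1^{-1}g_0^{-1}xh,h_{i_1},\dots,h_{i_j},\gamma_{s_i^j,x},g_{j+1},\dots,g_n)$ with the same $h,i$. *)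

theory Defs
  imports Complex_Main "HOL-Algebra.Coset" "HOL-Library.Function_Algebras"
begin

section \<open>Complexes of vector spaces and homotopy deformation retracts\<close>

text \<open>A graded vector space is a family of subspaces of one ambient vector space, indexed by the
  integers. Maps are only considered on the subspaces.\<close>

definition linear_map_on ::
  "('k \<Rightarrow> 'v \<Rightarrow> 'v::ab_group_add) \<Rightarrow> ('k \<Rightarrow> 'w \<Rightarrow> 'w::ab_group_add) \<Rightarrow> 'v set \<Rightarrow> 'w set \<Rightarrow> ('v \<Rightarrow> 'w) \<Rightarrow> bool"
  where "linear_map_on scV scW V W f \<longleftrightarrow>
    (\<forall>v\<in>V. f v \<in> W) \<and>
    (\<forall>v\<in>V. \<forall>v'\<in>V. f (v + v') = f v + f v') \<and>
    (\<forall>c. \<forall>v\<in>V. f (scV c v) = scW c (f v))"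

locale cochain_complex = vector_space sc
  for sc :: "'k::field \<Rightarrow> 'v::ab_group_add \<Rightarrow> 'v" +
  fixes C :: "int \<Rightarrow> 'v set" and d :: "int \<Rightarrow> 'v \<Rightarrow> 'v"
  assumes space: "subspace (C m)"
    and diff: "linear_map_on sc sc (C m) (C (m + 1)) (d m)"
    and diff_diff: "v \<in> C m \<Longrightarrow> d (m + 1) (d m v) = 0"

definition complex_morphism where
  "complex_morphism scV C d scW C' d' f \<longleftrightarrow>
    (\<forall>m::int. linear_map_on scV scW (C m) (C' m) (f m)) \<and>
    (\<forall>m. \<forall>v\<in>C m. f (m + 1) (d m v) = d' m (f m v))"

definition homotopy_deformation_retract ::
  "('k::field \<Rightarrow> 'v::ab_group_add \<Rightarrow> 'v) \<Rightarrow> (int \<Rightarrow> 'v set) \<Rightarrow> (int \<Rightarrow> 'v \<Rightarrow> 'v) \<Rightarrow>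
   ('k \<Rightarrow> 'w::ab_group_add \<Rightarrow> 'w) \<Rightarrow> (int \<Rightarrow> 'w set) \<Rightarrow> (int \<Rightarrow> 'w \<Rightarrow> 'w) \<Rightarrow>
   (int \<Rightarrow> 'v \<Rightarrow> 'w) \<Rightarrow> (int \<Rightarrow> 'w \<Rightarrow> 'v) \<Rightarrow> (int \<Rightarrow> 'v \<Rightarrow> 'v) \<Rightarrow> bool"
  where "homotopy_deformation_retract scV C d scW C' d' \<rho> \<iota> s \<longleftrightarrow>
    cochain_complex scV C d \<and> cochain_complex scW C' d' \<and>
    complex_morphism scV C d scW C' d' \<rho> \<and>
    complex_morphism scW C' d' scV C d \<iota> \<and>
    (\<forall>m. linear_map_on scV scV (C m) (C (m - 1)) (s m)) \<and>
    (\<forall>m. \<forall>w\<in>C' m. \<rho> m (\<iota> m w) = w) \<and>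
    (\<forall>m. \<forall>v\<in>C m. v - \<iota> m (\<rho> m v) = d (m - 1) (s m v) + s (m + 1) (d m v))"

definition fscale :: "('k \<Rightarrow> 'v \<Rightarrow> 'v) \<Rightarrow> 'k \<Rightarrow> ('s \<Rightarrow> 'v) \<Rightarrow> 's \<Rightarrow> 'v"
  where "fscale sc c f = (\<lambda>s. sc c (f s))"

abbreviation scale1 :: "'k::field \<Rightarrow> ('s \<Rightarrow> 'k) \<Rightarrow> 's \<Rightarrow> 'k"
  where "scale1 \<equiv> fscale (*)"

abbreviation scale2 :: "'k::field \<Rightarrow> ('s \<Rightarrow> 't \<Rightarrow> 'k) \<Rightarrow> 's \<Rightarrow> 't \<Rightarrow> 'k"
  where "scale2 \<equiv> fscale (fscale (*))"

definition dsum_space :: "'i set \<Rightarrow> ('i \<Rightarrow> int \<Rightarrow> 'v::zero set) \<Rightarrow> int \<Rightarrow> ('i \<Rightarrow> 'v) set"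
  where "dsum_space X C m =
    {f. finite {x. f x \<noteq> 0} \<and> (\<forall>x\<in>X. f x \<in> C x m) \<and> (\<forall>x. x \<notin> X \<longrightarrow> f x = 0)}"

definition dsum_diff :: "'i set \<Rightarrow> ('i \<Rightarrow> int \<Rightarrow> 'v \<Rightarrow> 'v::zero) \<Rightarrow> int \<Rightarrow> ('i \<Rightarrow> 'v) \<Rightarrow> 'i \<Rightarrow> 'v"
  where "dsum_diff X d m f = (\<lambda>x. if x \<in> X then d x m (f x) else 0)"


section \<open>Group-theoretic preliminaries\<close>

definition centralizer :: "('a, 'b) monoid_scheme \<Rightarrow> 'a \<Rightarrow> 'a set"
  where "centralizer G x = {g \<in> carrier G. g \<otimes>\<^bsub>G\<^esub> x = x \<otimes>\<^bsub>G\<^esub> g}"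

abbreviation centralizer_group :: "('a, 'b) monoid_scheme \<Rightarrow> 'a \<Rightarrow> ('a, 'b) monoid_scheme"
  where "centralizer_group G x \<equiv> G\<lparr>carrier := centralizer G x\<rparr>"

definition conj_class :: "('a, 'b) monoid_scheme \<Rightarrow> 'a \<Rightarrow> 'a set"
  where "conj_class G x = {inv\<^bsub>G\<^esub> g \<otimes>\<^bsub>G\<^esub> x \<otimes>\<^bsub>G\<^esub> g | g. g \<in> carrier G}"

definition conj_class_reps :: "('a, 'b) monoid_scheme \<Rightarrow> 'a set \<Rightarrow> bool"
  where "conj_class_reps G X \<longleftrightarrow>
    X \<subseteq> carrier G \<and> (\<forall>g\<in>carrier G. \<exists>!x. x \<in> X \<and> g \<in> conj_class G x)"

definition right_coset_reps :: "('a, 'b) monoid_scheme \<Rightarrow> 'a set \<Rightarrow> nat \<Rightarrow> (nat \<Rightarrow> 'a) \<Rightarrow> bool"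
  where "right_coset_reps G H n r \<longleftrightarrow>
    (\<forall>i\<in>{1..n}. r i \<in> carrier G) \<and> r 1 = \<one>\<^bsub>G\<^esub> \<and>
    bij_betw (\<lambda>i. H #>\<^bsub>G\<^esub> r i) {1..n} (rcosets\<^bsub>G\<^esub> H)"

definition list_prod :: "('a, 'b) monoid_scheme \<Rightarrow> 'a list \<Rightarrow> 'a"
  where "list_prod G gs = foldr (mult G) gs \<one>\<^bsub>G\<^esub>"

text \<open>For \<open>gs = [g\<^sub>1, \<dots>, g\<^sub>n]\<close> this is the inverse product \<open>g\<^sub>n\<^sup>-\<^sup>1 \<cdots> g\<^sub>1\<^sup>-\<^sup>1\<close>.\<close>

definition list_inv_prod :: "('a, 'b) monoid_scheme \<Rightarrow> 'a list \<Rightarrow> 'a"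
  where "list_inv_prod G gs = list_prod G (rev (map (m_inv G) gs))"

text \<open>The tuple \<open>(g\<^sub>1, \<dots>, g\<^sub>i g\<^sub>i\<^sub>+\<^sub>1, \<dots>, g\<^sub>n)\<close> for \<open>1 \<le> i < n\<close>; list positions start at \<open>0\<close>.\<close>

definition merge_at :: "('a, 'b) monoid_scheme \<Rightarrow> nat \<Rightarrow> 'a list \<Rightarrow> 'a list"
  where "merge_at G i gs = take (i - 1) gs @ [gs ! (i - 1) \<otimes>\<^bsub>G\<^esub> gs ! i] @ drop (i + 1) gs"

definition tuples :: "('a, 'b) monoid_scheme \<Rightarrow> nat \<Rightarrow> 'a list set"
  where "tuples G n = {gs. length gs = n \<and> set gs \<subseteq> carrier G - {\<one>\<^bsub>G\<^esub>}}"


section \<open>Free vector spaces and the group algebra\<close>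

definition free_space :: "'s set \<Rightarrow> ('s \<Rightarrow> 'k::zero) set"
  where "free_space S = {a. finite {s. a s \<noteq> 0} \<and> (\<forall>s. s \<notin> S \<longrightarrow> a s = 0)}"

definition basis_vec :: "'s \<Rightarrow> 's \<Rightarrow> 'k::zero_neq_one"
  where "basis_vec s = (\<lambda>t. if t = s then 1 else 0)"

text \<open>The group algebra \<open>kG\<close> is \<open>free_space (carrier G)\<close> with the convolution product. The
  coefficient of \<open>x\<close> in \<open>a\<close> is \<open>a x\<close>. The pointwise product \<open>(*)\<close> of functions is not used.\<close>

definition ga_mult :: "('a, 'b) monoid_scheme \<Rightarrow> ('a \<Rightarrow> 'k::field) \<Rightarrow> ('a \<Rightarrow> 'k) \<Rightarrow> 'a \<Rightarrow> 'k"
  where "ga_mult G a b =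
    (\<Sum>g\<in>carrier G. \<Sum>h\<in>carrier G. scale1 (a g * b h) (basis_vec (g \<otimes>\<^bsub>G\<^esub> h)))"


section \<open>The complex \<open>\<D>\<^sup>*(kG, kG)\<close>\<close>

text \<open>Cochains and chains share the type \<^typ>\<open>'a list \<Rightarrow> 'a \<Rightarrow> 'k\<close>: a cochain \<open>\<phi>\<close> sends a list
  \<open>gs\<close> to the element \<open>\<phi> gs\<close> of \<open>kG\<close>, and for a chain \<open>c\<close> the scalar \<open>c gs g\<^sub>0\<close> is the coefficient
  of the basis element \<open>(g\<^sub>0, gs)\<close>. Cochains vanish off \<^term>\<open>tuples G n\<close>, which is the
  extension by \<open>0\<close> to tuples with an entry \<open>1\<close>.\<close>

definition cochains :: "('a, 'b) monoid_scheme \<Rightarrow> nat \<Rightarrow> ('a list \<Rightarrow> 'a \<Rightarrow> 'k::field) set"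
  where "cochains G n =
    {\<phi>. (\<forall>gs\<in>tuples G n. \<phi> gs \<in> free_space (carrier G)) \<and> (\<forall>gs. gs \<notin> tuples G n \<longrightarrow> \<phi> gs = 0)}"

definition chains :: "('a, 'b) monoid_scheme \<Rightarrow> nat \<Rightarrow> ('a list \<Rightarrow> 'a \<Rightarrow> 'k::field) set"
  where "chains G n = {c. (\<lambda>(g, gs). c gs g) \<in> free_space (carrier G \<times> tuples G n)}"

definition chain_elt :: "('a, 'b) monoid_scheme \<Rightarrow> 'a \<Rightarrow> 'a list \<Rightarrow> 'a list \<Rightarrow> 'a \<Rightarrow> 'k::field"
  where "chain_elt G g gs = (\<lambda>hs h.
    if \<one>\<^bsub>G\<^esub> \<in> set gs then 0 else basis_vec (g, gs) (h, hs))"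

definition coch_diff ::
  "('a, 'b) monoid_scheme \<Rightarrow> nat \<Rightarrow> ('a list \<Rightarrow> 'a \<Rightarrow> 'k::field) \<Rightarrow> 'a list \<Rightarrow> 'a \<Rightarrow> 'k"
  where "coch_diff G n \<phi> = (\<lambda>gs. if gs \<in> tuples G (n + 1) then
      ga_mult G (basis_vec (gs ! 0)) (\<phi> (drop 1 gs))
      + (\<Sum>i=1..n. scale1 ((-1) ^ i) (\<phi> (merge_at G i gs)))
      + scale1 ((-1) ^ (n + 1)) (ga_mult G (\<phi> (take n gs)) (basis_vec (gs ! n)))
    else 0)"

text \<open>Only used for \<open>n \<ge> 1\<close>.\<close>

definition ch_diff ::
  "('a, 'b) monoid_scheme \<Rightarrow> nat \<Rightarrow> ('a list \<Rightarrow> 'a \<Rightarrow> 'k::field) \<Rightarrow> 'a list \<Rightarrow> 'a \<Rightarrow> 'k"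
  where "ch_diff G n c = (\<Sum>(g\<^sub>0, gs)\<in>carrier G \<times> tuples G n. scale2 (c gs g\<^sub>0)
      (chain_elt G (g\<^sub>0 \<otimes>\<^bsub>G\<^esub> gs ! 0) (drop 1 gs)
       + (\<Sum>i=1..n-1. scale2 ((-1) ^ i) (chain_elt G g\<^sub>0 (merge_at G i gs)))
       + scale2 ((-1) ^ n) (chain_elt G (gs ! (n - 1) \<otimes>\<^bsub>G\<^esub> g\<^sub>0) (take (n - 1) gs))))"

definition trace_map ::
  "('a, 'b) monoid_scheme \<Rightarrow> ('a list \<Rightarrow> 'a \<Rightarrow> 'k::field) \<Rightarrow> 'a list \<Rightarrow> 'a \<Rightarrow> 'k"
  where "trace_map G c = (\<lambda>gs. if gs = [] then
      (\<Sum>h\<in>carrier G. scale1 (c [] h)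
        (\<Sum>g\<in>carrier G. basis_vec (g \<otimes>\<^bsub>G\<^esub> h \<otimes>\<^bsub>G\<^esub> inv\<^bsub>G\<^esub> g)))
    else 0)"

definition D_space :: "('a, 'b) monoid_scheme \<Rightarrow> int \<Rightarrow> ('a list \<Rightarrow> 'a \<Rightarrow> 'k::field) set"
  where "D_space G m = (if m \<ge> 0 then cochains G (nat m) else chains G (nat (- m - 1)))"

definition D_diff ::
  "('a, 'b) monoid_scheme \<Rightarrow> int \<Rightarrow> ('a list \<Rightarrow> 'a \<Rightarrow> 'k::field) \<Rightarrow> 'a list \<Rightarrow> 'a \<Rightarrow> 'k"
  where "D_diff G m = (if m \<ge> 0 then coch_diff G (nat m)
    else if m = -1 then trace_map G
    else ch_diff G (nat (- m - 1)))"


section \<open>The Tate cochain complex with trivial coefficients\<close>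

definition gcochains :: "('a, 'b) monoid_scheme \<Rightarrow> nat \<Rightarrow> ('a list \<Rightarrow> 'k::field) set"
  where "gcochains H n = {\<psi>. \<forall>hs. hs \<notin> tuples H n \<longrightarrow> \<psi> hs = 0}"

definition gchains :: "('a, 'b) monoid_scheme \<Rightarrow> nat \<Rightarrow> ('a list \<Rightarrow> 'k::field) set"
  where "gchains H n = free_space (tuples H n)"

definition gchain_elt :: "('a, 'b) monoid_scheme \<Rightarrow> 'a list \<Rightarrow> 'a list \<Rightarrow> 'k::field"
  where "gchain_elt H hs = (if \<one>\<^bsub>H\<^esub> \<in> set hs then 0 else basis_vec hs)"

definition gcoch_diff ::
  "('a, 'b) monoid_scheme \<Rightarrow> nat \<Rightarrow> ('a list \<Rightarrow> 'k::field) \<Rightarrow> 'a list \<Rightarrow> 'k"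
  where "gcoch_diff H n \<psi> = (\<lambda>hs. if hs \<in> tuples H (n + 1) then
      \<psi> (drop 1 hs) + (\<Sum>i=1..n. (-1) ^ i * \<psi> (merge_at H i hs)) + (-1) ^ (n + 1) * \<psi> (take n hs)
    else 0)"

definition gch_diff ::
  "('a, 'b) monoid_scheme \<Rightarrow> nat \<Rightarrow> ('a list \<Rightarrow> 'k::field) \<Rightarrow> 'a list \<Rightarrow> 'k"
  where "gch_diff H n c = (\<Sum>hs\<in>tuples H n. scale1 (c hs)
      (gchain_elt H (drop 1 hs)
       + (\<Sum>i=1..n-1. scale1 ((-1) ^ i) (gchain_elt H (merge_at H i hs)))
       + scale1 ((-1) ^ n) (gchain_elt H (take (n - 1) hs))))"

definition tate_space :: "('a, 'b) monoid_scheme \<Rightarrow> int \<Rightarrow> ('a list \<Rightarrow> 'k::field) set"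
  where "tate_space H m = (if m \<ge> 0 then gcochains H (nat m) else gchains H (nat (- m - 1)))"

text \<open>In degrees \<open>-1\<close> and \<open>0\<close> the field \<open>k\<close> appears as the functions supported on \<open>{[]}\<close>.\<close>

definition tate_diff ::
  "('a, 'b) monoid_scheme \<Rightarrow> int \<Rightarrow> ('a list \<Rightarrow> 'k::field) \<Rightarrow> 'a list \<Rightarrow> 'k"
  where "tate_diff H m = (if m \<ge> 0 then gcoch_diff H (nat m)
    else if m = -1 then scale1 (of_nat (order H))
    else gch_diff H (nat (- m - 1)))"


section \<open>Decomposition over the conjugacy classes\<close>

definition coch_part :: "('a, 'b) monoid_scheme \<Rightarrow> 'a \<Rightarrow> nat \<Rightarrow> ('a list \<Rightarrow> 'a \<Rightarrow> 'k::field) set"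
  where "coch_part G x n =
    {\<phi> \<in> cochains G n. \<forall>gs\<in>tuples G n. \<phi> gs \<in> free_space (list_prod G gs <#\<^bsub>G\<^esub> conj_class G x)}"

definition ch_part_basis :: "('a, 'b) monoid_scheme \<Rightarrow> 'a \<Rightarrow> nat \<Rightarrow> ('a \<times> 'a list) set"
  where "ch_part_basis G x n =
    {(list_inv_prod G gs \<otimes>\<^bsub>G\<^esub> u, gs) | u gs. u \<in> conj_class G x \<and> gs \<in> tuples G n}"

definition ch_part :: "('a, 'b) monoid_scheme \<Rightarrow> 'a \<Rightarrow> nat \<Rightarrow> ('a list \<Rightarrow> 'a \<Rightarrow> 'k::field) set"
  where "ch_part G x n = {c. (\<lambda>(g, gs). c gs g) \<in> free_space (ch_part_basis G x n)}"

text \<open>The projections onto these summands; they are justified by the lemmas below.\<close>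

definition coch_proj ::
  "('a, 'b) monoid_scheme \<Rightarrow> 'a \<Rightarrow> ('a list \<Rightarrow> 'a \<Rightarrow> 'k::field) \<Rightarrow> 'a list \<Rightarrow> 'a \<Rightarrow> 'k"
  where "coch_proj G x \<phi> =
    (\<lambda>gs u. if u \<in> list_prod G gs <#\<^bsub>G\<^esub> conj_class G x then \<phi> gs u else 0)"

definition ch_proj ::
  "('a, 'b) monoid_scheme \<Rightarrow> 'a \<Rightarrow> nat \<Rightarrow> ('a list \<Rightarrow> 'a \<Rightarrow> 'k::field) \<Rightarrow> 'a list \<Rightarrow> 'a \<Rightarrow> 'k"
  where "ch_proj G x n c = (\<lambda>gs g. if (g, gs) \<in> ch_part_basis G x n then c gs g else 0)"


section \<open>The elements \<open>h\<^sub>i\<^sub>j\<close> and the indices \<open>s\<^sub>i\<^sup>j\<close>\<close>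

text \<open>Throughout, \<open>N x\<close> is the number \<open>n\<^sub>x\<close> of cosets and \<open>\<gamma> x i\<close> is the representative
  \<open>\<gamma>\<^bsub>i,x\<^esub>\<close>, for \<open>1 \<le> i \<le> n\<^sub>x\<close>.\<close>

definition coset_decomp ::
  "('a, 'b) monoid_scheme \<Rightarrow> ('a \<Rightarrow> nat) \<Rightarrow> ('a \<Rightarrow> nat \<Rightarrow> 'a) \<Rightarrow> 'a \<Rightarrow> 'a \<Rightarrow> 'a \<times> nat"
  where "coset_decomp G N \<gamma> x g =
    (THE p. fst p \<in> centralizer G x \<and> snd p \<in> {1..N x} \<and> g = fst p \<otimes>\<^bsub>G\<^esub> \<gamma> x (snd p))"

primrec s_index ::
  "('a, 'b) monoid_scheme \<Rightarrow> ('a \<Rightarrow> nat) \<Rightarrow> ('a \<Rightarrow> nat \<Rightarrow> 'a) \<Rightarrow> 'a \<Rightarrow> nat \<Rightarrow> 'a list \<Rightarrow> nat \<Rightarrow> nat"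
  where
    "s_index G N \<gamma> x i gs 0 = i"
  | "s_index G N \<gamma> x i gs (Suc j) =
      snd (coset_decomp G N \<gamma> x (\<gamma> x (s_index G N \<gamma> x i gs j) \<otimes>\<^bsub>G\<^esub> gs ! j))"

definition h_tuple ::
  "('a, 'b) monoid_scheme \<Rightarrow> ('a \<Rightarrow> nat) \<Rightarrow> ('a \<Rightarrow> nat \<Rightarrow> 'a) \<Rightarrow> 'a \<Rightarrow> nat \<Rightarrow> 'a list \<Rightarrow> 'a list"
  where "h_tuple G N \<gamma> x i gs =
    map (\<lambda>j. fst (coset_decomp G N \<gamma> x (\<gamma> x (s_index G N \<gamma> x i gs j) \<otimes>\<^bsub>G\<^esub> gs ! j)))
      [0..<length gs]"

text \<open>The tuple \<open>(h\<^sub>i\<^sub>1, \<dots>, h\<^sub>i\<^sub>j, \<gamma>, g\<^sub>j\<^sub>+\<^sub>1, \<dots>, g\<^sub>n)\<close> with \<open>\<gamma>\<close> the representative of index \<open>s\<^sub>i\<^sup>j\<close>.\<close>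

definition insert_tuple ::
  "('a, 'b) monoid_scheme \<Rightarrow> ('a \<Rightarrow> nat) \<Rightarrow> ('a \<Rightarrow> nat \<Rightarrow> 'a) \<Rightarrow> 'a \<Rightarrow> nat \<Rightarrow> 'a list \<Rightarrow> nat \<Rightarrow> 'a list"
  where "insert_tuple G N \<gamma> x i gs j =
    take j (h_tuple G N \<gamma> x i gs) @ [\<gamma> x (s_index G N \<gamma> x i gs j)] @ drop j gs"

definition conj_rep :: "('a, 'b) monoid_scheme \<Rightarrow> ('a \<Rightarrow> nat \<Rightarrow> 'a) \<Rightarrow> 'a \<Rightarrow> nat \<Rightarrow> 'a"
  where "conj_rep G \<gamma> x i = inv\<^bsub>G\<^esub> (\<gamma> x i) \<otimes>\<^bsub>G\<^esub> x \<otimes>\<^bsub>G\<^esub> \<gamma> x i"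


section \<open>The cohomological maps\<close>

definition coh_iota_x ::
  "('a, 'b) monoid_scheme \<Rightarrow> 'a \<Rightarrow> nat \<Rightarrow> ('a list \<Rightarrow> 'a \<Rightarrow> 'k::field) \<Rightarrow> 'a list \<Rightarrow> 'k"
  where "coh_iota_x G x n \<phi> = (\<lambda>hs. if hs \<in> tuples (centralizer_group G x) n
    then ga_mult G (\<phi> hs) (basis_vec (list_inv_prod G hs)) x else 0)"

definition coh_rho_x ::
  "('a, 'b) monoid_scheme \<Rightarrow> ('a \<Rightarrow> nat) \<Rightarrow> ('a \<Rightarrow> nat \<Rightarrow> 'a) \<Rightarrow> 'a \<Rightarrow> nat \<Rightarrow>
   ('a list \<Rightarrow> 'k::field) \<Rightarrow> 'a list \<Rightarrow> 'a \<Rightarrow> 'k"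
  where "coh_rho_x G N \<gamma> x n \<psi> = (\<lambda>gs. if gs \<in> tuples G n then
      (\<Sum>i=1..N x. scale1 (\<psi> (h_tuple G N \<gamma> x i gs))
        (basis_vec (conj_rep G \<gamma> x i \<otimes>\<^bsub>G\<^esub> list_prod G gs)))
    else 0)"

definition coh_s_coeff ::
  "('a, 'b) monoid_scheme \<Rightarrow> ('a \<Rightarrow> nat) \<Rightarrow> ('a \<Rightarrow> nat \<Rightarrow> 'a) \<Rightarrow> 'a \<Rightarrow>
   ('a list \<Rightarrow> 'a \<Rightarrow> 'k::field) \<Rightarrow> 'a list \<Rightarrow> nat \<Rightarrow> nat \<Rightarrow> 'k"
  where "coh_s_coeff G N \<gamma> x \<phi> gs i j =
    ga_mult G (\<phi> (insert_tuple G N \<gamma> x i gs j))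
      (basis_vec (list_inv_prod G gs \<otimes>\<^bsub>G\<^esub> inv\<^bsub>G\<^esub> (\<gamma> x i))) x"

definition coh_s_x ::
  "('a, 'b) monoid_scheme \<Rightarrow> ('a \<Rightarrow> nat) \<Rightarrow> ('a \<Rightarrow> nat \<Rightarrow> 'a) \<Rightarrow> 'a \<Rightarrow> nat \<Rightarrow>
   ('a list \<Rightarrow> 'a \<Rightarrow> 'k::field) \<Rightarrow> 'a list \<Rightarrow> 'a \<Rightarrow> 'k"
  where "coh_s_x G N \<gamma> x n \<phi> = (\<lambda>gs. if n \<ge> 1 \<and> gs \<in> tuples G (n - 1) then
      (\<Sum>j=0..n-1. \<Sum>i=1..N x. scale1 ((-1) ^ j * coh_s_coeff G N \<gamma> x \<phi> gs i j)
        (basis_vec (conj_rep G \<gamma> x i \<otimes>\<^bsub>G\<^esub> list_prod G gs)))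
    else 0)"

definition coh_iota ::
  "('a, 'b) monoid_scheme \<Rightarrow> 'a set \<Rightarrow> nat \<Rightarrow> ('a list \<Rightarrow> 'a \<Rightarrow> 'k::field) \<Rightarrow> 'a \<Rightarrow> 'a list \<Rightarrow> 'k"
  where "coh_iota G X n \<phi> = (\<lambda>x. if x \<in> X then coh_iota_x G x n (coch_proj G x \<phi>) else 0)"

definition coh_rho ::
  "('a, 'b) monoid_scheme \<Rightarrow> 'a set \<Rightarrow> ('a \<Rightarrow> nat) \<Rightarrow> ('a \<Rightarrow> nat \<Rightarrow> 'a) \<Rightarrow> nat \<Rightarrow>
   ('a \<Rightarrow> 'a list \<Rightarrow> 'k::field) \<Rightarrow> 'a list \<Rightarrow> 'a \<Rightarrow> 'k"
  where "coh_rho G X N \<gamma> n \<psi> = (\<Sum>x\<in>X. coh_rho_x G N \<gamma> x n (\<psi> x))"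

definition coh_s ::
  "('a, 'b) monoid_scheme \<Rightarrow> 'a set \<Rightarrow> ('a \<Rightarrow> nat) \<Rightarrow> ('a \<Rightarrow> nat \<Rightarrow> 'a) \<Rightarrow> nat \<Rightarrow>
   ('a list \<Rightarrow> 'a \<Rightarrow> 'k::field) \<Rightarrow> 'a list \<Rightarrow> 'a \<Rightarrow> 'k"
  where "coh_s G X N \<gamma> n \<phi> = (\<Sum>x\<in>X. coh_s_x G N \<gamma> x n (coch_proj G x \<phi>))"


section \<open>The homological maps\<close>

definition hom_iota_x ::
  "('a, 'b) monoid_scheme \<Rightarrow> 'a \<Rightarrow> nat \<Rightarrow> ('a list \<Rightarrow> 'k::field) \<Rightarrow> 'a list \<Rightarrow> 'a \<Rightarrow> 'k"
  where "hom_iota_x G x n c = (\<Sum>hs\<in>tuples (centralizer_group G x) n.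
    scale2 (c hs) (chain_elt G (list_inv_prod G hs \<otimes>\<^bsub>G\<^esub> x) hs))"

text \<open>A basis element \<open>(a, g\<^sub>1, \<dots>, g\<^sub>n)\<close> of the \<open>x\<close>-part has the form
  \<open>a = g\<^sub>n\<^sup>-\<^sup>1 \<cdots> g\<^sub>1\<^sup>-\<^sup>1 g\<^sub>0\<^sup>-\<^sup>1 x g\<^sub>0\<close>. The element \<open>g\<^sub>0\<close> is determined up to left
  multiplication by the centralizer of \<open>x\<close>, which affects neither the index \<open>i\<close> in
  \<open>g\<^sub>0 = h \<gamma>\<^bsub>i,x\<^esub>\<close> nor \<open>g\<^sub>0\<^sup>-\<^sup>1 x h\<close>, so that any choice of \<open>g\<^sub>0\<close> may be used.\<close>

definition conjugator :: "('a, 'b) monoid_scheme \<Rightarrow> 'a \<Rightarrow> 'a \<Rightarrow> 'a list \<Rightarrow> 'a"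
  where "conjugator G x a gs = (SOME g\<^sub>0. g\<^sub>0 \<in> carrier G \<and>
    a = list_inv_prod G gs \<otimes>\<^bsub>G\<^esub> inv\<^bsub>G\<^esub> g\<^sub>0 \<otimes>\<^bsub>G\<^esub> x \<otimes>\<^bsub>G\<^esub> g\<^sub>0)"

definition hom_rho_x ::
  "('a, 'b) monoid_scheme \<Rightarrow> ('a \<Rightarrow> nat) \<Rightarrow> ('a \<Rightarrow> nat \<Rightarrow> 'a) \<Rightarrow> 'a \<Rightarrow> nat \<Rightarrow>
   ('a list \<Rightarrow> 'a \<Rightarrow> 'k::field) \<Rightarrow> 'a list \<Rightarrow> 'k"
  where "hom_rho_x G N \<gamma> x n c = (\<Sum>(a, gs)\<in>ch_part_basis G x n. scale1 (c gs a)
    (let (h, i) = coset_decomp G N \<gamma> x (conjugator G x a gs)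
     in gchain_elt (centralizer_group G x) (h_tuple G N \<gamma> x i gs)))"

definition hom_s_x ::
  "('a, 'b) monoid_scheme \<Rightarrow> ('a \<Rightarrow> nat) \<Rightarrow> ('a \<Rightarrow> nat \<Rightarrow> 'a) \<Rightarrow> 'a \<Rightarrow> nat \<Rightarrow>
   ('a list \<Rightarrow> 'a \<Rightarrow> 'k::field) \<Rightarrow> 'a list \<Rightarrow> 'a \<Rightarrow> 'k"
  where "hom_s_x G N \<gamma> x n c = (\<Sum>(a, gs)\<in>ch_part_basis G x n. scale2 (c gs a)
    (let g\<^sub>0 = conjugator G x a gs; (h, i) = coset_decomp G N \<gamma> x g\<^sub>0
     in \<Sum>j=0..n. scale2 ((-1) ^ j)
          (chain_elt G (list_inv_prod G gs \<otimes>\<^bsub>G\<^esub> inv\<^bsub>G\<^esub> g\<^sub>0 \<otimes>\<^bsub>G\<^esub> x \<otimes>\<^bsub>G\<^esub> h)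
            (insert_tuple G N \<gamma> x i gs j))))"

definition hom_iota ::
  "('a, 'b) monoid_scheme \<Rightarrow> 'a set \<Rightarrow> nat \<Rightarrow> ('a \<Rightarrow> 'a list \<Rightarrow> 'k::field) \<Rightarrow> 'a list \<Rightarrow> 'a \<Rightarrow> 'k"
  where "hom_iota G X n c = (\<Sum>x\<in>X. hom_iota_x G x n (c x))"

definition hom_rho ::
  "('a, 'b) monoid_scheme \<Rightarrow> 'a set \<Rightarrow> ('a \<Rightarrow> nat) \<Rightarrow> ('a \<Rightarrow> nat \<Rightarrow> 'a) \<Rightarrow> nat \<Rightarrow>
   ('a list \<Rightarrow> 'a \<Rightarrow> 'k::field) \<Rightarrow> 'a \<Rightarrow> 'a list \<Rightarrow> 'k"
  where "hom_rho G X N \<gamma> n c =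
    (\<lambda>x. if x \<in> X then hom_rho_x G N \<gamma> x n (ch_proj G x n c) else 0)"

definition hom_s ::
  "('a, 'b) monoid_scheme \<Rightarrow> 'a set \<Rightarrow> ('a \<Rightarrow> nat) \<Rightarrow> ('a \<Rightarrow> nat \<Rightarrow> 'a) \<Rightarrow> nat \<Rightarrow>
   ('a list \<Rightarrow> 'a \<Rightarrow> 'k::field) \<Rightarrow> 'a list \<Rightarrow> 'a \<Rightarrow> 'k"
  where "hom_s G X N \<gamma> n c = (\<Sum>x\<in>X. hom_s_x G N \<gamma> x n (ch_proj G x n c))"


section \<open>The maps in all degrees\<close>

text \<open>The letters \<open>\<iota>\<close> and \<open>\<rho>\<close> change roles in nonnegative degrees.\<close>

definition iota_hat ::
  "('a, 'b) monoid_scheme \<Rightarrow> 'a set \<Rightarrow> ('a \<Rightarrow> nat) \<Rightarrow> ('a \<Rightarrow> nat \<Rightarrow> 'a) \<Rightarrow> int \<Rightarrow>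
   ('a \<Rightarrow> 'a list \<Rightarrow> 'k::field) \<Rightarrow> 'a list \<Rightarrow> 'a \<Rightarrow> 'k"
  where "iota_hat G X N \<gamma> m =
    (if m \<ge> 0 then coh_rho G X N \<gamma> (nat m) else hom_iota G X (nat (- m - 1)))"

definition rho_hat ::
  "('a, 'b) monoid_scheme \<Rightarrow> 'a set \<Rightarrow> ('a \<Rightarrow> nat) \<Rightarrow> ('a \<Rightarrow> nat \<Rightarrow> 'a) \<Rightarrow> int \<Rightarrow>
   ('a list \<Rightarrow> 'a \<Rightarrow> 'k::field) \<Rightarrow> 'a \<Rightarrow> 'a list \<Rightarrow> 'k"
  where "rho_hat G X N \<gamma> m =
    (if m \<ge> 0 then coh_iota G X (nat m) else hom_rho G X N \<gamma> (nat (- m - 1)))"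

definition s_hat ::
  "('a, 'b) monoid_scheme \<Rightarrow> 'a set \<Rightarrow> ('a \<Rightarrow> nat) \<Rightarrow> ('a \<Rightarrow> nat \<Rightarrow> 'a) \<Rightarrow> int \<Rightarrow>
   ('a list \<Rightarrow> 'a \<Rightarrow> 'k::field) \<Rightarrow> 'a list \<Rightarrow> 'a \<Rightarrow> 'k"
  where "s_hat G X N \<gamma> m =
    (if m \<ge> 0 then coh_s G X N \<gamma> (nat m) else hom_s G X N \<gamma> (nat (- m - 1)))"


section \<open>The decomposition is a direct sum\<close>

lemma conj_class_closed: "group G \<Longrightarrow> x \<in> carrier G \<Longrightarrow> conj_class G x \<subseteq> carrier G"
  unfolding conj_class_def by (auto intro!: monoid.m_closed group.is_monoid group.inv_closed)

lemma list_prod_closed: "group G \<Longrightarrow> set gs \<subseteq> carrier G \<Longrightarrow> list_prod G gs \<in> carrier G"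
  unfolding list_prod_def
  by (induction gs) (auto intro!: monoid.m_closed group.is_monoid monoid.one_closed)

lemma list_inv_prod:
  assumes "group G" "set gs \<subseteq> carrier G"
  shows "list_inv_prod G gs = inv\<^bsub>G\<^esub> (list_prod G gs)"
proof -
  interpret group G by fact
  have app: "list_prod G (as @ [b]) = list_prod G as \<otimes>\<^bsub>G\<^esub> b"
    if "set as \<subseteq> carrier G" "b \<in> carrier G" for as b
    using that
  proof (induction as)
    case (Cons a as)
    then have "list_prod G as \<in> carrier G" by (auto intro: list_prod_closed[OF assms(1)])
    with Cons show ?case by (simp add: list_prod_def m_assoc)
  qed (simp add: list_prod_def)
  show ?thesis using assms(2)
  proof (induction gs)
    case (Cons g gs)
    have "list_inv_prod G (g # gs) = list_inv_prod G gs \<otimes>\<^bsub>G\<^esub> inv\<^bsub>G\<^esub> g"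
      unfolding list_inv_prod_def using Cons.prems by (auto intro!: app inv_closed)
    moreover have "list_prod G gs \<in> carrier G"
      using Cons.prems by (auto intro: list_prod_closed[OF assms(1)])
    ultimately show ?case using Cons by (simp add: list_prod_def inv_mult_group)
  qed (simp add: list_inv_prod_def list_prod_def)
qed

lemma mem_l_coset_iff:
  assumes "group G" "p \<in> carrier G" "C \<subseteq> carrier G" "u \<in> carrier G"
  shows "u \<in> p <#\<^bsub>G\<^esub> C \<longleftrightarrow> inv\<^bsub>G\<^esub> p \<otimes>\<^bsub>G\<^esub> u \<in> C"
proof -
  interpret group G by fact
  have "u = p \<otimes>\<^bsub>G\<^esub> (inv\<^bsub>G\<^esub> p \<otimes>\<^bsub>G\<^esub> u)" using assms by (simp add: m_assoc[symmetric])
  moreover have "inv\<^bsub>G\<^esub> p \<otimes>\<^bsub>G\<^esub> (p \<otimes>\<^bsub>G\<^esub> c) = c" if "c \<in> C" for c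
    using assms that by (auto simp: m_assoc[symmetric])
  ultimately show ?thesis unfolding l_coset_def by auto
qed

lemma mem_ch_part_basis_iff:
  assumes "group G" "x \<in> carrier G" "a \<in> carrier G" "gs \<in> tuples G n"
  shows "(a, gs) \<in> ch_part_basis G x n \<longleftrightarrow> list_prod G gs \<otimes>\<^bsub>G\<^esub> a \<in> conj_class G x"
proof -
  interpret group G by fact
  have p: "list_prod G gs \<in> carrier G" "set gs \<subseteq> carrier G"
    using assms by (auto simp: tuples_def intro!: list_prod_closed)
  have "(a, gs) \<in> ch_part_basis G x n \<longleftrightarrow> a \<in> inv\<^bsub>G\<^esub> (list_prod G gs) <#\<^bsub>G\<^esub> conj_class G x"
    using assms p by (auto simp: ch_part_basis_def l_coset_def list_inv_prod)
  then show ?thesis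
    using mem_l_coset_iff[of G "inv\<^bsub>G\<^esub> (list_prod G gs)" "conj_class G x" a] assms p
      conj_class_closed[of G x] by simp
qed

lemma sum_fun_apply: "(\<Sum>x\<in>A. f x) y = (\<Sum>x\<in>A. f x y)"
  by (induction A rule: infinite_finite_induct) auto

lemma conj_class_unique:
  assumes "conj_class_reps G X" "x \<in> X" "y \<in> X" "g \<in> carrier G"
    "g \<in> conj_class G x" "g \<in> conj_class G y"
  shows "x = y"
  using assms unfolding conj_class_reps_def by blast

lemma sum_conj_class:
  assumes "finite X" "conj_class_reps G X" "g \<in> carrier G"
  shows "(\<Sum>x\<in>X. if g \<in> conj_class G x then c else 0) = (c::'k::field)"
proof -
  obtain y where y: "y \<in> X" "g \<in> conj_class G y"
    using assms(2,3) unfolding conj_class_reps_def by blast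
  have "(\<Sum>x\<in>X. if g \<in> conj_class G x then c else 0) = (\<Sum>x\<in>X. if x = y then c else 0)"
    by (rule sum.cong) (use y assms conj_class_unique in fastforce)+
  then show ?thesis using y assms(1) by simp
qed

context
  fixes G :: "('a, 'b) monoid_scheme" and X :: "'a set"
  assumes G: "group G" "finite (carrier G)" and X: "conj_class_reps G X"
begin

lemma X_carrier: "x \<in> X \<Longrightarrow> x \<in> carrier G" and finite_X: "finite X"
  using X G(2) finite_subset unfolding conj_class_reps_def by auto

lemma coch_mem_iff:
  assumes "x \<in> X" "gs \<in> tuples G n" "u \<in> carrier G"
  shows "u \<in> list_prod G gs <#\<^bsub>G\<^esub> conj_class G x \<longleftrightarrow>
    inv\<^bsub>G\<^esub> (list_prod G gs) \<otimes>\<^bsub>G\<^esub> u \<in> conj_class G x"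
  using assms G X_carrier by (intro mem_l_coset_iff conj_class_closed list_prod_closed)
    (auto simp: tuples_def)

lemma inv_prod_closed:
  assumes "gs \<in> tuples G n" "u \<in> carrier G"
  shows "inv\<^bsub>G\<^esub> (list_prod G gs) \<otimes>\<^bsub>G\<^esub> u \<in> carrier G" "list_prod G gs \<otimes>\<^bsub>G\<^esub> u \<in> carrier G"
proof -
  interpret group G by (rule G)
  have "list_prod G gs \<in> carrier G" using assms G by (auto simp: tuples_def intro!: list_prod_closed)
  then show "inv\<^bsub>G\<^esub> (list_prod G gs) \<otimes>\<^bsub>G\<^esub> u \<in> carrier G" "list_prod G gs \<otimes>\<^bsub>G\<^esub> u \<in> carrier G"
    using assms by auto
qed

lemma cochain_zero:
  assumes "\<phi> \<in> cochains G n" "gs \<notin> tuples G n \<or> u \<notin> carrier G"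
  shows "\<phi> gs u = 0"
  using assms unfolding cochains_def free_space_def by (cases "gs \<in> tuples G n") auto

lemma coch_proj_mem:
  assumes "\<phi> \<in> cochains G n" "x \<in> X"
  shows "coch_proj G x \<phi> \<in> coch_part G x n"
proof -
  have "finite {u. coch_proj G x \<phi> gs u \<noteq> 0}" for gs
    by (rule finite_subset[OF _ G(2)])
      (use cochain_zero[OF assms(1)] in \<open>auto simp: coch_proj_def split: if_splits\<close>)
  moreover have "coch_proj G x \<phi> gs = 0" if "gs \<notin> tuples G n" for gs
    using cochain_zero[OF assms(1)] that by (auto simp: coch_proj_def fun_eq_iff)
  moreover have "coch_proj G x \<phi> gs u = 0" if "u \<notin> carrier G" for gs u
    using cochain_zero[OF assms(1)] that by (auto simp: coch_proj_def)
  ultimately show ?thesis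
    by (auto simp: coch_part_def cochains_def free_space_def coch_proj_def)
qed

lemma coch_proj_sum:
  assumes "\<phi> \<in> cochains G n"
  shows "(\<Sum>x\<in>X. coch_proj G x \<phi>) = \<phi>"
proof (intro ext)
  fix gs u
  show "(\<Sum>x\<in>X. coch_proj G x \<phi>) gs u = \<phi> gs u"
  proof (cases "gs \<in> tuples G n \<and> u \<in> carrier G")
    case True
    have "(\<Sum>x\<in>X. coch_proj G x \<phi>) gs u =
      (\<Sum>x\<in>X. if inv\<^bsub>G\<^esub> (list_prod G gs) \<otimes>\<^bsub>G\<^esub> u \<in> conj_class G x then \<phi> gs u else 0)"
      unfolding sum_fun_apply coch_proj_def
      by (rule sum.cong) (use True coch_mem_iff in auto)
    also have "\<dots> = \<phi> gs u"
      using True inv_prod_closed(1) by (intro sum_conj_class[OF finite_X X]) blast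
    finally show ?thesis .
  next
    case False
    then have "\<phi> gs u = 0" using cochain_zero[OF assms] by blast
    then show ?thesis by (simp add: sum_fun_apply coch_proj_def cong: if_cong)
  qed
qed

lemma coch_proj_of_part:
  assumes "\<phi> \<in> coch_part G y n" "x \<in> X" "y \<in> X"
  shows "coch_proj G x \<phi> = (if x = y then \<phi> else 0)"
proof (intro ext)
  fix gs u
  have \<phi>: "\<phi> \<in> cochains G n" using assms by (simp add: coch_part_def)
  have "\<phi> gs u = 0 \<or> (gs \<in> tuples G n \<and> u \<in> carrier G \<and>
      u \<in> list_prod G gs <#\<^bsub>G\<^esub> conj_class G y)"
    using cochain_zero[OF \<phi>] assms(1) by (auto simp: coch_part_def free_space_def)
  moreover have "x = y" if "gs \<in> tuples G n" "u \<in> carrier G"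
    "u \<in> list_prod G gs <#\<^bsub>G\<^esub> conj_class G x" "u \<in> list_prod G gs <#\<^bsub>G\<^esub> conj_class G y"
    using conj_class_unique[OF X assms(2,3) inv_prod_closed(1)[OF that(1,2)]]
      coch_mem_iff[OF assms(2) that(1,2)] coch_mem_iff[OF assms(3) that(1,2)] that(3,4) by simp
  ultimately show "coch_proj G x \<phi> gs u = (if x = y then \<phi> else 0) gs u"
    by (cases "x = y") (auto simp: coch_proj_def)
qed

lemma chain_zero:
  assumes "c \<in> chains G n" "gs \<notin> tuples G n \<or> a \<notin> carrier G"
  shows "c gs a = 0"
  using assms unfolding chains_def free_space_def by auto

lemma ch_part_subset: "x \<in> X \<Longrightarrow> ch_part_basis G x n \<subseteq> carrier G \<times> tuples G n"
proof -
  interpret group G by (rule G)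
  assume "x \<in> X"
  then show ?thesis
    using conj_class_closed[OF G(1) X_carrier]
    by (auto simp: ch_part_basis_def tuples_def list_inv_prod list_prod_closed G subset_iff)
qed

lemma ch_proj_mem:
  assumes "c \<in> chains G n" "x \<in> X"
  shows "ch_proj G x n c \<in> ch_part G x n"
proof -
  have "finite {s. (\<lambda>(g, gs). c gs g) s \<noteq> 0}" using assms by (simp add: chains_def free_space_def)
  then have "finite {s. (\<lambda>(g, gs). ch_proj G x n c gs g) s \<noteq> 0}"
    by (rule rev_finite_subset) (auto simp: ch_proj_def split: if_splits)
  then show ?thesis by (auto simp: ch_part_def free_space_def ch_proj_def)
qed

lemma ch_proj_sum:
  assumes "c \<in> chains G n"
  shows "(\<Sum>x\<in>X. ch_proj G x n c) = c"
proof (intro ext)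
  fix gs a
  show "(\<Sum>x\<in>X. ch_proj G x n c) gs a = c gs a"
  proof (cases "gs \<in> tuples G n \<and> a \<in> carrier G")
    case True
    have "(\<Sum>x\<in>X. ch_proj G x n c) gs a =
      (\<Sum>x\<in>X. if list_prod G gs \<otimes>\<^bsub>G\<^esub> a \<in> conj_class G x then c gs a else 0)"
      unfolding sum_fun_apply ch_proj_def
      by (rule sum.cong) (use True mem_ch_part_basis_iff[OF G(1) X_carrier] in auto)
    also have "\<dots> = c gs a"
      using True inv_prod_closed(2) by (intro sum_conj_class[OF finite_X X]) blast
    finally show ?thesis .
  next
    case False
    then have "c gs a = 0" using chain_zero[OF assms] by blast
    then show ?thesis by (simp add: sum_fun_apply ch_proj_def cong: if_cong)
  qed
qed

lemma ch_proj_of_part: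
  assumes "c \<in> ch_part G y n" "x \<in> X" "y \<in> X"
  shows "ch_proj G x n c = (if x = y then c else 0)"
proof (intro ext)
  fix gs a
  have "c gs a = 0 \<or> (a, gs) \<in> ch_part_basis G y n"
    using assms(1) by (auto simp: ch_part_def free_space_def)
  then have "c gs a = 0 \<or> (gs \<in> tuples G n \<and> a \<in> carrier G \<and> (a, gs) \<in> ch_part_basis G y n)"
    using ch_part_subset[OF assms(3)] by blast
  moreover have "x = y" if "gs \<in> tuples G n" "a \<in> carrier G"
    "(a, gs) \<in> ch_part_basis G x n" "(a, gs) \<in> ch_part_basis G y n"
    using conj_class_unique[OF X assms(2,3) inv_prod_closed(2)[OF that(1,2)]]
      mem_ch_part_basis_iff[OF G(1) X_carrier[OF assms(2)] that(2,1)]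
      mem_ch_part_basis_iff[OF G(1) X_carrier[OF assms(3)] that(2,1)] that(3,4) by simp
  ultimately show "ch_proj G x n c gs a = (if x = y then c else 0) gs a"
    by (cases "x = y") (auto simp: ch_proj_def)
qed

end

end

theory Submission
  imports Defs
begin

text \<open>Both halves of \<open>\<D>\<^sup>*(kG, kG)\<close> are complexes of one groupoid. Let \<open>G\<close> act on itself by conjugation, with an
  arrow \<open>g\<close> from \<open>u\<close> to \<open>g\<^sup>-\<^sup>1 u g\<close>. If a cochain \<open>\<phi>\<close> is recorded by the coefficients of \<open>u g\<^sub>1 \<cdots> g\<^sub>n\<close> in
  \<open>\<phi>(g\<^sub>1, \<dots>, g\<^sub>n)\<close>, the Hochschild differential becomes the normalized coboundary, with trivial
  coefficients, on the nerve of this groupoid (\<open>gpd_coord_coch_diff\<close>). The sum of the Tate complexes is, in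
  degrees \<open>\<ge> 0\<close>, the same construction for the full subgroupoid on \<open>X\<close>, which is a skeleton with automorphism
  groups \<open>C\<^sub>G(x)\<close>.

  A skeleton is a strong deformation retract. The representatives \<open>\<gamma>\<^bsub>i,x\<^esub>\<close> are a choice of arrows
  from \<open>x\<close> to \<open>x\<^sub>i\<close>, that is, a natural transformation from the retraction functor
  \<open>(u, g) \<mapsto> (x, \<gamma> g \<gamma>'\<^sup>-\<^sup>1)\<close> to the identity. In these terms \<open>\<iota>\<close> is restriction to \<open>X\<close>, \<open>\<rho>\<close> is
  pullback along the retraction and \<open>s\<close> is the prism operator of the transformation. The homotopy formula
  is the prism identity \<open>cobd_prism\<close>, and \<open>\<gamma>\<^bsub>1,x\<^esub> = 1\<close> gives the retraction property. The locale
  \<open>class_transversal\<close> matches the given indices \<open>s\<^sub>i\<^sup>j\<close> and elements \<open>h\<^sub>i\<^sub>j\<close> with this picture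
  (\<open>coset_decomp_gam\<close>).

  On chains every map is the transpose of the corresponding map on cochains, under the pairing of chains with
  normalized functions on the nerve (\<open>pairing_ch_diff\<close>, \<open>pairing_hom_iota\<close>, \<open>class_pairing_hom_rho\<close>,
  \<open>pairing_hom_s\<close>). As these functions separate chains (\<open>chain_eqI\<close>), the homological
  identities need no second computation.

  The halves are joined by \<open>\<tau>\<close>, whose matrix entry at \<open>(u, h)\<close> is the number of \<open>g\<close> with \<open>g h g\<^sup>-\<^sup>1 = u\<close>. It
  is a class function in both variables, and for \<open>h = x\<close> it is \<open>|C\<^sub>G(x)|\<close> on the class of \<open>x\<close> and \<open>0\<close> elsewhere
  (\<open>conjugator_count_rep\<close>); this is the norm of the Tate complex.\<close>

section \<open>Cochains on the nerve of the conjugation groupoid\<close>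

definition conj_by :: "('a, 'b) monoid_scheme \<Rightarrow> 'a \<Rightarrow> 'a \<Rightarrow> 'a"
  where "conj_by G u g = inv\<^bsub>G\<^esub> g \<otimes>\<^bsub>G\<^esub> u \<otimes>\<^bsub>G\<^esub> g"

text \<open>The value of \<open>\<psi>\<close> on the face that multiplies the first two entries of \<open>g # l\<close>. For \<open>l = []\<close>
  there is nothing to multiply and the value is that of the face which drops the last entry, so
  that one formula covers both kinds of faces.\<close>

definition absorb :: "('a, 'b) monoid_scheme \<Rightarrow> 'a \<Rightarrow> ('a list \<Rightarrow> 'k) \<Rightarrow> 'a list \<Rightarrow> 'k"
  where "absorb G g \<psi> l = (case l of [] \<Rightarrow> \<psi> [] | a # l' \<Rightarrow> \<psi> ((g \<otimes>\<^bsub>G\<^esub> a) # l'))"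

text \<open>The alternating sum over all faces of a simplex except the one that removes its first arrow; these
  are the faces that keep the source object. The recursion peels off the first arrow and
  changes \<open>\<psi>\<close>, so the simplicial identities become short inductions with \<open>\<psi>\<close> arbitrary.
  The sum over \<^const>\<open>merge_at\<close> is recovered in \<open>upper_cobd_eq_sum\<close>.\<close>

fun upper_cobd :: "('a, 'b) monoid_scheme \<Rightarrow> ('a list \<Rightarrow> 'k::field) \<Rightarrow> 'a list \<Rightarrow> 'k"
  where
    "upper_cobd G \<psi> [] = 0"
  | "upper_cobd G \<psi> (g # l) = - absorb G g \<psi> l - upper_cobd G (\<lambda>l. \<psi> (g # l)) l"

text \<open>The coboundary on the nerve of the conjugation groupoid: objects are the elements \<open>u\<close>, and \<open>g\<close> is
  an arrow from \<open>u\<close> to \<open>g\<^sup>-\<^sup>1 u g\<close>. The value \<open>0\<close> on the empty list makes the homotopy formula hold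
  in degree \<open>0\<close>, where the term \<open>\<delta> s\<close> is absent.\<close>

fun cobd :: "('a, 'b) monoid_scheme \<Rightarrow> ('a \<Rightarrow> 'a list \<Rightarrow> 'k::field) \<Rightarrow> 'a \<Rightarrow> 'a list \<Rightarrow> 'k"
  where
    "cobd G f u [] = 0"
  | "cobd G f u (g # l) = f (conj_by G u g) l + upper_cobd G (f u) (g # l)"

text \<open>The arrow \<open>g\<close> out of \<open>u\<close>, carried back along \<open>\<gamma>\<close> to an automorphism of the representative of \<open>u\<close>;
  these are the \<open>h\<^sub>i\<^sub>j\<close>.\<close>

definition loop :: "('a, 'b) monoid_scheme \<Rightarrow> ('a \<Rightarrow> 'a) \<Rightarrow> 'a \<Rightarrow> 'a \<Rightarrow> 'a"
  where "loop G \<gamma> u g = \<gamma> u \<otimes>\<^bsub>G\<^esub> g \<otimes>\<^bsub>G\<^esub> inv\<^bsub>G\<^esub> (\<gamma> (conj_by G u g))"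

fun loops :: "('a, 'b) monoid_scheme \<Rightarrow> ('a \<Rightarrow> 'a) \<Rightarrow> 'a \<Rightarrow> 'a list \<Rightarrow> 'a list"
  where
    "loops G \<gamma> u [] = []"
  | "loops G \<gamma> u (g # l) = loop G \<gamma> u g # loops G \<gamma> (conj_by G u g) l"

text \<open>The prism operator of the natural transformation \<open>\<gamma>\<close>, from the retraction onto the
  representatives to the identity, composed with \<open>\<psi>\<close>.\<close>

fun prism :: "('a, 'b) monoid_scheme \<Rightarrow> ('a \<Rightarrow> 'a) \<Rightarrow> ('a list \<Rightarrow> 'k::field) \<Rightarrow> 'a \<Rightarrow> 'a list \<Rightarrow> 'k"
  where
    "prism G \<gamma> \<psi> u [] = \<psi> [\<gamma> u]"
  | "prism G \<gamma> \<psi> u (g # l) =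
      \<psi> (\<gamma> u # g # l) - prism G \<gamma> (\<lambda>l. \<psi> (loop G \<gamma> u g # l)) (conj_by G u g) l"

definition normalized :: "('a, 'b) monoid_scheme \<Rightarrow> ('a list \<Rightarrow> 'k::zero) \<Rightarrow> bool"
  where "normalized G \<psi> \<longleftrightarrow> (\<forall>l. \<one>\<^bsub>G\<^esub> \<in> set l \<longrightarrow> \<psi> l = 0)"

lemma absorb_simps [simp]:
  "absorb G g \<psi> [] = \<psi> []" "absorb G g \<psi> (a # l) = \<psi> ((g \<otimes>\<^bsub>G\<^esub> a) # l)"
  by (simp_all add: absorb_def)

lemma absorb_lin:
  "absorb G g (\<lambda>l. \<psi> l + \<psi>' l) gs = absorb G g \<psi> gs + absorb G g \<psi>' gs"
  "absorb G g (\<lambda>l. \<psi> l - \<psi>' l) gs = absorb G g \<psi> gs - absorb G g \<psi>' gs"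
  "absorb G g (\<lambda>l. - \<psi> l) gs = - absorb G g \<psi> gs"
  "absorb G g (\<lambda>l. 0) gs = (0::'k::field)"
  for \<psi> :: "'a list \<Rightarrow> 'k::field"
  by (cases gs; simp)+

lemma upper_cobd_add:
  "upper_cobd G (\<lambda>l. \<psi> l + \<psi>' l) gs = upper_cobd G \<psi> gs + upper_cobd G \<psi>' gs"
  by (induction gs arbitrary: \<psi> \<psi>') (simp_all add: absorb_lin)

lemma upper_cobd_diff:
  "upper_cobd G (\<lambda>l. \<psi> l - \<psi>' l) gs = upper_cobd G \<psi> gs - upper_cobd G \<psi>' gs"
  by (induction gs arbitrary: \<psi> \<psi>') (simp_all add: absorb_lin)

lemma upper_cobd_minus: "upper_cobd G (\<lambda>l. - \<psi> l) gs = - upper_cobd G \<psi> gs"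
  by (induction gs arbitrary: \<psi>) (simp_all add: absorb_lin)

lemma upper_cobd_zero: "upper_cobd G (\<lambda>l. 0) gs = 0"
  by (induction gs) (simp_all add: absorb_lin)

lemmas upper_cobd_lin = upper_cobd_add upper_cobd_diff upper_cobd_minus upper_cobd_zero

lemma prism_add:
  "prism G \<gamma> (\<lambda>l. \<psi> l + \<psi>' l) u gs = prism G \<gamma> \<psi> u gs + prism G \<gamma> \<psi>' u gs"
  by (induction gs arbitrary: \<psi> \<psi>' u) simp_all

lemma prism_diff:
  "prism G \<gamma> (\<lambda>l. \<psi> l - \<psi>' l) u gs = prism G \<gamma> \<psi> u gs - prism G \<gamma> \<psi>' u gs"
  by (induction gs arbitrary: \<psi> \<psi>' u) simp_all

lemma prism_minus: "prism G \<gamma> (\<lambda>l. - \<psi> l) u gs = - prism G \<gamma> \<psi> u gs"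
  by (induction gs arbitrary: \<psi> u) simp_all

lemma prism_zero: "prism G \<gamma> (\<lambda>l. 0) u gs = 0"
  by (induction gs arbitrary: u) simp_all

lemmas prism_lin = prism_add prism_diff prism_minus prism_zero

lemma upper_cobd_scale: "upper_cobd G (\<lambda>l. c * \<psi> l) gs = c * upper_cobd G \<psi> gs"
proof (induction gs arbitrary: \<psi>)
  case (Cons g l)
  have "absorb G g (\<lambda>l. c * \<psi> l) l = c * absorb G g \<psi> l" by (cases l) simp_all
  then show ?case using Cons by (simp add: right_diff_distrib)
qed simp

lemma prism_scale: "prism G \<gamma> (\<lambda>l. c * \<psi> l) u gs = c * prism G \<gamma> \<psi> u gs"
  by (induction gs arbitrary: \<psi> u) (simp_all add: right_diff_distrib)

lemma cobd_add: "cobd G (\<lambda>u l. f u l + f' u l) u gs = cobd G f u gs + cobd G f' u gs"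
  by (cases gs) (simp_all only: cobd.simps upper_cobd_add, simp_all)

lemma cobd_scale: "cobd G (\<lambda>u l. c * f u l) u gs = c * cobd G f u gs"
  by (cases gs) (simp_all only: cobd.simps upper_cobd_scale, simp_all add: distrib_left)

lemma upper_cobd_cong:
  assumes "\<And>l. set l \<subseteq> A \<Longrightarrow> Suc (length l) = length gs \<Longrightarrow> \<psi> l = \<psi>' l"
    and "set gs \<subseteq> A" "\<And>a b. a \<in> A \<Longrightarrow> b \<in> A \<Longrightarrow> a \<otimes>\<^bsub>G\<^esub> b \<in> A"
  shows "upper_cobd G \<psi> gs = upper_cobd G \<psi>' gs"
  using assms(1,2)
proof (induction gs arbitrary: \<psi> \<psi>')
  case (Cons g l)
  have "upper_cobd G (\<lambda>l. \<psi> (g # l)) l = upper_cobd G (\<lambda>l. \<psi>' (g # l)) l"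
    using Cons.prems by (intro Cons.IH) auto
  moreover have "absorb G g \<psi> l = absorb G g \<psi>' l"
    using Cons.prems assms(3) by (cases l) auto
  ultimately show ?case by simp
qed simp

lemma cobd_cong:
  assumes "\<And>v l. v \<in> B \<Longrightarrow> set l \<subseteq> A \<Longrightarrow> Suc (length l) = length gs \<Longrightarrow> f v l = f' v l"
    and "u \<in> B" "set gs \<subseteq> A" "\<And>a b. a \<in> A \<Longrightarrow> b \<in> A \<Longrightarrow> a \<otimes>\<^bsub>G\<^esub> b \<in> A"
    and "\<And>v a. v \<in> B \<Longrightarrow> a \<in> A \<Longrightarrow> conj_by G v a \<in> B"
  shows "cobd G f u gs = cobd G f' u gs"
proof (cases gs)
  case (Cons g l)
  have "upper_cobd G (f u) gs = upper_cobd G (f' u) gs"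
    using assms by (intro upper_cobd_cong[of A]) auto
  moreover have "f (conj_by G u g) l = f' (conj_by G u g) l"
    using assms Cons by auto
  ultimately show ?thesis by (simp add: Cons)
qed simp

lemma upper_cobd_eq_sum:
  assumes "length gs = n + 1"
  shows "upper_cobd G \<psi> gs =
    (\<Sum>i=1..n. (-1) ^ i * \<psi> (merge_at G i gs)) + (-1) ^ (n + 1) * \<psi> (take n gs)"
  using assms
proof (induction gs arbitrary: \<psi> n)
  case (Cons g l)
  show ?case
  proof (cases l)
    case Nil
    with Cons show ?thesis by simp
  next
    case (Cons a l')
    obtain m where m: "n = Suc m" using Cons Cons.prems by (cases n) auto
    have merge: "merge_at G (Suc i) (g # l) = g # merge_at G i l" if "i \<ge> 1" for i
      using that by (cases i) (auto simp: merge_at_def)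
    have "(\<Sum>i=1..n. (-1) ^ i * \<psi> (merge_at G i (g # l))) =
      - \<psi> (merge_at G 1 (g # l)) + (\<Sum>i=1..m. (-1) ^ Suc i * \<psi> (merge_at G (Suc i) (g # l)))"
      unfolding m by (subst sum.atLeast_Suc_atMost, simp)
        (simp only: sum.shift_bounds_cl_Suc_ivl, simp)
    also have "(\<Sum>i=1..m. (-1) ^ Suc i * \<psi> (merge_at G (Suc i) (g # l))) =
      - (\<Sum>i=1..m. (-1) ^ i * \<psi> (g # merge_at G i l))"
      unfolding sum_negf[symmetric] by (rule sum.cong) (auto simp: merge)
    finally have sum: "(\<Sum>i=1..n. (-1) ^ i * \<psi> (merge_at G i (g # l))) =
      - absorb G g \<psi> l - (\<Sum>i=1..m. (-1) ^ i * \<psi> (g # merge_at G i l))"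
      by (simp add: merge_at_def Cons)
    have "length l = m + 1" using Cons.prems m by simp
    from Cons.IH[OF this, of "\<lambda>l. \<psi> (g # l)"] show ?thesis
      unfolding sum by (simp add: m)
  qed
qed simp

lemma cobd_eq_sum:
  assumes "length gs = n + 1"
  shows "cobd G f u gs = f (conj_by G u (gs ! 0)) (drop 1 gs) +
    (\<Sum>i=1..n. (-1) ^ i * f u (merge_at G i gs)) + (-1) ^ (n + 1) * f u (take n gs)"
proof -
  obtain g l where gs: "gs = g # l" using assms by (cases gs) auto
  show ?thesis
    using upper_cobd_eq_sum[OF assms, of G "f u"] unfolding gs cobd.simps by simp
qed

context group
begin

lemma conj_by_closed [simp, intro]: "u \<in> carrier G \<Longrightarrow> g \<in> carrier G \<Longrightarrow> conj_by G u g \<in> carrier G"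
  by (simp add: conj_by_def)

lemma conj_by_mult:
  "u \<in> carrier G \<Longrightarrow> g \<in> carrier G \<Longrightarrow> h \<in> carrier G \<Longrightarrow> conj_by G (conj_by G u g) h = conj_by G u (g \<otimes> h)"
  by (simp add: conj_by_def inv_mult_group m_assoc)

lemma conj_by_one [simp]: "u \<in> carrier G \<Longrightarrow> conj_by G u \<one> = u"
  by (simp add: conj_by_def)

text \<open>Associativity makes the two ways of multiplying three neighbouring entries agree; the other pairs of
  faces that keep the source commute by the shape of the recursion.\<close>

lemma upper_cobd_absorb:
  assumes "g \<in> carrier G" "set l \<subseteq> carrier G"
  shows "upper_cobd G (absorb G g \<psi>) l = absorb G g (upper_cobd G \<psi>) l"
proof (cases l)
  case (Cons a l')
  have "absorb G a (absorb G g \<psi>) l' = absorb G (g \<otimes> a) \<psi> l'"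
    using assms Cons by (cases l') (auto simp: m_assoc)
  then show ?thesis by (simp add: Cons)
qed simp

lemma upper_cobd_upper_cobd:
  "set gs \<subseteq> carrier G \<Longrightarrow> upper_cobd G (upper_cobd G \<psi>) gs = 0"
proof (induction gs arbitrary: \<psi>)
  case (Cons g l)
  have "upper_cobd G (upper_cobd G \<psi>) (g # l) = - absorb G g (upper_cobd G \<psi>) l
      - upper_cobd G (\<lambda>l. - absorb G g \<psi> l - upper_cobd G (\<lambda>l. \<psi> (g # l)) l) l"
    by simp
  also have "\<dots> = - absorb G g (upper_cobd G \<psi>) l + upper_cobd G (absorb G g \<psi>) l
      + upper_cobd G (upper_cobd G (\<lambda>l. \<psi> (g # l))) l"
    unfolding upper_cobd_lin by simp
  also have "\<dots> = 0"
    using Cons upper_cobd_absorb[of g l \<psi>] by simp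
  finally show ?case .
qed simp

lemma cobd_cobd:
  assumes "u \<in> carrier G" "set gs \<subseteq> carrier G" "length gs \<ge> 2"
  shows "cobd G (cobd G f) u gs = 0"
proof -
  obtain g a l where gs: "gs = g # a # l"
    using assms(3) by (auto simp: Suc_le_length_iff numeral_2_eq_2)
  define head where "head = (\<lambda>l. case l of [] \<Rightarrow> 0 | g # l' \<Rightarrow> f (conj_by G u g) l')"
  have split: "cobd G f u = (\<lambda>l. head l + upper_cobd G (f u) l)"
    by (intro ext) (auto simp: head_def split: list.splits)
  have "upper_cobd G head gs = - f (conj_by G u (g \<otimes> a)) l - upper_cobd G (f (conj_by G u g)) (a # l)"
    by (simp add: gs head_def del: upper_cobd.simps(2))
      (simp add: head_def)
  moreover have "cobd G (cobd G f) u gs = cobd G f (conj_by G u g) (a # l) + upper_cobd G (cobd G f u) gs"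
    by (simp add: gs)
  moreover have "upper_cobd G (cobd G f u) gs = upper_cobd G head gs"
    using upper_cobd_upper_cobd[OF assms(2), of "f u"] by (simp add: split upper_cobd_lin)
  ultimately show ?thesis
    using assms by (simp add: gs conj_by_mult)
qed

lemma normalized_tail: "normalized G \<psi> \<Longrightarrow> normalized G (\<lambda>l. \<psi> (g # l))"
  "normalized G \<psi> \<Longrightarrow> (\<lambda>l. \<psi> (\<one> # l)) = (\<lambda>l. 0)"
  by (auto simp: normalized_def)

lemma absorb_one: "set l \<subseteq> carrier G \<Longrightarrow> absorb G \<one> \<psi> l = \<psi> l"
  by (cases l) auto

text \<open>Two faces next to the unit multiply it into its neighbours (or drop it, if it is last); they give
  the same list with opposite signs, and all other faces still contain the unit.\<close>

lemma upper_cobd_degenerate: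
  assumes "normalized G \<psi>" "g \<in> carrier G" "set l \<subseteq> carrier G" "\<one> \<in> set l"
  shows "upper_cobd G \<psi> (g # l) = 0"
  using assms
proof (induction l arbitrary: \<psi> g)
  case (Cons a l)
  show ?case
  proof (cases "\<one> \<in> set l")
    case True
    have "upper_cobd G (\<lambda>l. \<psi> (g # l)) (a # l) = 0"
      using Cons.prems True by (intro Cons.IH normalized_tail) auto
    moreover have "\<psi> ((g \<otimes> a) # l) = 0"
      using Cons.prems(1) True by (simp add: normalized_def)
    ultimately show ?thesis by (simp del: upper_cobd.simps(2) add: upper_cobd.simps(2)[of _ _ g])
  next
    case False
    then have a: "a = \<one>" using Cons.prems by simp
    have "(\<lambda>l. \<psi> (g # \<one> # l)) = (\<lambda>l. 0)"
      using Cons.prems(1) by (auto simp: normalized_def)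
    then show ?thesis
      using Cons.prems by (simp add: a absorb_one upper_cobd_lin)
  qed
qed simp

lemma cobd_degenerate:
  assumes "\<And>v. normalized G (f v)" "u \<in> carrier G" "set gs \<subseteq> carrier G" "\<one> \<in> set gs"
  shows "cobd G f u gs = 0"
proof -
  obtain g l where gs: "gs = g # l" using assms(4) by (cases gs) auto
  show ?thesis
  proof (cases "\<one> \<in> set l")
    case True
    then have "f (conj_by G u g) l = 0" using assms(1) by (auto simp: normalized_def)
    then show ?thesis
      using upper_cobd_degenerate[OF assms(1), of g l u] assms(2,3) True by (simp add: gs)
  next
    case False
    then have "g = \<one>" using assms gs by simp
    then show ?thesis
      using assms(2,3) assms(1)[of u] by (simp add: gs absorb_one normalized_tail(2)[of "f u"] upper_cobd_lin)
  qed
qed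

end

section \<open>Contraction onto a skeleton\<close>

text \<open>Every object \<open>u\<close> is joined to a representative \<open>rep u\<close> of its isomorphism class by the
  arrow \<open>\<gamma> u\<close>. The normalization \<open>\<gamma> = 1\<close> on representatives makes the retraction strict.\<close>

locale skeleton = group G for G (structure) +
  fixes rep \<gamma> :: "'a \<Rightarrow> 'a"
  assumes rep_closed [simp, intro]: "u \<in> carrier G \<Longrightarrow> rep u \<in> carrier G"
    and gam_closed [simp, intro]: "u \<in> carrier G \<Longrightarrow> \<gamma> u \<in> carrier G"
    and conj_by_gam: "u \<in> carrier G \<Longrightarrow> conj_by G (rep u) (\<gamma> u) = u"
    and rep_conj_by: "u \<in> carrier G \<Longrightarrow> g \<in> carrier G \<Longrightarrow> rep (conj_by G u g) = rep u"
    and gam_rep: "u \<in> carrier G \<Longrightarrow> \<gamma> (rep u) = \<one>"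
begin

lemma loop_closed [simp, intro]: "u \<in> carrier G \<Longrightarrow> g \<in> carrier G \<Longrightarrow> loop G \<gamma> u g \<in> carrier G"
  by (simp add: loop_def)

lemma loops_closed: "u \<in> carrier G \<Longrightarrow> set l \<subseteq> carrier G \<Longrightarrow> set (loops G \<gamma> u l) \<subseteq> carrier G"
  by (induction l arbitrary: u) auto

lemma loop_gam:
  "u \<in> carrier G \<Longrightarrow> g \<in> carrier G \<Longrightarrow> loop G \<gamma> u g \<otimes> \<gamma> (conj_by G u g) = \<gamma> u \<otimes> g"
  by (simp add: loop_def m_assoc)

lemma loop_mult:
  assumes "u \<in> carrier G" "g \<in> carrier G" "h \<in> carrier G"
  shows "loop G \<gamma> u g \<otimes> loop G \<gamma> (conj_by G u g) h = loop G \<gamma> u (g \<otimes> h)"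
proof -
  have "loop G \<gamma> u g \<otimes> loop G \<gamma> (conj_by G u g) h =
    (loop G \<gamma> u g \<otimes> \<gamma> (conj_by G u g)) \<otimes> (h \<otimes> inv (\<gamma> (conj_by G (conj_by G u g) h)))"
    using assms by (simp add: loop_def[of G \<gamma> "conj_by G u g"] m_assoc)
  then show ?thesis
    using assms by (simp only: loop_gam) (simp add: loop_def m_assoc conj_by_mult)
qed

lemma conj_by_loop:
  assumes "u \<in> carrier G" "g \<in> carrier G"
  shows "conj_by G (rep u) (loop G \<gamma> u g) = rep u"
proof -
  let ?v = "conj_by G u g"
  have "conj_by G (rep u) (loop G \<gamma> u g) = conj_by G (conj_by G (conj_by G (rep u) (\<gamma> u)) g) (inv (\<gamma> ?v))"
    using assms by (simp add: conj_by_mult loop_def)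
  also have "\<dots> = conj_by G (conj_by G (rep ?v) (\<gamma> ?v)) (inv (\<gamma> ?v))"
    using assms by (simp add: conj_by_gam)
  also have "\<dots> = rep u" using assms by (simp add: conj_by_mult rep_conj_by)
  finally show ?thesis .
qed

lemma loop_one [simp]: "u \<in> carrier G \<Longrightarrow> loop G \<gamma> u \<one> = \<one>"
  by (simp add: loop_def)

lemma one_in_loops:
  "u \<in> carrier G \<Longrightarrow> set l \<subseteq> carrier G \<Longrightarrow> \<one> \<in> set l \<Longrightarrow> \<one> \<in> set (loops G \<gamma> u l)"
  by (induction l arbitrary: u) force+

lemma prism_degenerate:
  assumes "normalized G \<psi>" "u \<in> carrier G" "set l \<subseteq> carrier G" "\<one> \<in> set l"
  shows "prism G \<gamma> \<psi> u l = 0"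
  using assms
proof (induction l arbitrary: \<psi> u)
  case (Cons g l)
  have "\<psi> (\<gamma> u # g # l) = 0" using Cons.prems by (simp add: normalized_def)
  moreover have "prism G \<gamma> (\<lambda>l. \<psi> (loop G \<gamma> u g # l)) (conj_by G u g) l = 0"
  proof (cases "g = \<one>")
    case True
    then show ?thesis using Cons.prems by (simp add: normalized_tail(2)[of \<psi>] prism_lin)
  next
    case False
    then show ?thesis using Cons.prems by (intro Cons.IH normalized_tail) auto
  qed
  ultimately show ?case by simp
qed simp

lemma upper_cobd_loops:
  assumes "u \<in> carrier G" "set l \<subseteq> carrier G"
  shows "upper_cobd G (\<lambda>l. \<psi> (loops G \<gamma> u l)) l = upper_cobd G \<psi> (loops G \<gamma> u l)"
  using assms
proof (induction l arbitrary: u \<psi>)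
  case (Cons g l)
  have "absorb G g (\<lambda>l. \<psi> (loops G \<gamma> u l)) l = absorb G (loop G \<gamma> u g) \<psi> (loops G \<gamma> (conj_by G u g) l)"
    using Cons.prems by (cases l) (auto simp: loop_mult conj_by_mult)
  then show ?case
    using Cons.IH[of "conj_by G u g" "\<lambda>l. \<psi> (loop G \<gamma> u g # l)"] Cons.prems by simp
qed simp

text \<open>The retraction onto the representatives is a functor, hence induces a cochain map.\<close>

lemma cobd_loops:
  assumes "u \<in> carrier G" "set gs \<subseteq> carrier G"
  shows "cobd G (\<lambda>u l. f (rep u) (loops G \<gamma> u l)) u gs = cobd G f (rep u) (loops G \<gamma> u gs)"
proof (cases gs)
  case (Cons g l)
  have "upper_cobd G (\<lambda>l. f (rep u) (loops G \<gamma> u l)) (g # l) =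
      upper_cobd G (f (rep u)) (loops G \<gamma> u (g # l))"
    using assms Cons by (intro upper_cobd_loops) auto
  then show ?thesis
    using assms unfolding Cons cobd.simps loops.simps
    by (simp add: conj_by_loop rep_conj_by del: upper_cobd.simps)
qed simp

text \<open>In the induction on the list all terms that do not involve the induction hypothesis cancel after
  one more case distinction, by \<open>\<eta>(g) \<gamma> = \<gamma> g\<close> and the multiplicativity of \<open>\<eta> = loop\<close>. The surviving
  term is the last face of the last prism simplex.\<close>

lemma prism_upper_cobd:
  assumes "u \<in> carrier G" "set gs \<subseteq> carrier G"
  shows "upper_cobd G (prism G \<gamma> \<psi> u) gs + prism G \<gamma> (upper_cobd G \<psi>) u gs = - \<psi> (loops G \<gamma> u gs)"
  using assms
proof (induction gs arbitrary: u \<psi>)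
  case (Cons g l)
  let ?v = "conj_by G u g" and ?h = "loop G \<gamma> u g"
  let ?\<psi> = "\<lambda>l. \<psi> (?h # l)"
  have IH: "upper_cobd G (prism G \<gamma> ?\<psi> ?v) l + prism G \<gamma> (upper_cobd G ?\<psi>) ?v l =
      - \<psi> (?h # loops G \<gamma> ?v l)"
    using Cons by auto
  \<comment> \<open>The faces that multiply the first arrow with its neighbour.\<close>
  have rest: "absorb G g (prism G \<gamma> \<psi> u) l =
      prism G \<gamma> (absorb G ?h \<psi>) ?v l - \<psi> ((\<gamma> u \<otimes> g) # l) + absorb G g (\<lambda>l. \<psi> (\<gamma> u # l)) l"
  proof (cases l)
    case Nil
    then show ?thesis using Cons.prems by (simp add: loop_gam)
  next
    case (Cons a l')
    then show ?thesis using Cons.prems by (simp add: loop_gam loop_mult conj_by_mult)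
  qed
  show ?case
    using IH rest by (simp add: upper_cobd_lin prism_lin)
qed simp

text \<open>The face missing from \<open>upper_cobd\<close> removes the first arrow of a prism simplex. On the first simplex
  that arrow is \<open>\<gamma> u\<close>, whose target is \<open>u\<close>, and the identity term appears; on the others it is a loop at
  the representative, and the result cancels against the first face of the base.\<close>

lemma cobd_prism:
  assumes "u \<in> carrier G" "set gs \<subseteq> carrier G"
  shows "cobd G (\<lambda>u. prism G \<gamma> (f (rep u)) u) u gs + prism G \<gamma> (cobd G f (rep u)) u gs =
    f u gs - f (rep u) (loops G \<gamma> u gs)"
proof -
  define head where "head = (\<lambda>l. case l of [] \<Rightarrow> 0 | g # l' \<Rightarrow> f (conj_by G (rep u) g) l')"
  have split: "cobd G f (rep u) = (\<lambda>l. head l + upper_cobd G (f (rep u)) l)"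
    by (intro ext) (auto simp: head_def split: list.splits)
  have "prism G \<gamma> head u gs =
    f u gs - (case gs of [] \<Rightarrow> 0 | g # l \<Rightarrow> prism G \<gamma> (f (rep u)) (conj_by G u g) l)"
    using assms by (cases gs) (auto simp: head_def conj_by_gam conj_by_loop)
  moreover have "cobd G (\<lambda>u. prism G \<gamma> (f (rep u)) u) u gs =
    (case gs of [] \<Rightarrow> 0 | g # l \<Rightarrow> prism G \<gamma> (f (rep u)) (conj_by G u g) l) +
    upper_cobd G (prism G \<gamma> (f (rep u)) u) gs"
    using assms by (cases gs) (auto simp: rep_conj_by)
  ultimately show ?thesis
    using prism_upper_cobd[OF assms, of "f (rep u)"] by (simp add: split prism_lin)
qed

lemma length_loops [simp]: "length (loops G \<gamma> u l) = length l"
  by (induction l arbitrary: u) auto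

lemma loops_stabilize:
  "u \<in> carrier G \<Longrightarrow> set l \<subseteq> carrier G \<Longrightarrow> h \<in> set (loops G \<gamma> u l) \<Longrightarrow>
    h \<in> carrier G \<and> conj_by G (rep u) h = rep u"
proof (induction l arbitrary: u)
  case (Cons g l)
  then show ?case
    using Cons.IH[of "conj_by G u g"] by (auto simp: conj_by_loop rep_conj_by)
qed simp

lemma prism_cong:
  assumes "\<And>l. set l \<subseteq> carrier G \<Longrightarrow> length l = Suc (length gs) \<Longrightarrow> \<psi> l = \<psi>' l"
    and "u \<in> carrier G" "set gs \<subseteq> carrier G"
  shows "prism G \<gamma> \<psi> u gs = prism G \<gamma> \<psi>' u gs"
  using assms
proof (induction gs arbitrary: \<psi> \<psi>' u)
  case (Cons g l)
  have "prism G \<gamma> (\<lambda>l. \<psi> (loop G \<gamma> u g # l)) (conj_by G u g) l =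
    prism G \<gamma> (\<lambda>l. \<psi>' (loop G \<gamma> u g # l)) (conj_by G u g) l"
    using Cons.prems by (intro Cons.IH) auto
  then show ?case using Cons.prems by simp
qed simp

lemma loops_eq_self:
  assumes "u \<in> carrier G" "rep u = u" "\<And>h. h \<in> set l \<Longrightarrow> h \<in> carrier G \<and> conj_by G u h = u"
  shows "loops G \<gamma> u l = l"
  using assms gam_rep[of u] by (induction l) (auto simp: loop_def)

end


section \<open>Class representatives and coset decompositions\<close>

lemma s_index_Cons:
  "s_index G N \<gamma> x i (g # gs) (Suc j) =
    s_index G N \<gamma> x (snd (coset_decomp G N \<gamma> x (\<gamma> x i \<otimes>\<^bsub>G\<^esub> g))) gs j"
  by (induction j) simp_all

lemma h_tuple_Nil [simp]: "h_tuple G N \<gamma> x i [] = []"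
  by (simp add: h_tuple_def)

lemma h_tuple_Cons:
  "h_tuple G N \<gamma> x i (g # gs) =
    fst (coset_decomp G N \<gamma> x (\<gamma> x i \<otimes>\<^bsub>G\<^esub> g)) #
    h_tuple G N \<gamma> x (snd (coset_decomp G N \<gamma> x (\<gamma> x i \<otimes>\<^bsub>G\<^esub> g))) gs"
  unfolding h_tuple_def length_Cons upt_conv_Cons[OF zero_less_Suc] map_Suc_upt[symmetric]
  by (simp add: s_index_Cons del: s_index.simps(2))

lemma insert_tuple_0: "insert_tuple G N \<gamma> x i gs 0 = \<gamma> x i # gs"
  by (simp add: insert_tuple_def)

lemma insert_tuple_Cons:
  "insert_tuple G N \<gamma> x i (g # gs) (Suc j) =
    fst (coset_decomp G N \<gamma> x (\<gamma> x i \<otimes>\<^bsub>G\<^esub> g)) #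
    insert_tuple G N \<gamma> x (snd (coset_decomp G N \<gamma> x (\<gamma> x i \<otimes>\<^bsub>G\<^esub> g))) gs j"
  by (simp add: insert_tuple_def h_tuple_Cons s_index_Cons del: s_index.simps(2))

lemma list_prod_simps [simp]:
  "list_prod G [] = \<one>\<^bsub>G\<^esub>" "list_prod G (g # gs) = g \<otimes>\<^bsub>G\<^esub> list_prod G gs"
  by (simp_all add: list_prod_def)

locale class_transversal = group G for G (structure) +
  fixes X :: "'a set" and N :: "'a \<Rightarrow> nat" and \<gamma> :: "'a \<Rightarrow> nat \<Rightarrow> 'a"
  assumes fin: "finite (carrier G)"
    and X: "conj_class_reps G X"
    and cosets: "\<And>x. x \<in> X \<Longrightarrow> right_coset_reps G (centralizer G x) (N x) (\<gamma> x)"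
begin

text \<open>The pairs \<open>(x, i)\<close> with \<open>1 \<le> i \<le> n\<^sub>x\<close> correspond to the elements \<open>x\<^sub>i\<close> of \<open>G\<close>. Indexing by the group element
  \<open>u = x\<^sub>i\<close> instead removes the sum over the classes from all later computations.\<close>

definition class_rep :: "'a \<Rightarrow> 'a"
  where "class_rep u = (THE x. x \<in> X \<and> u \<in> conj_class G x)"

definition idx :: "'a \<Rightarrow> nat"
  where "idx u = (THE i. i \<in> {1..N (class_rep u)} \<and> conj_rep G \<gamma> (class_rep u) i = u)"

definition gam :: "'a \<Rightarrow> 'a"
  where "gam u = \<gamma> (class_rep u) (idx u)"

lemma X_closed [simp, intro]: "x \<in> X \<Longrightarrow> x \<in> carrier G"
  by (rule X_carrier[OF is_group fin X])

lemma fin_X: "finite X"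
  by (rule finite_X[OF is_group fin X])

lemma conj_class_eq: "conj_class G x = conj_by G x ` carrier G"
  by (auto simp: conj_class_def conj_by_def)

lemma centralizer_eq: "x \<in> carrier G \<Longrightarrow> centralizer G x = {g \<in> carrier G. conj_by G x g = x}"
  by (auto simp: centralizer_def conj_by_def m_assoc inv_solve_left')

lemma centralizer_subgroup:
  assumes "x \<in> carrier G"
  shows "subgroup (centralizer G x) G"
proof (rule subgroupI)
  show "inv a \<in> centralizer G x" if "a \<in> centralizer G x" for a
  proof -
    have a: "a \<in> carrier G" "conj_by G x a = x" using that assms by (auto simp: centralizer_eq)
    then have "conj_by G x (inv a) = conj_by G (conj_by G x a) (inv a)" by simp
    also have "\<dots> = x" using a(1) assms by (simp add: conj_by_mult)
    finally show ?thesis using a assms by (simp add: centralizer_eq)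
  qed
  show "a \<otimes> b \<in> centralizer G x" if "a \<in> centralizer G x" "b \<in> centralizer G x" for a b
    using that assms by (simp add: centralizer_eq conj_by_mult[symmetric])
qed (use assms in \<open>auto simp: centralizer_eq intro!: exI[of _ \<one>]\<close>)

lemma gamma_closed [simp, intro]: "x \<in> X \<Longrightarrow> i \<in> {1..N x} \<Longrightarrow> \<gamma> x i \<in> carrier G"
  using cosets by (auto simp: right_coset_reps_def)

lemma conj_rep_eq: "conj_rep G \<gamma> x i = conj_by G x (\<gamma> x i)"
  by (simp add: conj_rep_def conj_by_def)

lemma conj_by_eq_iff:
  assumes "x \<in> carrier G" "a \<in> carrier G" "b \<in> carrier G"
  shows "conj_by G x a = conj_by G x b \<longleftrightarrow> a \<otimes> inv b \<in> centralizer G x"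
proof
  assume "conj_by G x a = conj_by G x b"
  then have "conj_by G (conj_by G x a) (inv b) = conj_by G (conj_by G x b) (inv b)" by simp
  then show "a \<otimes> inv b \<in> centralizer G x"
    using assms by (simp add: conj_by_mult centralizer_eq)
next
  assume "a \<otimes> inv b \<in> centralizer G x"
  then have "conj_by G (conj_by G x (a \<otimes> inv b)) b = conj_by G x b"
    using assms by (simp add: centralizer_eq)
  then show "conj_by G x a = conj_by G x b"
    using assms by (simp add: conj_by_mult m_assoc)
qed

lemma gamma_coset_unique:
  assumes "x \<in> X" "i \<in> {1..N x}" "j \<in> {1..N x}" "h \<in> centralizer G x" "h' \<in> centralizer G x"
    "h \<otimes> \<gamma> x i = h' \<otimes> \<gamma> x j"
  shows "i = j \<and> h = h'"
proof -
  interpret H: subgroup "centralizer G x" G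
    using assms by (intro centralizer_subgroup) auto
  have absorb: "centralizer G x #> (h \<otimes> \<gamma> x i) = centralizer G x #> \<gamma> x i"
    if "h \<in> centralizer G x" "i \<in> {1..N x}" for h i
  proof (rule repr_independence[symmetric, OF _ _ H.subgroup_axioms])
    show "h \<otimes> \<gamma> x i \<in> centralizer G x #> \<gamma> x i"
      unfolding r_coset_def using that(1) by blast
  qed (use assms(1) that in auto)
  have "centralizer G x #> \<gamma> x i = centralizer G x #> \<gamma> x j"
    using absorb[OF assms(4,2)] absorb[OF assms(5,3)] assms(6) by simp
  moreover have "inj_on (\<lambda>i. centralizer G x #> \<gamma> x i) {1..N x}"
    using cosets[OF assms(1)] by (simp add: right_coset_reps_def bij_betw_def)
  ultimately have "i = j" using assms(2,3) by (meson inj_onD)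
  moreover have "h \<in> carrier G" "h' \<in> carrier G" "\<gamma> x i \<in> carrier G"
    using assms(1,2,4,5) by auto
  ultimately show ?thesis using assms(6) by simp
qed

lemma gamma_coset_exists:
  assumes "x \<in> X" "g \<in> carrier G"
  obtains h i where "h \<in> centralizer G x" "i \<in> {1..N x}" "g = h \<otimes> \<gamma> x i"
proof -
  interpret H: subgroup "centralizer G x" G
    using assms by (intro centralizer_subgroup) auto
  have "centralizer G x #> g \<in> rcosets (centralizer G x)"
    using assms by (auto simp: RCOSETS_def)
  moreover have "rcosets (centralizer G x) = (\<lambda>i. centralizer G x #> \<gamma> x i) ` {1..N x}"
    using cosets[OF assms(1)] by (simp add: right_coset_reps_def bij_betw_def)
  ultimately obtain i where i: "i \<in> {1..N x}" "centralizer G x #> g = centralizer G x #> \<gamma> x i"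
    by blast
  have "g \<in> centralizer G x #> g"
    using assms by (intro rcos_self H.subgroup_axioms)
  then have "g \<in> centralizer G x #> \<gamma> x i" using i by simp
  then show ?thesis using that i(1) unfolding r_coset_def by blast
qed

lemma coset_decomp_eq:
  assumes "x \<in> X" "h \<in> centralizer G x" "i \<in> {1..N x}"
  shows "coset_decomp G N \<gamma> x (h \<otimes> \<gamma> x i) = (h, i)"
  unfolding coset_decomp_def
proof (rule the_equality)
  fix p assume p: "fst p \<in> centralizer G x \<and> snd p \<in> {1..N x} \<and> h \<otimes> \<gamma> x i = fst p \<otimes> \<gamma> x (snd p)"
  then show "p = (h, i)"
    using gamma_coset_unique[OF assms(1,3) _ assms(2), of "snd p" "fst p"]
    by (auto intro: prod_eqI)
qed (use assms in simp)

lemma gamma_1: "x \<in> X \<Longrightarrow> \<gamma> x 1 = \<one>"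
  using cosets by (auto simp: right_coset_reps_def)

lemma one_le_N: "x \<in> X \<Longrightarrow> 1 \<le> N x"
  by (rule gamma_coset_exists[of x \<one>]) (simp_all only: one_closed atLeastAtMost_iff, linarith)

lemma conj_rep_inj:
  assumes "x \<in> X" "i \<in> {1..N x}" "j \<in> {1..N x}" "conj_rep G \<gamma> x i = conj_rep G \<gamma> x j"
  shows "i = j"
proof -
  have "\<gamma> x i \<otimes> inv (\<gamma> x j) \<in> centralizer G x"
    using assms by (simp add: conj_rep_eq conj_by_eq_iff)
  moreover have "\<one> \<in> centralizer G x"
    using assms by (auto simp: centralizer_eq)
  moreover have "\<one> \<otimes> \<gamma> x i = (\<gamma> x i \<otimes> inv (\<gamma> x j)) \<otimes> \<gamma> x j"
    using assms by (simp add: m_assoc)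
  ultimately show ?thesis using gamma_coset_unique[of x i j] assms by blast
qed

lemma class_rep_eq:
  assumes "x \<in> X" "g \<in> carrier G"
  shows "class_rep (conj_by G x g) = x"
  unfolding class_rep_def
proof (rule the_equality)
  have mem: "conj_by G x g \<in> conj_class G x" using assms(2) by (simp add: conj_class_eq)
  then show "x \<in> X \<and> conj_by G x g \<in> conj_class G x" using assms(1) by simp
  show "y = x" if "y \<in> X \<and> conj_by G x g \<in> conj_class G y" for y
    by (rule conj_class_unique[OF X, of _ _ "conj_by G x g"]) (use that assms mem in auto)
qed

lemma class_rep_mem: "u \<in> carrier G \<Longrightarrow> class_rep u \<in> X"
  and in_class_rep: "u \<in> carrier G \<Longrightarrow> u \<in> conj_class G (class_rep u)"
proof -
  assume u: "u \<in> carrier G"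
  then obtain x where "x \<in> X" "u \<in> conj_class G x"
    using X by (auto simp: conj_class_reps_def)
  then show "class_rep u \<in> X" "u \<in> conj_class G (class_rep u)"
    by (auto simp: conj_class_eq class_rep_eq)
qed

lemma class_rep_X: "x \<in> X \<Longrightarrow> class_rep x = x"
  using class_rep_eq[of x \<one>] by simp

lemma mem_conj_class_iff: "x \<in> X \<Longrightarrow> u \<in> carrier G \<Longrightarrow> u \<in> conj_class G x \<longleftrightarrow> class_rep u = x"
  using in_class_rep[of u] class_rep_eq[of x] unfolding conj_class_eq by blast

lemma idx_eqI:
  assumes "u \<in> carrier G" "i \<in> {1..N (class_rep u)}" "conj_rep G \<gamma> (class_rep u) i = u"
  shows "idx u = i"
  unfolding idx_def
  using assms class_rep_mem[OF assms(1)] conj_rep_inj[of "class_rep u"]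
  by (intro the_equality) auto

lemma idx_mem: "u \<in> carrier G \<Longrightarrow> idx u \<in> {1..N (class_rep u)}"
  and conj_rep_idx: "u \<in> carrier G \<Longrightarrow> conj_rep G \<gamma> (class_rep u) (idx u) = u"
proof -
  assume u: "u \<in> carrier G"
  define x where "x = class_rep u"
  have x: "x \<in> X" using class_rep_mem[OF u] by (simp add: x_def)
  obtain g where g: "g \<in> carrier G" "u = conj_by G x g"
    using in_class_rep[OF u] unfolding x_def conj_class_eq by blast
  obtain h i where hi: "h \<in> centralizer G x" "i \<in> {1..N x}" "g = h \<otimes> \<gamma> x i"
    using gamma_coset_exists[OF x g(1)] by blast
  have "conj_rep G \<gamma> x i = u"
    using hi x conj_by_mult[of x h "\<gamma> x i"] unfolding g(2) by (simp add: conj_rep_eq centralizer_eq)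
  note hi = hi[unfolded x_def] and rep = this[unfolded x_def]
  then show "idx u \<in> {1..N (class_rep u)}" "conj_rep G \<gamma> (class_rep u) (idx u) = u"
    using idx_eqI[OF u hi(2) rep] hi(2) rep by auto
qed

lemma idx_unique:
  assumes "x \<in> X" "i \<in> {1..N x}" "u \<in> carrier G"
  shows "conj_rep G \<gamma> x i = u \<longleftrightarrow> x = class_rep u \<and> i = idx u"
proof
  assume u: "conj_rep G \<gamma> x i = u"
  then have "class_rep u = x"
    using assms class_rep_eq[of x "\<gamma> x i"] by (auto simp: conj_rep_eq)
  then show "x = class_rep u \<and> i = idx u"
    using idx_eqI[OF assms(3), of i] assms u by auto
qed (use conj_rep_idx assms in auto)

lemma idx_X: "x \<in> X \<Longrightarrow> idx x = 1"
proof -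
  assume x: "x \<in> X"
  then have "conj_rep G \<gamma> x 1 = x" by (simp only: conj_rep_eq gamma_1 conj_by_one X_closed)
  moreover have "1 \<in> {1..N x}" using one_le_N[OF x] by simp
  ultimately show ?thesis using idx_unique[OF x _ X_closed[OF x]] by metis
qed

sublocale skeleton G class_rep gam
proof
  fix u g assume u: "u \<in> carrier G"
  show "gam u \<in> carrier G" unfolding gam_def using u class_rep_mem idx_mem by blast
  show "class_rep u \<in> carrier G" using class_rep_mem[OF u] by auto
  show "conj_by G (class_rep u) (gam u) = u"
    using conj_rep_idx[OF u] by (simp add: gam_def conj_rep_eq)
  then show "class_rep (conj_by G u g) = class_rep u" if "g \<in> carrier G"
    using class_rep_eq[OF class_rep_mem[OF u], of "gam u \<otimes> g"] that u class_rep_mem[OF u]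
      \<open>gam u \<in> carrier G\<close> by (simp add: conj_by_mult[symmetric])
  show "gam (class_rep u) = \<one>"
    using class_rep_mem[OF u] by (simp add: gam_def class_rep_X idx_X gamma_1[unfolded One_nat_def])
qed

text \<open>Right multiplication by \<open>g\<close> permutes the cosets of the centralizer as conjugation by \<open>g\<close> permutes the
  class. This identifies the recursions for \<open>s\<^sub>i\<^sup>j\<close> and \<open>h\<^sub>i\<^sub>j\<close> with \<^const>\<open>conj_by\<close> and \<^const>\<open>loop\<close>.\<close>

lemma coset_decomp_gam:
  assumes "u \<in> carrier G" "g \<in> carrier G"
  shows "coset_decomp G N \<gamma> (class_rep u) (\<gamma> (class_rep u) (idx u) \<otimes> g) =
    (loop G gam u g, idx (conj_by G u g))"
proof -
  let ?v = "conj_by G u g"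
  have "coset_decomp G N \<gamma> (class_rep u) (loop G gam u g \<otimes> \<gamma> (class_rep u) (idx ?v)) =
      (loop G gam u g, idx ?v)"
    using assms class_rep_mem idx_mem[of ?v] conj_by_loop
    by (intro coset_decomp_eq) (auto simp: centralizer_eq rep_conj_by)
  moreover have "loop G gam u g \<otimes> \<gamma> (class_rep u) (idx ?v) = \<gamma> (class_rep u) (idx u) \<otimes> g"
    using loop_gam[OF assms] assms by (simp add: gam_def[of ?v] gam_def[of u] rep_conj_by)
  ultimately show ?thesis by simp
qed

lemma h_tuple_eq_loops:
  assumes "u \<in> carrier G" "set gs \<subseteq> carrier G"
  shows "h_tuple G N \<gamma> (class_rep u) (idx u) gs = loops G gam u gs"
  using assms
proof (induction gs arbitrary: u)
  case (Cons g gs)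
  have "h_tuple G N \<gamma> (class_rep u) (idx (conj_by G u g)) gs = loops G gam (conj_by G u g) gs"
    using Cons.IH[of "conj_by G u g"] Cons.prems by (simp add: rep_conj_by)
  then show ?case using Cons.prems by (simp add: h_tuple_Cons coset_decomp_gam)
qed simp

lemma prism_eq_sum:
  assumes "u \<in> carrier G" "set gs \<subseteq> carrier G"
  shows "prism G gam \<psi> u gs =
    (\<Sum>j=0..length gs. (-1) ^ j * \<psi> (insert_tuple G N \<gamma> (class_rep u) (idx u) gs j))"
  using assms
proof (induction gs arbitrary: u \<psi>)
  case Nil
  then show ?case by (simp add: insert_tuple_def gam_def)
next
  case (Cons g gs)
  have "(\<Sum>j=0..Suc (length gs). (-1) ^ j * \<psi> (insert_tuple G N \<gamma> (class_rep u) (idx u) (g # gs) j)) =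
     \<psi> (gam u # g # gs) +
     (\<Sum>j=0..length gs. - ((-1) ^ j * \<psi> (loop G gam u g #
        insert_tuple G N \<gamma> (class_rep u) (idx (conj_by G u g)) gs j)))"
    using Cons.prems unfolding sum.atLeast0_atMost_Suc_shift
    by (simp add: insert_tuple_0 insert_tuple_Cons coset_decomp_gam gam_def o_def)
  then show ?case
    using Cons.IH[of "conj_by G u g" "\<lambda>l. \<psi> (loop G gam u g # l)"] Cons.prems
    by (simp add: rep_conj_by sum_negf)
qed

lemma insert_tuple_props:
  assumes "u \<in> carrier G" "set gs \<subseteq> carrier G" "j \<le> length gs"
  shows "length (insert_tuple G N \<gamma> (class_rep u) (idx u) gs j) = Suc (length gs)"
    and "set (insert_tuple G N \<gamma> (class_rep u) (idx u) gs j) \<subseteq> carrier G"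
    and "list_prod G (insert_tuple G N \<gamma> (class_rep u) (idx u) gs j) = gam u \<otimes> list_prod G gs"
proof -
  have "length (insert_tuple G N \<gamma> (class_rep u) (idx u) gs j) = Suc (length gs) \<and>
    set (insert_tuple G N \<gamma> (class_rep u) (idx u) gs j) \<subseteq> carrier G \<and>
    list_prod G (insert_tuple G N \<gamma> (class_rep u) (idx u) gs j) = gam u \<otimes> list_prod G gs"
    using assms
  proof (induction j arbitrary: u gs)
    case 0
    then show ?case by (auto simp: insert_tuple_0 gam_def[symmetric])
  next
    case (Suc j)
    then obtain g l where gs: "gs = g # l" by (cases gs) auto
    let ?v = "conj_by G u g"
    have l: "list_prod G l \<in> carrier G"
      using Suc.prems gs by (intro list_prod_closed is_group) auto
    have "loop G gam u g \<otimes> (gam ?v \<otimes> list_prod G l) =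
        (loop G gam u g \<otimes> gam ?v) \<otimes> list_prod G l"
      using Suc.prems gs l by (simp add: m_assoc)
    also have "\<dots> = gam u \<otimes> (g \<otimes> list_prod G l)"
      using Suc.prems gs l by (simp add: loop_gam m_assoc)
    finally show ?case
      using Suc.IH[of ?v l] Suc.prems gs
      by (auto simp: insert_tuple_Cons coset_decomp_gam rep_conj_by)
  qed
  then show "length (insert_tuple G N \<gamma> (class_rep u) (idx u) gs j) = Suc (length gs)"
    and "set (insert_tuple G N \<gamma> (class_rep u) (idx u) gs j) \<subseteq> carrier G"
    and "list_prod G (insert_tuple G N \<gamma> (class_rep u) (idx u) gs j) = gam u \<otimes> list_prod G gs"
    by auto
qed

end


section \<open>The cohomological half\<close>

lemma scale1_apply [simp]: "scale1 c f s = c * f s"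
  by (simp add: fscale_def)

lemma scale2_apply [simp]: "scale2 c f s = scale1 c (f s)"
  by (simp add: fscale_def)

text \<open>The coefficient of \<open>u g\<^sub>1 \<cdots> g\<^sub>n\<close> in \<open>\<phi>(g\<^sub>1, \<dots>, g\<^sub>n)\<close>. In these coordinates the coefficients in \<open>kG\<close>
  become trivial, and \<open>\<H>\<^sub>x\<close> consists of the functions supported on \<open>u\<close> in the class of \<open>x\<close>.\<close>

definition gpd_coord :: "('a, 'b) monoid_scheme \<Rightarrow> ('a list \<Rightarrow> 'a \<Rightarrow> 'k) \<Rightarrow> 'a \<Rightarrow> 'a list \<Rightarrow> 'k"
  where "gpd_coord G \<phi> u gs = \<phi> gs (u \<otimes>\<^bsub>G\<^esub> list_prod G gs)"

lemma merge_at_Cons: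
  assumes "1 \<le> i" shows "merge_at G (Suc i) (g # gs) = g # merge_at G i gs"
  using assms by (cases i) (auto simp: merge_at_def)

lemma merge_at_props:
  assumes "\<And>a b. a \<in> A \<Longrightarrow> b \<in> A \<Longrightarrow> a \<otimes>\<^bsub>G\<^esub> b \<in> A"
    and "set gs \<subseteq> A" "1 \<le> i" "i < length gs"
  shows "set (merge_at G i gs) \<subseteq> A" "length (merge_at G i gs) = length gs - 1"
proof -
  have "gs ! (i - 1) \<in> A" "gs ! i \<in> A"
    using assms by (auto intro!: subsetD[OF assms(2)] nth_mem)
  then show "set (merge_at G i gs) \<subseteq> A"
    using assms by (auto simp: merge_at_def dest: in_set_takeD in_set_dropD)
  show "length (merge_at G i gs) = length gs - 1"
    using assms by (simp add: merge_at_def)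
qed

context group
begin

lemma list_prod_in [simp, intro]: "set gs \<subseteq> carrier G \<Longrightarrow> list_prod G gs \<in> carrier G"
  by (rule list_prod_closed[OF is_group])

lemma tuples_sub: "gs \<in> tuples G n \<Longrightarrow> set gs \<subseteq> carrier G"
  by (auto simp: tuples_def)

lemma list_prod_append:
  "set as \<subseteq> carrier G \<Longrightarrow> set bs \<subseteq> carrier G \<Longrightarrow>
    list_prod G (as @ bs) = list_prod G as \<otimes> list_prod G bs"
  by (induction as) (auto simp: m_assoc)

lemma list_prod_merge_at:
  assumes "set gs \<subseteq> carrier G" "1 \<le> i" "i < length gs"
  shows "list_prod G (merge_at G i gs) = list_prod G gs"
  using assms
proof (induction gs arbitrary: i)
  case (Cons g gs)
  show ?case
  proof (cases "i = 1")
    case True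
    then obtain a l where "gs = a # l" using Cons.prems by (cases gs) auto
    then show ?thesis using True Cons.prems by (simp add: merge_at_def m_assoc)
  next
    case False
    then obtain j where "i = Suc j" "1 \<le> j" using Cons.prems by (cases i) auto
    then show ?thesis using Cons by (simp add: merge_at_Cons)
  qed
qed simp

lemma cochains_iff:
  assumes "finite (carrier G)"
  shows "\<phi> \<in> cochains G n \<longleftrightarrow> (\<forall>gs u. gs \<notin> tuples G n \<or> u \<notin> carrier G \<longrightarrow> \<phi> gs u = 0)"
proof
  assume "\<phi> \<in> cochains G n"
  then show "\<forall>gs u. gs \<notin> tuples G n \<or> u \<notin> carrier G \<longrightarrow> \<phi> gs u = 0"
    by (fastforce simp: cochains_def free_space_def)
next
  assume r: "\<forall>gs u. gs \<notin> tuples G n \<or> u \<notin> carrier G \<longrightarrow> \<phi> gs u = 0"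
  have "finite {u. \<phi> gs u \<noteq> 0}" for gs
    by (rule finite_subset[OF _ assms]) (use r in auto)
  then show "\<phi> \<in> cochains G n"
    using r by (auto simp: cochains_def free_space_def fun_eq_iff)
qed

lemma gpd_coord_normalized: "\<phi> \<in> cochains G n \<Longrightarrow> normalized G (gpd_coord G \<phi> u)"
  by (auto simp: normalized_def gpd_coord_def cochains_def tuples_def)

lemma cochain_eqI:
  assumes "finite (carrier G)" "\<phi> \<in> cochains G n" "\<phi>' \<in> cochains G n"
    and "\<And>u gs. u \<in> carrier G \<Longrightarrow> set gs \<subseteq> carrier G \<Longrightarrow> length gs = n \<Longrightarrow>
      gpd_coord G \<phi> u gs = gpd_coord G \<phi>' u gs"
  shows "\<phi> = \<phi>'"
proof (intro ext)
  fix gs y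
  show "\<phi> gs y = \<phi>' gs y"
  proof (cases "gs \<in> tuples G n \<and> y \<in> carrier G")
    case True
    then have "gpd_coord G \<phi> (y \<otimes> inv (list_prod G gs)) gs = gpd_coord G \<phi>' (y \<otimes> inv (list_prod G gs)) gs"
      by (intro assms(4)) (auto simp: tuples_def)
    then show ?thesis using True tuples_sub[of gs n] by (simp add: gpd_coord_def m_assoc)
  next
    case False
    then show ?thesis using assms(2,3) unfolding cochains_iff[OF assms(1)] by metis
  qed
qed

lemma ga_mult_basis_left:
  assumes "finite (carrier G)" "g \<in> carrier G" "y \<in> carrier G"
  shows "ga_mult G (basis_vec g) a y = a (inv g \<otimes> y)"
proof -
  have "ga_mult G (basis_vec g) a y =
      (\<Sum>g'\<in>carrier G. if g' = g then \<Sum>h\<in>carrier G. a h * basis_vec (g \<otimes> h) y else 0)"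
    unfolding ga_mult_def sum_fun_apply
    by (rule sum.cong) (auto simp: basis_vec_def)
  also have "\<dots> = (\<Sum>h\<in>carrier G. a h * basis_vec (g \<otimes> h) y)"
    using assms by simp
  also have "\<dots> = (\<Sum>h\<in>carrier G. if h = inv g \<otimes> y then a h else 0)"
    by (rule sum.cong) (use assms in \<open>auto simp: basis_vec_def m_assoc[symmetric]\<close>)
  finally show ?thesis using assms by simp
qed

lemma ga_mult_basis_right:
  assumes "finite (carrier G)" "h \<in> carrier G" "y \<in> carrier G"
  shows "ga_mult G a (basis_vec h) y = a (y \<otimes> inv h)"
proof -
  have "ga_mult G a (basis_vec h) y = (\<Sum>g\<in>carrier G. a g * basis_vec (g \<otimes> h) y)"
    unfolding ga_mult_def sum_fun_apply
  proof (rule sum.cong[OF refl])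
    fix g assume "g \<in> carrier G"
    have "(\<Sum>h'\<in>carrier G. scale1 (a g * basis_vec h h') (basis_vec (g \<otimes> h')) y) =
        (\<Sum>h'\<in>carrier G. if h' = h then a g * basis_vec (g \<otimes> h) y else 0)"
      by (rule sum.cong) (auto simp: basis_vec_def)
    then show "(\<Sum>h'\<in>carrier G. scale1 (a g * basis_vec h h') (basis_vec (g \<otimes> h')) y) =
        a g * basis_vec (g \<otimes> h) y" using assms by simp
  qed
  also have "\<dots> = (\<Sum>g\<in>carrier G. if g = y \<otimes> inv h then a g else 0)"
    by (rule sum.cong) (use assms in \<open>auto simp: basis_vec_def m_assoc\<close>)
  finally show ?thesis using assms by simp
qed

lemma ga_mult_outside: "y \<notin> carrier G \<Longrightarrow> ga_mult G a b y = 0"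
  by (auto simp: ga_mult_def sum_fun_apply basis_vec_def intro!: sum.neutral)

lemma coch_diff_closed:
  assumes "finite (carrier G)" "\<phi> \<in> cochains G n"
  shows "coch_diff G n \<phi> \<in> cochains G (n + 1)"
  using assms by (auto simp: cochains_iff coch_diff_def ga_mult_outside sum_fun_apply)

text \<open>The left factor \<open>g\<^sub>1\<close> of the Hochschild differential turns into the change of object from \<open>u\<close> to
  \<open>g\<^sub>1\<^sup>-\<^sup>1 u g\<^sub>1\<close>, because \<open>g\<^sub>1\<^sup>-\<^sup>1 u g\<^sub>1 g\<^sub>2 \<cdots> g\<^sub>n = (g\<^sub>1\<^sup>-\<^sup>1 u g\<^sub>1) (g\<^sub>2 \<cdots> g\<^sub>n)\<close>. The other faces keep the product
  up to the right factor of the last one. The formula holds on all lists, also on those with a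
  unit, where both sides vanish; this is needed because \<^const>\<open>loops\<close> and \<^const>\<open>merge_at\<close> produce units.\<close>

lemma gpd_coord_coch_diff:
  assumes fin: "finite (carrier G)" and \<phi>: "\<phi> \<in> cochains G n"
    and u: "u \<in> carrier G" and gs: "set gs \<subseteq> carrier G" "length gs = n + 1"
  shows "gpd_coord G (coch_diff G n \<phi>) u gs = cobd G (gpd_coord G \<phi>) u gs"
proof (cases "\<one> \<in> set gs")
  case True
  then show ?thesis
    using cobd_degenerate[OF gpd_coord_normalized[OF \<phi>] u gs(1)]
    by (auto simp: gpd_coord_def coch_diff_def tuples_def)
next
  case False
  then have tup: "gs \<in> tuples G (n + 1)" using gs by (auto simp: tuples_def)
  obtain g l where gl: "gs = g # l" using gs by (cases gs) auto
  define w where "w = u \<otimes> list_prod G gs"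
  have w: "w \<in> carrier G" using u gs by (simp add: w_def)
  have last: "gs = take n gs @ [gs ! n]" "gs ! n \<in> carrier G" "set (take n gs) \<subseteq> carrier G"
    using gs nth_mem[of n gs] by (auto simp: take_Suc_conv_app_nth[symmetric] dest: in_set_takeD)
  have 0: "inv g \<otimes> w = conj_by G u g \<otimes> list_prod G l"
    using u gs by (simp add: w_def gl conj_by_def m_assoc)
  have n: "w \<otimes> inv (gs ! n) = u \<otimes> list_prod G (take n gs)"
  proof -
    have "list_prod G gs = list_prod G (take n gs) \<otimes> gs ! n"
      using last by (subst last(1), subst list_prod_append) auto
    then show ?thesis using u last by (simp add: w_def m_assoc)
  qed
  have m: "w = u \<otimes> list_prod G (merge_at G i gs)" if "1 \<le> i" "i \<le> n" for i
    using that gs by (simp add: w_def list_prod_merge_at)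
  have hd: "gs ! 0 = g" "drop 1 gs = l" "g \<in> carrier G" using gs by (simp_all add: gl)
  have "gpd_coord G (coch_diff G n \<phi>) u gs = \<phi> l (inv g \<otimes> w)
      + (\<Sum>i=1..n. (-1) ^ i * \<phi> (merge_at G i gs) w)
      + (-1) ^ (n + 1) * \<phi> (take n gs) (w \<otimes> inv (gs ! n))"
    using w hd(3) last(2) fin tup unfolding gpd_coord_def coch_diff_def w_def[symmetric] hd(1,2)
    by (simp add: sum_fun_apply ga_mult_basis_left ga_mult_basis_right)
  also have "(\<Sum>i=1..n. (-1) ^ i * \<phi> (merge_at G i gs) w) =
      (\<Sum>i=1..n. (-1) ^ i * gpd_coord G \<phi> u (merge_at G i gs))"
    by (rule sum.cong) (auto simp: gpd_coord_def m)
  finally show ?thesis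
    unfolding cobd_eq_sum[OF gs(2)] 0 n by (simp add: gl gpd_coord_def)
qed

end

context class_transversal
begin

text \<open>In each degree the direct sum of the Tate cochain spaces, for cochains and for chains
  alike, since all tuple sets are finite.\<close>

definition class_cochains :: "nat \<Rightarrow> ('a \<Rightarrow> 'a list \<Rightarrow> 'k::zero) set"
  where "class_cochains n =
    {\<psi>. \<forall>x hs. x \<notin> X \<or> hs \<notin> tuples (centralizer_group G x) n \<longrightarrow> \<psi> x hs = 0}"

lemma class_cochainsD:
  "\<psi> \<in> class_cochains n \<Longrightarrow> x \<notin> X \<or> hs \<notin> tuples (centralizer_group G x) n \<Longrightarrow> \<psi> x hs = 0"
  by (auto simp: class_cochains_def)

lemma class_cochain_normalized: "\<psi> \<in> class_cochains n \<Longrightarrow> normalized G (\<psi> x)"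
  by (auto simp: normalized_def class_cochains_def tuples_def)

lemma centralizer_sub: "x \<in> carrier G \<Longrightarrow> centralizer G x \<subseteq> carrier G"
  by (auto simp: centralizer_def)

lemma centralizer_mult_closed:
  "x \<in> carrier G \<Longrightarrow> a \<in> centralizer G x \<Longrightarrow> b \<in> centralizer G x \<Longrightarrow> a \<otimes> b \<in> centralizer G x"
  using subgroup.m_closed[OF centralizer_subgroup] by blast

lemma coch_proj_apply:
  assumes "x \<in> X" "set gs \<subseteq> carrier G"
  shows "coch_proj G x \<phi> gs (x \<otimes> list_prod G gs) = gpd_coord G \<phi> x gs"
proof -
  have "x \<otimes> list_prod G gs = list_prod G gs \<otimes> conj_by G x (list_prod G gs)"
    using assms by (simp add: conj_by_def m_assoc[symmetric])
  then have "x \<otimes> list_prod G gs \<in> list_prod G gs <# conj_class G x"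
    using assms unfolding conj_class_eq l_coset_def by blast
  then show ?thesis by (simp add: coch_proj_def gpd_coord_def)
qed

lemma coh_iota_apply:
  assumes "x \<in> X" "\<phi> \<in> cochains G n" "set hs \<subseteq> centralizer G x" "length hs = n"
  shows "coh_iota G X n \<phi> x hs = gpd_coord G \<phi> x hs"
proof (cases "hs \<in> tuples (centralizer_group G x) n")
  case True
  have hs: "set hs \<subseteq> carrier G" using assms centralizer_sub[of x] by auto
  have "coh_iota G X n \<phi> x hs = coch_proj G x \<phi> hs (x \<otimes> inv (list_inv_prod G hs))"
    using True assms hs fin
    by (simp add: coh_iota_def coh_iota_x_def ga_mult_basis_right list_inv_prod[OF is_group])
  then show ?thesis
    using hs assms by (simp add: list_inv_prod[OF is_group] coch_proj_apply)
next
  case False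
  then have "\<one> \<in> set hs" using assms by (auto simp: tuples_def)
  then have "hs \<notin> tuples G n" by (auto simp: tuples_def)
  then show ?thesis
    using False assms by (simp add: coh_iota_def coh_iota_x_def gpd_coord_def cochains_iff[OF fin])
qed

lemma coh_iota_closed: "coh_iota G X n \<phi> \<in> class_cochains n"
  by (auto simp: class_cochains_def coh_iota_def coh_iota_x_def)

lemma class_cochain_eqI:
  assumes "\<psi> \<in> class_cochains n" "\<psi>' \<in> class_cochains n"
    and "\<And>x hs. x \<in> X \<Longrightarrow> set hs \<subseteq> centralizer G x \<Longrightarrow> length hs = n \<Longrightarrow> \<psi> x hs = \<psi>' x hs"
  shows "\<psi> = \<psi>'"
proof (intro ext)
  fix x hs
  show "\<psi> x hs = \<psi>' x hs"
  proof (cases "x \<in> X \<and> hs \<in> tuples (centralizer_group G x) n")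
    case True
    then show ?thesis by (intro assms(3)) (auto simp: tuples_def)
  next
    case False
    then show ?thesis using assms(1,2) class_cochainsD by metis
  qed
qed

text \<open>Each \<open>u\<close> equals \<open>x\<^sub>i\<close> for exactly one pair \<open>(x, i)\<close>.\<close>

lemma sum_over_classes:
  assumes "u \<in> carrier G" "p \<in> carrier G"
  shows "(\<Sum>x\<in>X. \<Sum>i=1..N x. F x i * basis_vec (conj_rep G \<gamma> x i \<otimes> p) (u \<otimes> p)) =
    (F (class_rep u) (idx u) :: 'k::field)"
proof -
  have rep: "conj_rep G \<gamma> x i \<in> carrier G" if "x \<in> X" "i \<in> {1..N x}" for x i
    using that by (simp add: conj_rep_eq)
  have "(\<Sum>x\<in>X. \<Sum>i=1..N x. F x i * basis_vec (conj_rep G \<gamma> x i \<otimes> p) (u \<otimes> p)) =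
    (\<Sum>x\<in>X. \<Sum>i=1..N x. if x = class_rep u \<and> i = idx u then F x i else 0)"
  proof (intro sum.cong[OF refl])
    fix x i assume "x \<in> X" "i \<in> {1..N x}"
    then have "u \<otimes> p = conj_rep G \<gamma> x i \<otimes> p \<longleftrightarrow> x = class_rep u \<and> i = idx u"
      using assms rep idx_unique[of x i u] by auto
    then show "F x i * basis_vec (conj_rep G \<gamma> x i \<otimes> p) (u \<otimes> p) =
        (if x = class_rep u \<and> i = idx u then F x i else 0)"
      by (simp add: basis_vec_def)
  qed
  also have "\<dots> = (\<Sum>x\<in>X. if x = class_rep u then
      \<Sum>i=1..N x. if i = idx u then F x i else 0 else 0)"
    by (intro sum.cong) auto
  also have "\<dots> = F (class_rep u) (idx u)"
    using fin_X class_rep_mem[OF assms(1)] idx_mem[OF assms(1)] by simp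
  finally show ?thesis .
qed

lemma loops_in_centralizer:
  "u \<in> carrier G \<Longrightarrow> set gs \<subseteq> carrier G \<Longrightarrow> set (loops G gam u gs) \<subseteq> centralizer G (class_rep u)"
  using loops_stabilize by (auto simp: centralizer_eq)

lemma gpd_coord_coh_rho:
  assumes "\<psi> \<in> class_cochains n" "u \<in> carrier G" "set gs \<subseteq> carrier G" "length gs = n"
  shows "gpd_coord G (coh_rho G X N \<gamma> n \<psi>) u gs = \<psi> (class_rep u) (loops G gam u gs)"
proof (cases "gs \<in> tuples G n")
  case True
  have "gpd_coord G (coh_rho G X N \<gamma> n \<psi>) u gs =
    (\<Sum>x\<in>X. \<Sum>i=1..N x. \<psi> x (h_tuple G N \<gamma> x i gs) *
      basis_vec (conj_rep G \<gamma> x i \<otimes> list_prod G gs) (u \<otimes> list_prod G gs))"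
    using True by (simp add: gpd_coord_def coh_rho_def coh_rho_x_def sum_fun_apply)
  also have "\<dots> = \<psi> (class_rep u) (h_tuple G N \<gamma> (class_rep u) (idx u) gs)"
    using assms by (intro sum_over_classes) auto
  finally show ?thesis using assms by (simp add: h_tuple_eq_loops)
next
  case False
  then have "\<one> \<in> set gs" using assms by (auto simp: tuples_def)
  then have "\<one> \<in> set (loops G gam u gs)" using assms by (intro one_in_loops)
  then have "\<psi> (class_rep u) (loops G gam u gs) = 0"
    using class_cochain_normalized[OF assms(1)] by (auto simp: normalized_def)
  then show ?thesis using False by (simp add: gpd_coord_def coh_rho_def coh_rho_x_def sum_fun_apply)
qed

lemma conj_rep_closed: "x \<in> X \<Longrightarrow> i \<in> {1..N x} \<Longrightarrow> conj_rep G \<gamma> x i \<in> carrier G"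
  by (simp add: conj_rep_eq)

lemma basis_outside:
  assumes "gs \<in> tuples G n" "y \<notin> carrier G" "x \<in> X" "Suc 0 \<le> i" "i \<le> N x"
  shows "basis_vec (conj_rep G \<gamma> x i \<otimes> list_prod G gs) y = (0::'k::zero_neq_one)"
proof -
  have "conj_rep G \<gamma> x i \<in> carrier G"
    using assms by (intro conj_rep_closed) auto
  then show ?thesis using assms tuples_sub[OF assms(1)] by (auto simp: basis_vec_def)
qed

lemma coh_rho_closed: "coh_rho G X N \<gamma> n \<psi> \<in> cochains G n"
  unfolding cochains_iff[OF fin]
proof (intro allI impI)
  fix gs y assume "gs \<notin> tuples G n \<or> y \<notin> carrier G"
  then show "coh_rho G X N \<gamma> n \<psi> gs y = 0"
    unfolding coh_rho_def coh_rho_x_def sum_fun_apply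
    by (cases "gs \<in> tuples G n") (auto simp: sum_fun_apply basis_outside intro!: sum.neutral)
qed

lemma gpd_coord_coh_s:
  assumes "\<phi> \<in> cochains G (Suc n)" "u \<in> carrier G" "set gs \<subseteq> carrier G" "length gs = n"
  shows "gpd_coord G (coh_s G X N \<gamma> (Suc n) \<phi>) u gs = prism G gam (gpd_coord G \<phi> (class_rep u)) u gs"
proof (cases "gs \<in> tuples G n")
  case True
  have "gpd_coord G (coh_s G X N \<gamma> (Suc n) \<phi>) u gs =
    (\<Sum>x\<in>X. \<Sum>j=0..n. \<Sum>i=1..N x.
      (-1) ^ j * coh_s_coeff G N \<gamma> x (coch_proj G x \<phi>) gs i j *
      basis_vec (conj_rep G \<gamma> x i \<otimes> list_prod G gs) (u \<otimes> list_prod G gs))"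
    using True by (simp add: gpd_coord_def coh_s_def coh_s_x_def sum_fun_apply)
  also have "\<dots> = (\<Sum>x\<in>X. \<Sum>i=1..N x.
      (\<Sum>j=0..n. (-1) ^ j * coh_s_coeff G N \<gamma> x (coch_proj G x \<phi>) gs i j) *
      basis_vec (conj_rep G \<gamma> x i \<otimes> list_prod G gs) (u \<otimes> list_prod G gs))"
    unfolding sum_distrib_right by (subst sum.swap) (rule refl)
  also have "\<dots> = (\<Sum>j=0..n. (-1) ^ j *
      coh_s_coeff G N \<gamma> (class_rep u) (coch_proj G (class_rep u) \<phi>) gs (idx u) j)"
    using assms by (intro sum_over_classes) auto
  also have "\<dots> = (\<Sum>j=0..length gs. (-1) ^ j *
      gpd_coord G \<phi> (class_rep u) (insert_tuple G N \<gamma> (class_rep u) (idx u) gs j))"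
  proof (rule sum.cong)
    fix j assume j: "j \<in> {0..length gs}"
    let ?ins = "insert_tuple G N \<gamma> (class_rep u) (idx u) gs j" and ?p = "list_prod G gs"
    have ins: "set ?ins \<subseteq> carrier G" "list_prod G ?ins = gam u \<otimes> ?p"
      using insert_tuple_props[OF assms(2,3)] j by auto
    have cl: "?p \<in> carrier G" "gam u \<in> carrier G" "class_rep u \<in> carrier G"
      using assms by auto
    have "inv (list_inv_prod G gs \<otimes> inv gam u) = gam u \<otimes> ?p"
      using cl assms by (simp add: list_inv_prod[OF is_group] inv_mult_group)
    then have "coh_s_coeff G N \<gamma> (class_rep u) (coch_proj G (class_rep u) \<phi>) gs (idx u) j =
        coch_proj G (class_rep u) \<phi> ?ins (class_rep u \<otimes> list_prod G ?ins)"
      using cl assms ins(2)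
      by (simp add: coh_s_coeff_def gam_def[symmetric] ga_mult_basis_right fin
          list_inv_prod[OF is_group])
    then show "(-1) ^ j * coh_s_coeff G N \<gamma> (class_rep u) (coch_proj G (class_rep u) \<phi>) gs (idx u) j
        = (-1) ^ j * gpd_coord G \<phi> (class_rep u) ?ins"
      using coch_proj_apply[OF class_rep_mem[OF assms(2)] ins(1)] by simp
  qed (use assms in simp)
  finally show ?thesis using assms by (simp add: prism_eq_sum)
next
  case False
  then have "\<one> \<in> set gs" using assms by (auto simp: tuples_def)
  then have "prism G gam (gpd_coord G \<phi> (class_rep u)) u gs = 0"
    using assms gpd_coord_normalized[OF assms(1)] by (intro prism_degenerate)
  then show ?thesis using False by (simp add: gpd_coord_def coh_s_def coh_s_x_def sum_fun_apply)
qed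

lemma coh_s_closed: "coh_s G X N \<gamma> (Suc n) \<phi> \<in> cochains G n"
  unfolding cochains_iff[OF fin]
proof (intro allI impI)
  fix gs y assume "gs \<notin> tuples G n \<or> y \<notin> carrier G"
  then show "coh_s G X N \<gamma> (Suc n) \<phi> gs y = 0"
    unfolding coh_s_def coh_s_x_def sum_fun_apply
    by (cases "gs \<in> tuples G n") (auto simp: sum_fun_apply basis_outside intro!: sum.neutral)
qed

lemma coh_s_zero: "coh_s G X N \<gamma> 0 \<phi> = 0"
  by (simp add: coh_s_def coh_s_x_def fun_eq_iff sum_fun_apply)

text \<open>A representative \<open>x\<close> is fixed by conjugation with its centralizer, so the groupoid coboundary restricted
  to the automorphisms of \<open>x\<close> is the group coboundary.\<close>

lemma gcoch_diff_eq:
  assumes "\<psi> \<in> class_cochains n" "x \<in> X" "set hs \<subseteq> centralizer G x" "length hs = n + 1"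
  shows "gcoch_diff (centralizer_group G x) n (\<psi> x) hs = cobd G \<psi> x hs"
proof -
  have hs: "set hs \<subseteq> carrier G" using assms centralizer_sub[of x] by auto
  have "hs ! 0 \<in> centralizer G x" using assms by (auto intro!: subsetD[OF assms(3)] nth_mem)
  then have stab: "conj_by G x (hs ! 0) = x" using assms by (auto simp: centralizer_eq)
  show ?thesis
  proof (cases "\<one> \<in> set hs")
    case True
    then show ?thesis
      using cobd_degenerate[OF class_cochain_normalized[OF assms(1)] X_closed[OF assms(2)] hs]
      by (auto simp: gcoch_diff_def tuples_def)
  next
    case False
    then have "hs \<in> tuples (centralizer_group G x) (n + 1)"
      using assms by (auto simp: tuples_def)
    then show ?thesis
      unfolding cobd_eq_sum[OF assms(4)] stab by (simp add: gcoch_diff_def merge_at_def)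
  qed
qed

definition class_cobd :: "nat \<Rightarrow> ('a \<Rightarrow> 'a list \<Rightarrow> 'k::field) \<Rightarrow> 'a \<Rightarrow> 'a list \<Rightarrow> 'k"
  where "class_cobd n \<psi> = (\<lambda>x. if x \<in> X then gcoch_diff (centralizer_group G x) n (\<psi> x) else 0)"

lemma class_cobd_closed: "class_cobd n \<psi> \<in> class_cochains (n + 1)"
  by (auto simp: class_cochains_def class_cobd_def gcoch_diff_def)

lemma class_cobd_eq:
  assumes "\<psi> \<in> class_cochains n" "x \<in> X" "set hs \<subseteq> centralizer G x" "length hs = n + 1"
  shows "class_cobd n \<psi> x hs = cobd G \<psi> x hs"
  using assms by (simp add: class_cobd_def gcoch_diff_eq)

lemma cobd_cong_centralizer:
  assumes "x \<in> X" "set hs \<subseteq> centralizer G x"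
    and "\<And>l. set l \<subseteq> centralizer G x \<Longrightarrow> Suc (length l) = length hs \<Longrightarrow> f x l = f' x l"
  shows "cobd G f x hs = cobd G f' x hs"
proof (rule cobd_cong[of "{x}" "centralizer G x"])
  show "conj_by G v a \<in> {x}" if "v \<in> {x}" "a \<in> centralizer G x" for v a
    using that assms(1) by (simp add: centralizer_eq)
qed (use assms centralizer_mult_closed in auto)

lemma cobd_cong_carrier:
  assumes "u \<in> carrier G" "set gs \<subseteq> carrier G"
    and "\<And>v l. v \<in> carrier G \<Longrightarrow> set l \<subseteq> carrier G \<Longrightarrow> Suc (length l) = length gs \<Longrightarrow> f v l = f' v l"
  shows "cobd G f u gs = cobd G f' u gs"
  by (rule cobd_cong[of "carrier G" "carrier G"]) (use assms in auto)

lemma coch_diff_coch_diff: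
  assumes "\<phi> \<in> cochains G n"
  shows "coch_diff G (n + 1) (coch_diff G n \<phi>) = 0"
proof (rule cochain_eqI[OF fin, of _ "n + 2"])
  note d = coch_diff_closed[OF fin assms]
  show "coch_diff G (n + 1) (coch_diff G n \<phi>) \<in> cochains G (n + 2)"
    using coch_diff_closed[OF fin d] by simp
  fix u gs assume u: "u \<in> carrier G" and gs: "set gs \<subseteq> carrier G" "length gs = n + 2"
  have "gpd_coord G (coch_diff G (n + 1) (coch_diff G n \<phi>)) u gs = cobd G (gpd_coord G (coch_diff G n \<phi>)) u gs"
    using u gs d by (intro gpd_coord_coch_diff fin) auto
  also have "\<dots> = cobd G (cobd G (gpd_coord G \<phi>)) u gs"
    using u gs assms by (intro cobd_cong_carrier gpd_coord_coch_diff fin) auto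
  also have "\<dots> = 0" using u gs by (intro cobd_cobd) auto
  finally show "gpd_coord G (coch_diff G (n + 1) (coch_diff G n \<phi>)) u gs = gpd_coord G 0 u gs"
    by (simp add: gpd_coord_def)
qed (simp add: cochains_iff[OF fin])

lemma class_cobd_class_cobd:
  assumes "\<psi> \<in> class_cochains n"
  shows "class_cobd (n + 1) (class_cobd n \<psi>) = 0"
proof (rule class_cochain_eqI)
  fix x hs assume x: "x \<in> X" and hs: "set hs \<subseteq> centralizer G x" "length hs = n + 1 + 1"
  have "class_cobd (n + 1) (class_cobd n \<psi>) x hs = cobd G (class_cobd n \<psi>) x hs"
    using x hs by (intro class_cobd_eq class_cobd_closed) auto
  also have "\<dots> = cobd G (cobd G \<psi>) x hs"
    using x hs assms by (intro cobd_cong_centralizer class_cobd_eq) auto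
  also have "\<dots> = 0" using x hs centralizer_sub[of x] by (intro cobd_cobd) auto
  finally show "class_cobd (n + 1) (class_cobd n \<psi>) x hs = 0 x hs" by simp
qed (rule class_cobd_closed, simp add: class_cochains_def)

lemma coh_iota_coch_diff:
  assumes "\<phi> \<in> cochains G n"
  shows "coh_iota G X (n + 1) (coch_diff G n \<phi>) = class_cobd n (coh_iota G X n \<phi>)"
proof (rule class_cochain_eqI)
  fix x hs assume x: "x \<in> X" and hs: "set hs \<subseteq> centralizer G x" "length hs = n + 1"
  have sub: "set hs \<subseteq> carrier G" using x hs centralizer_sub[of x] by auto
  have "coh_iota G X (n + 1) (coch_diff G n \<phi>) x hs = cobd G (gpd_coord G \<phi>) x hs"
    using x hs sub assms coch_diff_closed[OF fin assms]
    by (simp add: coh_iota_apply gpd_coord_coch_diff fin)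
  also have "\<dots> = cobd G (coh_iota G X n \<phi>) x hs"
    using x hs assms by (intro cobd_cong_centralizer coh_iota_apply[symmetric]) auto
  also have "\<dots> = class_cobd n (coh_iota G X n \<phi>) x hs"
    using x hs by (intro class_cobd_eq[symmetric] coh_iota_closed) auto
  finally show "coh_iota G X (n + 1) (coch_diff G n \<phi>) x hs = class_cobd n (coh_iota G X n \<phi>) x hs" .
qed (rule coh_iota_closed class_cobd_closed)+

text \<open>The map \<open>\<rho>\<close> is pullback along the retraction functor.\<close>

lemma coh_rho_class_cobd:
  assumes "\<psi> \<in> class_cochains n"
  shows "coh_rho G X N \<gamma> (n + 1) (class_cobd n \<psi>) = coch_diff G n (coh_rho G X N \<gamma> n \<psi>)"
proof (rule cochain_eqI[OF fin coh_rho_closed coch_diff_closed[OF fin coh_rho_closed]])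
  fix u gs assume u: "u \<in> carrier G" and gs: "set gs \<subseteq> carrier G" "length gs = n + 1"
  have "gpd_coord G (coh_rho G X N \<gamma> (n + 1) (class_cobd n \<psi>)) u gs =
      class_cobd n \<psi> (class_rep u) (loops G gam u gs)"
    using u gs by (intro gpd_coord_coh_rho class_cobd_closed)
  also have "\<dots> = cobd G \<psi> (class_rep u) (loops G gam u gs)"
    using u gs assms class_rep_mem by (intro class_cobd_eq loops_in_centralizer) auto
  also have "\<dots> = cobd G (\<lambda>u l. \<psi> (class_rep u) (loops G gam u l)) u gs"
    using u gs by (intro cobd_loops[symmetric])
  also have "\<dots> = cobd G (gpd_coord G (coh_rho G X N \<gamma> n \<psi>)) u gs"
    using u gs assms by (intro cobd_cong_carrier gpd_coord_coh_rho[symmetric]) auto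
  also have "\<dots> = gpd_coord G (coch_diff G n (coh_rho G X N \<gamma> n \<psi>)) u gs"
    using u gs by (intro gpd_coord_coch_diff[symmetric] fin coh_rho_closed)
  finally show "gpd_coord G (coh_rho G X N \<gamma> (n + 1) (class_cobd n \<psi>)) u gs =
    gpd_coord G (coch_diff G n (coh_rho G X N \<gamma> n \<psi>)) u gs" .
qed

lemma coh_iota_coh_rho:
  assumes "\<psi> \<in> class_cochains n"
  shows "coh_iota G X n (coh_rho G X N \<gamma> n \<psi>) = \<psi>"
proof (rule class_cochain_eqI[OF coh_iota_closed assms])
  fix x hs assume x: "x \<in> X" and hs: "set hs \<subseteq> centralizer G x" "length hs = n"
  have sub: "set hs \<subseteq> carrier G" using x hs centralizer_sub[of x] by auto
  have "loops G gam x hs = hs"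
    by (rule loops_eq_self)
      (use x hs in \<open>auto simp: class_rep_X centralizer_eq\<close>)
  then show "coh_iota G X n (coh_rho G X N \<gamma> n \<psi>) x hs = \<psi> x hs"
    using x hs sub assms gpd_coord_coh_rho[OF assms, of x hs]
    by (simp add: coh_iota_apply[OF _ coh_rho_closed] class_rep_X)
qed

text \<open>This is \<open>cobd_prism\<close> in coordinates.\<close>

lemma coh_homotopy:
  assumes "\<phi> \<in> cochains G n"
  shows "\<phi> - coh_rho G X N \<gamma> n (coh_iota G X n \<phi>) =
    (if n = 0 then 0 else coch_diff G (n - 1) (coh_s G X N \<gamma> n \<phi>)) +
    coh_s G X N \<gamma> (n + 1) (coch_diff G n \<phi>)"
    (is "?l = ?a + ?b")
proof (rule cochain_eqI[OF fin, of _ n])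
  have s: "coh_s G X N \<gamma> n \<phi> \<in> cochains G (n - 1)" if "n \<noteq> 0"
    using coh_s_closed[of "n - 1" \<phi>] that by simp
  have a: "?a \<in> cochains G n"
    using coch_diff_closed[OF fin s] by (cases n) (auto simp: cochains_iff[OF fin])
  have b: "?b \<in> cochains G n" using coh_s_closed by simp
  show "?a + ?b \<in> cochains G n" using a b by (simp add: cochains_iff[OF fin])
  show "?l \<in> cochains G n" using assms coh_rho_closed by (simp add: cochains_iff[OF fin])
  fix u gs assume u: "u \<in> carrier G" and gs: "set gs \<subseteq> carrier G" "length gs = n"
  have loops: "set (loops G gam u gs) \<subseteq> centralizer G (class_rep u)"
    using u gs by (intro loops_in_centralizer)
  have l: "gpd_coord G ?l u gs = gpd_coord G \<phi> u gs - gpd_coord G \<phi> (class_rep u) (loops G gam u gs)"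
    using u gs assms loops class_rep_mem[OF u]
    by (simp add: gpd_coord_def[of _ "?l"] gpd_coord_def[of _ \<phi> u] gpd_coord_coh_rho[OF coh_iota_closed, unfolded gpd_coord_def]
        coh_iota_apply)
  have ca: "gpd_coord G ?a u gs = cobd G (\<lambda>u. prism G gam (gpd_coord G \<phi> (class_rep u)) u) u gs"
  proof (cases n)
    case 0
    then show ?thesis using gs by (simp add: gpd_coord_def)
  next
    case (Suc m)
    then have "gpd_coord G ?a u gs = cobd G (gpd_coord G (coh_s G X N \<gamma> (Suc m) \<phi>)) u gs"
      using u gs gpd_coord_coch_diff[OF fin coh_s_closed, of u gs m] by simp
    also have "\<dots> = cobd G (\<lambda>u. prism G gam (gpd_coord G \<phi> (class_rep u)) u) u gs"
      using u gs assms Suc by (intro cobd_cong_carrier gpd_coord_coh_s) auto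
    finally show ?thesis .
  qed
  have cb: "gpd_coord G ?b u gs = prism G gam (cobd G (gpd_coord G \<phi>) (class_rep u)) u gs"
  proof -
    have "gpd_coord G ?b u gs = prism G gam (gpd_coord G (coch_diff G n \<phi>) (class_rep u)) u gs"
      using u gs coch_diff_closed[OF fin assms] by (simp add: gpd_coord_coh_s)
    also have "\<dots> = prism G gam (cobd G (gpd_coord G \<phi>) (class_rep u)) u gs"
      using u gs assms by (intro prism_cong gpd_coord_coch_diff fin) auto
    finally show ?thesis .
  qed
  have "gpd_coord G (?a + ?b) u gs = gpd_coord G ?a u gs + gpd_coord G ?b u gs"
    by (simp add: gpd_coord_def)
  then show "gpd_coord G ?l u gs = gpd_coord G (?a + ?b) u gs"
    using l ca cb cobd_prism[OF u gs(1), of "gpd_coord G \<phi>"] by simp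
qed

lemma cochains_subspace:
  "0 \<in> cochains G n"
  "\<phi> \<in> cochains G n \<Longrightarrow> \<phi>' \<in> cochains G n \<Longrightarrow> \<phi> + \<phi>' \<in> cochains G n"
  "\<phi> \<in> cochains G n \<Longrightarrow> scale2 c \<phi> \<in> cochains G n"
  by (simp_all add: cochains_iff[OF fin])

lemma class_cochains_subspace:
  "0 \<in> class_cochains n"
  "\<psi> \<in> class_cochains n \<Longrightarrow> \<psi>' \<in> class_cochains n \<Longrightarrow> \<psi> + \<psi>' \<in> (class_cochains n :: ('a \<Rightarrow> 'a list \<Rightarrow> 'k::field) set)"
  "\<psi> \<in> class_cochains n \<Longrightarrow> scale2 c \<psi> \<in> class_cochains n"
  by (simp_all add: class_cochains_def)

lemma gpd_coord_add: "gpd_coord G (\<phi> + \<phi>') = (\<lambda>u l. gpd_coord G \<phi> u l + gpd_coord G \<phi>' u l)"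
  by (simp add: gpd_coord_def fun_eq_iff)

lemma gpd_coord_scale: "gpd_coord G (scale2 c \<phi>) = (\<lambda>u l. c * gpd_coord G \<phi> u l)"
  by (simp add: gpd_coord_def fun_eq_iff)

lemma linear_coch_diff: "linear_map_on scale2 scale2 (cochains G n) (cochains G (n + 1)) (coch_diff G n)"
  unfolding linear_map_on_def
proof (intro conjI ballI allI coch_diff_closed fin)
  fix \<phi> \<phi>' :: "'a list \<Rightarrow> 'a \<Rightarrow> 'k::field" and c
  assume \<phi>: "\<phi> \<in> cochains G n"
  show "coch_diff G n (scale2 c \<phi>) = scale2 c (coch_diff G n \<phi>)"
    by (rule cochain_eqI[OF fin, of _ "n + 1"])
      (simp_all only: coch_diff_closed cochains_subspace \<phi> fin gpd_coord_coch_diff gpd_coord_scale cobd_scale)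
  assume \<phi>': "\<phi>' \<in> cochains G n"
  show "coch_diff G n (\<phi> + \<phi>') = coch_diff G n \<phi> + coch_diff G n \<phi>'"
    by (rule cochain_eqI[OF fin, of _ "n + 1"])
      (simp_all only: coch_diff_closed cochains_subspace \<phi> \<phi>' fin gpd_coord_coch_diff gpd_coord_add cobd_add)
qed

lemma linear_class_cobd:
  "linear_map_on scale2 scale2 (class_cochains n) (class_cochains (n + 1)) (class_cobd n)"
  unfolding linear_map_on_def
proof (intro conjI ballI allI class_cobd_closed)
  fix \<psi> \<psi>' :: "'a \<Rightarrow> 'a list \<Rightarrow> 'k::field" and c
  assume \<psi>: "\<psi> \<in> class_cochains n"
  show "class_cobd n (scale2 c \<psi>) = scale2 c (class_cobd n \<psi>)"
  proof (rule class_cochain_eqI[OF class_cobd_closed class_cochains_subspace(3)[OF class_cobd_closed]])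
    fix x hs assume "x \<in> X" "set hs \<subseteq> centralizer G x" "length hs = n + 1"
    then show "class_cobd n (scale2 c \<psi>) x hs = scale2 c (class_cobd n \<psi>) x hs"
      using cobd_scale[of G c \<psi> x hs] \<psi> class_cochains_subspace(3)[OF \<psi>, of c]
      by (simp add: class_cobd_eq fscale_def)
  qed
  assume \<psi>': "\<psi>' \<in> class_cochains n"
  show "class_cobd n (\<psi> + \<psi>') = class_cobd n \<psi> + class_cobd n \<psi>'"
  proof (rule class_cochain_eqI[OF class_cobd_closed class_cochains_subspace(2)[OF class_cobd_closed class_cobd_closed]])
    fix x hs assume "x \<in> X" "set hs \<subseteq> centralizer G x" "length hs = n + 1"
    then show "class_cobd n (\<psi> + \<psi>') x hs = (class_cobd n \<psi> + class_cobd n \<psi>') x hs"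
      using cobd_add[of G \<psi> \<psi>' x hs] \<psi> \<psi>' class_cochains_subspace(2)[OF \<psi> \<psi>']
      by (simp add: class_cobd_eq plus_fun_def)
  qed
qed

lemma linear_coh_iota: "linear_map_on scale2 scale2 (cochains G n) (class_cochains n) (coh_iota G X n)"
  unfolding linear_map_on_def
proof (intro conjI ballI allI coh_iota_closed)
  fix \<phi> \<phi>' :: "'a list \<Rightarrow> 'a \<Rightarrow> 'k::field" and c
  assume \<phi>: "\<phi> \<in> cochains G n"
  show "coh_iota G X n (scale2 c \<phi>) = scale2 c (coh_iota G X n \<phi>)"
    by (rule class_cochain_eqI[OF coh_iota_closed class_cochains_subspace(3)[OF coh_iota_closed]])
      (simp add: coh_iota_apply[OF _ \<phi>] coh_iota_apply[OF _ cochains_subspace(3)[OF \<phi>]] gpd_coord_scale)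
  assume \<phi>': "\<phi>' \<in> cochains G n"
  show "coh_iota G X n (\<phi> + \<phi>') = coh_iota G X n \<phi> + coh_iota G X n \<phi>'"
    by (rule class_cochain_eqI[OF coh_iota_closed class_cochains_subspace(2)[OF coh_iota_closed coh_iota_closed]])
      (simp add: coh_iota_apply[OF _ \<phi>] coh_iota_apply[OF _ \<phi>'] gpd_coord_add
        coh_iota_apply[OF _ cochains_subspace(2)[OF \<phi> \<phi>']])
qed

lemma linear_coh_rho: "linear_map_on scale2 scale2 (class_cochains n) (cochains G n) (coh_rho G X N \<gamma> n)"
  unfolding linear_map_on_def
proof (intro conjI ballI allI coh_rho_closed)
  fix \<psi> \<psi>' :: "'a \<Rightarrow> 'a list \<Rightarrow> 'k::field" and c
  assume \<psi>: "\<psi> \<in> class_cochains n"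
  show "coh_rho G X N \<gamma> n (scale2 c \<psi>) = scale2 c (coh_rho G X N \<gamma> n \<psi>)"
    by (rule cochain_eqI[OF fin coh_rho_closed cochains_subspace(3)[OF coh_rho_closed]])
      (simp add: gpd_coord_scale gpd_coord_coh_rho[OF \<psi>] gpd_coord_coh_rho[OF class_cochains_subspace(3)[OF \<psi>]])
  assume \<psi>': "\<psi>' \<in> class_cochains n"
  show "coh_rho G X N \<gamma> n (\<psi> + \<psi>') = coh_rho G X N \<gamma> n \<psi> + coh_rho G X N \<gamma> n \<psi>'"
    by (rule cochain_eqI[OF fin coh_rho_closed cochains_subspace(2)[OF coh_rho_closed coh_rho_closed]])
      (simp add: gpd_coord_add gpd_coord_coh_rho[OF \<psi>] gpd_coord_coh_rho[OF \<psi>'] gpd_coord_coh_rho[OF class_cochains_subspace(2)[OF \<psi> \<psi>']])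
qed

lemma linear_coh_s: "linear_map_on scale2 scale2 (cochains G (Suc n)) (cochains G n) (coh_s G X N \<gamma> (Suc n))"
  unfolding linear_map_on_def
proof (intro conjI ballI allI coh_s_closed)
  fix \<phi> \<phi>' :: "'a list \<Rightarrow> 'a \<Rightarrow> 'k::field" and c
  assume \<phi>: "\<phi> \<in> cochains G (Suc n)"
  show "coh_s G X N \<gamma> (Suc n) (scale2 c \<phi>) = scale2 c (coh_s G X N \<gamma> (Suc n) \<phi>)"
    by (rule cochain_eqI[OF fin coh_s_closed cochains_subspace(3)[OF coh_s_closed]])
      (simp add: gpd_coord_scale gpd_coord_coh_s[OF \<phi>] gpd_coord_coh_s[OF cochains_subspace(3)[OF \<phi>]] prism_scale)
  assume \<phi>': "\<phi>' \<in> cochains G (Suc n)"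
  show "coh_s G X N \<gamma> (Suc n) (\<phi> + \<phi>') = coh_s G X N \<gamma> (Suc n) \<phi> + coh_s G X N \<gamma> (Suc n) \<phi>'"
    by (rule cochain_eqI[OF fin coh_s_closed cochains_subspace(2)[OF coh_s_closed coh_s_closed]])
      (simp add: gpd_coord_add gpd_coord_coh_s[OF \<phi>] gpd_coord_coh_s[OF \<phi>'] gpd_coord_coh_s[OF cochains_subspace(2)[OF \<phi> \<phi>']] prism_add)
qed

end


section \<open>The homological half as a transpose\<close>

lemma finite_tuples: "finite (carrier H) \<Longrightarrow> finite (tuples H n)"
  using finite_lists_length_eq[of "carrier H - {\<one>\<^bsub>H\<^esub>}" n]
  by (simp add: tuples_def conj_commute)

lemma tuple_faces:
  assumes "gs \<in> tuples H (n + 1)"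
    and "\<And>a b. a \<in> carrier H \<Longrightarrow> b \<in> carrier H \<Longrightarrow> a \<otimes>\<^bsub>H\<^esub> b \<in> carrier H"
  shows "gs ! 0 \<in> carrier H" "gs ! n \<in> carrier H"
    "set (drop 1 gs) \<subseteq> carrier H" "set (take n gs) \<subseteq> carrier H"
    "length (drop 1 gs) = n" "length (take n gs) = n"
    "1 \<le> i \<Longrightarrow> i \<le> n \<Longrightarrow> set (merge_at H i gs) \<subseteq> carrier H \<and> length (merge_at H i gs) = n"
proof -
  have gs: "set gs \<subseteq> carrier H" "length gs = n + 1" using assms by (auto simp: tuples_def)
  then show "gs ! 0 \<in> carrier H" "gs ! n \<in> carrier H"
    by (auto intro!: subsetD[OF gs(1)] nth_mem)
  show "set (drop 1 gs) \<subseteq> carrier H" "set (take n gs) \<subseteq> carrier H"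
    using gs by (auto dest: in_set_dropD in_set_takeD)
  show "length (drop 1 gs) = n" "length (take n gs) = n" using gs by simp_all
  show "set (merge_at H i gs) \<subseteq> carrier H \<and> length (merge_at H i gs) = n" if "1 \<le> i" "i \<le> n"
    using merge_at_props[of "carrier H" H gs i] assms(2) gs that by auto
qed

context class_transversal
begin

text \<open>Finiteness of \<open>G\<close> lets chains and cochains share closure properties and support arguments.\<close>

lemma chains_eq_cochains: "chains G n = (cochains G n :: ('a list \<Rightarrow> 'a \<Rightarrow> 'k::field) set)"
proof -
  have "c \<in> chains G n" if c: "c \<in> cochains G n" for c :: "'a list \<Rightarrow> 'a \<Rightarrow> 'k"
  proof -
    have "finite {s. (\<lambda>(g, gs). c gs g) s \<noteq> 0}"
      by (rule finite_subset[of _ "carrier G \<times> tuples G n"])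
        (use c fin in \<open>auto simp: cochains_iff finite_tuples\<close>)
    then show ?thesis
      using c by (auto simp: chains_def free_space_def cochains_iff[OF fin])
  qed
  moreover have "c \<in> cochains G n" if "c \<in> chains G n" for c :: "'a list \<Rightarrow> 'a \<Rightarrow> 'k"
    using that by (auto simp: cochains_iff[OF fin] chains_def free_space_def)
  ultimately show ?thesis by blast
qed

text \<open>Functionals on chains, in the coordinates of the groupoid. Vanishing on degenerate
  simplices is demanded only over the carrier, where \<^const>\<open>cobd\<close> and \<^const>\<open>prism\<close> preserve it.\<close>

definition normalized_functional :: "('a \<Rightarrow> 'a list \<Rightarrow> 'k::zero) \<Rightarrow> bool"
  where "normalized_functional f \<longleftrightarrow>
    (\<forall>u\<in>carrier G. \<forall>gs. set gs \<subseteq> carrier G \<longrightarrow> \<one> \<in> set gs \<longrightarrow> f u gs = 0)"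

text \<open>The basis chain \<open>(a, g\<^sub>1, \<dots>, g\<^sub>n)\<close> lies over the object \<open>u = g\<^sub>1 \<cdots> g\<^sub>n a\<close>, as
  \<open>a = g\<^sub>n\<^sup>-\<^sup>1 \<cdots> g\<^sub>1\<^sup>-\<^sup>1 u\<close>.\<close>

definition pairing :: "nat \<Rightarrow> ('a \<Rightarrow> 'a list \<Rightarrow> 'k::field) \<Rightarrow> ('a list \<Rightarrow> 'a \<Rightarrow> 'k) \<Rightarrow> 'k"
  where "pairing n f c = (\<Sum>(a, gs)\<in>carrier G \<times> tuples G n. c gs a * f (list_prod G gs \<otimes> a) gs)"

definition class_pairing :: "nat \<Rightarrow> ('a \<Rightarrow> 'a list \<Rightarrow> 'k::field) \<Rightarrow> ('a \<Rightarrow> 'a list \<Rightarrow> 'k) \<Rightarrow> 'k"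
  where "class_pairing n \<psi> d = (\<Sum>x\<in>X. \<Sum>hs\<in>tuples (centralizer_group G x) n. d x hs * \<psi> x hs)"

lemma normalized_cobd:
  assumes "normalized_functional f" shows "normalized_functional (cobd G f)"
  unfolding normalized_functional_def
proof (intro ballI allI impI)
  fix u gs assume u: "u \<in> carrier G" "set gs \<subseteq> carrier G" "\<one> \<in> set gs"
  let ?f = "\<lambda>u l. if u \<in> carrier G \<and> set l \<subseteq> carrier G then f u l else 0"
  have "cobd G f u gs = cobd G ?f u gs"
    using u by (intro cobd_cong_carrier) auto
  also have "\<dots> = 0"
    using u assms by (intro cobd_degenerate) (auto simp: normalized_functional_def normalized_def)
  finally show "cobd G f u gs = 0" .
qed

lemma normalized_prism:
  assumes "normalized_functional f" shows "normalized_functional (\<lambda>u. prism G gam (f (class_rep u)) u)"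
  unfolding normalized_functional_def
proof (intro ballI allI impI)
  fix u gs assume u: "u \<in> carrier G" "set gs \<subseteq> carrier G" "\<one> \<in> set gs"
  let ?\<psi> = "\<lambda>l. if set l \<subseteq> carrier G then f (class_rep u) l else 0"
  have "prism G gam (f (class_rep u)) u gs = prism G gam ?\<psi> u gs"
    using u by (intro prism_cong) auto
  also have "\<dots> = 0"
    using u assms by (intro prism_degenerate) (auto simp: normalized_functional_def normalized_def)
  finally show "prism G gam (f (class_rep u)) u gs = 0" .
qed

lemma normalized_loops:
  "normalized_functional f \<Longrightarrow> normalized_functional (\<lambda>u gs. f (class_rep u) (loops G gam u gs))"
  by (simp add: normalized_functional_def loops_closed one_in_loops)

lemma pairing_add: "pairing n f (c + c') = pairing n f c + pairing n f c'"
  by (simp add: pairing_def sum.distrib[symmetric] case_prod_unfold distrib_right)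

lemma pairing_diff: "pairing n f (c - c') = pairing n f c - pairing n f c'"
  by (simp add: pairing_def sum_subtractf[symmetric] case_prod_unfold left_diff_distrib)

lemma pairing_scale: "pairing n f (scale2 k c) = k * pairing n f c"
  by (simp add: pairing_def sum_distrib_left case_prod_unfold mult.assoc)

lemma pairing_zero: "pairing n f 0 = 0"
  by (simp add: pairing_def case_prod_unfold)

lemma pairing_sum: "pairing n f (\<Sum>s\<in>S. c s) = (\<Sum>s\<in>S. pairing n f (c s))"
  by (induction S rule: infinite_finite_induct)
    (simp_all only: sum.infinite sum.empty sum.insert pairing_add pairing_zero not_False_eq_True)

lemma pairing_cong:
  assumes "\<And>u gs. u \<in> carrier G \<Longrightarrow> set gs \<subseteq> carrier G \<Longrightarrow> length gs = n \<Longrightarrow> f u gs = f' u gs"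
  shows "pairing n f c = pairing n f' c"
  unfolding pairing_def using assms tuples_sub
  by (intro sum.cong) (auto simp: tuples_def)

lemma pairing_functional_add: "pairing n (\<lambda>u l. f u l + f' u l) c = pairing n f c + pairing n f' c"
  by (simp add: pairing_def sum.distrib[symmetric] case_prod_unfold distrib_left)

lemma pairing_functional_diff: "pairing n (\<lambda>u l. f u l - f' u l) c = pairing n f c - pairing n f' c"
  by (simp add: pairing_def sum_subtractf[symmetric] case_prod_unfold right_diff_distrib)

lemma class_pairing_add: "class_pairing n \<psi> (d + d') = class_pairing n \<psi> d + class_pairing n \<psi> d'"
  by (simp add: class_pairing_def sum.distrib[symmetric] distrib_right)

lemma class_pairing_scale: "class_pairing n \<psi> (scale2 k d) = k * class_pairing n \<psi> d"
  by (simp add: class_pairing_def sum_distrib_left mult.assoc)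

lemma class_pairing_zero: "class_pairing n \<psi> 0 = 0"
  by (simp add: class_pairing_def)

lemma class_pairing_cong:
  assumes "\<And>x hs. x \<in> X \<Longrightarrow> set hs \<subseteq> centralizer G x \<Longrightarrow> length hs = n \<Longrightarrow> \<psi> x hs = \<psi>' x hs"
  shows "class_pairing n \<psi> d = class_pairing n \<psi>' d"
  unfolding class_pairing_def using assms
  by (intro sum.cong) (auto simp: tuples_def)

text \<open>The normalized functionals contain the dual basis. Hence an identity between chain maps follows from the
  identity between their transposes, which are the maps already studied on cochains.\<close>

lemma chain_eqI:
  assumes "c \<in> chains G n" "c' \<in> chains G n"
    and "\<And>f. normalized_functional f \<Longrightarrow> pairing n f c = pairing n f c'"
  shows "c = c'"
proof (rule cochain_eqI[OF fin, unfolded gpd_coord_def])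
  show "c \<in> cochains G n" "c' \<in> cochains G n"
    using assms by (simp_all add: chains_eq_cochains)
  fix u gs assume u: "u \<in> carrier G" and gs: "set gs \<subseteq> carrier G" "length gs = n"
  let ?a = "u \<otimes> list_prod G gs"
  show "c gs ?a = c' gs ?a"
  proof (cases "gs \<in> tuples G n")
    case True
    let ?f = "\<lambda>v l. if v = list_prod G gs \<otimes> ?a \<and> l = gs then 1 else 0"
    have "normalized_functional ?f" using True by (auto simp: normalized_functional_def tuples_def)
    moreover have "pairing n ?f b = b gs ?a" for b
    proof -
      have "pairing n ?f b = (\<Sum>p\<in>carrier G \<times> tuples G n. if p = (?a, gs) then b gs ?a else 0)"
        unfolding pairing_def using u gs by (intro sum.cong) (auto split: if_split_asm)
      then show ?thesis using True u gs fin by (simp add: finite_tuples)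
    qed
    ultimately show ?thesis using assms(3) by metis
  next
    case False
    then show ?thesis
      using assms(1,2) unfolding chains_eq_cochains cochains_iff[OF fin] by metis
  qed
qed

lemma finite_centralizer: "x \<in> X \<Longrightarrow> finite (carrier (centralizer_group G x))"
  using fin centralizer_sub[of x] by (auto intro: finite_subset)

lemma class_chain_eqI:
  assumes "d \<in> class_cochains n" "d' \<in> class_cochains n"
    and "\<And>\<psi>. normalized_functional \<psi> \<Longrightarrow> class_pairing n \<psi> d = class_pairing n \<psi> d'"
  shows "d = d'"
proof (rule class_cochain_eqI[OF assms(1,2)])
  fix x hs assume x: "x \<in> X"
  show "d x hs = d' x hs"
  proof (cases "hs \<in> tuples (centralizer_group G x) n")
    case True
    let ?\<psi> = "\<lambda>y l. if y = x \<and> l = hs then 1 else 0"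
    have "normalized_functional ?\<psi>" using True by (auto simp: normalized_functional_def tuples_def)
    moreover have "class_pairing n ?\<psi> b = b x hs" for b
    proof -
      have "class_pairing n ?\<psi> b = (\<Sum>y\<in>X. if y = x then
          \<Sum>l\<in>tuples (centralizer_group G y) n. if l = hs then b x hs else 0 else 0)"
        unfolding class_pairing_def by (intro sum.cong) (auto intro: sum.cong)
      then show ?thesis using True x fin_X finite_centralizer[OF x] by (simp add: finite_tuples)
    qed
    ultimately show ?thesis using assms(3) by metis
  next
    case False
    then show ?thesis using assms(1,2) class_cochainsD by metis
  qed
qed

text \<open>Tuples with units are allowed because faces and inserted simplices may have them; both sides are then \<open>0\<close>.\<close>

lemma pairing_chain_elt:
  assumes "normalized_functional f" "a \<in> carrier G" "set gs \<subseteq> carrier G" "length gs = n"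
  shows "pairing n f (chain_elt G a gs) = f (list_prod G gs \<otimes> a) gs"
proof (cases "\<one> \<in> set gs")
  case True
  then show ?thesis
    using assms by (simp add: pairing_def chain_elt_def normalized_functional_def)
next
  case False
  then have "gs \<in> tuples G n" using assms by (auto simp: tuples_def)
  moreover have "pairing n f (chain_elt G a gs) =
      (\<Sum>p\<in>carrier G \<times> tuples G n. if p = (a, gs) then f (list_prod G gs \<otimes> a) gs else 0)"
    unfolding pairing_def using False
    by (intro sum.cong) (auto simp: chain_elt_def basis_vec_def split: if_split_asm)
  ultimately show ?thesis using assms fin by (simp add: finite_tuples)
qed

lemma chain_elt_closed:
  assumes "a \<in> carrier G" "set gs \<subseteq> carrier G" "length gs = n"
  shows "chain_elt G a gs \<in> chains G n"
  using assms
  by (auto simp: chains_eq_cochains cochains_iff[OF fin] chain_elt_def basis_vec_def tuples_def)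

lemma chains_subspace:
  "0 \<in> chains G n"
  "c \<in> chains G n \<Longrightarrow> c' \<in> chains G n \<Longrightarrow> c + c' \<in> chains G n"
  "c \<in> chains G n \<Longrightarrow> scale2 k c \<in> chains G n"
  unfolding chains_eq_cochains by (rule cochains_subspace; assumption?)+

lemma chains_sum: "(\<And>s. s \<in> S \<Longrightarrow> c s \<in> chains G n) \<Longrightarrow> (\<Sum>s\<in>S. c s) \<in> chains G n"
  by (induction S rule: infinite_finite_induct) (auto intro: chains_subspace)

lemma faces_closed:
  assumes "gs \<in> tuples G (n + 1)"
  shows "gs ! 0 \<in> carrier G" "gs ! n \<in> carrier G"
    "set (drop 1 gs) \<subseteq> carrier G" "set (take n gs) \<subseteq> carrier G"
    "length (drop 1 gs) = n" "length (take n gs) = n"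
    "1 \<le> i \<Longrightarrow> i \<le> n \<Longrightarrow> set (merge_at G i gs) \<subseteq> carrier G \<and> length (merge_at G i gs) = n"
  using tuple_faces[OF assms m_closed] by blast+

lemma ch_diff_closed: "ch_diff G (n + 1) c \<in> chains G n"
  unfolding ch_diff_def case_prod_unfold
proof (rule chains_sum)
  fix p assume "p \<in> carrier G \<times> tuples G (n + 1)"
  then have a: "fst p \<in> carrier G" and gs: "snd p \<in> tuples G (n + 1)" by auto
  have "set (merge_at G i (snd p)) \<subseteq> carrier G" "length (merge_at G i (snd p)) = n" if "i \<in> {1..n}" for i
    using faces_closed(7)[OF gs] that by auto
  then show "scale2 (c (snd p) (fst p)) (chain_elt G (fst p \<otimes> snd p ! 0) (drop 1 (snd p)) +
      (\<Sum>i=1..n + 1 - 1. scale2 ((-1) ^ i) (chain_elt G (fst p) (merge_at G i (snd p)))) +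
      scale2 ((-1) ^ (n + 1)) (chain_elt G (snd p ! (n + 1 - 1) \<otimes> fst p) (take (n + 1 - 1) (snd p))))
    \<in> chains G n"
    unfolding add_diff_cancel_right' using a faces_closed(1-6)[OF gs]
    by (intro chains_subspace chains_sum chain_elt_closed) simp_all
qed

text \<open>The chain differential is the transpose of the groupoid coboundary; the cyclic last face
  \<open>(g\<^sub>n a, g\<^sub>1, \<dots>, g\<^sub>n\<^sub>-\<^sub>1)\<close> lies over the same object as \<open>(a, g\<^sub>1, \<dots>, g\<^sub>n)\<close>.\<close>

lemma pairing_ch_diff:
  assumes "normalized_functional f"
  shows "pairing n f (ch_diff G (n + 1) c) = pairing (n + 1) (cobd G f) c"
proof -
  have "pairing n f (chain_elt G (a \<otimes> gs ! 0) (drop 1 gs)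
      + (\<Sum>i=1..n + 1 - 1. scale2 ((-1) ^ i) (chain_elt G a (merge_at G i gs)))
      + scale2 ((-1) ^ (n + 1)) (chain_elt G (gs ! (n + 1 - 1) \<otimes> a) (take (n + 1 - 1) gs)))
    = cobd G f (list_prod G gs \<otimes> a) gs" if a: "a \<in> carrier G" and gs: "gs \<in> tuples G (n + 1)" for a gs
  proof -
    note cl = faces_closed[OF gs]
    have gs': "set gs \<subseteq> carrier G" "length gs = n + 1" using gs by (auto simp: tuples_def)
    obtain g l where gl: "gs = g # l" using gs' by (cases gs) auto
    have 0: "list_prod G (drop 1 gs) \<otimes> (a \<otimes> gs ! 0) = conj_by G (list_prod G gs \<otimes> a) (gs ! 0)"
      using a gs' by (simp add: gl conj_by_def m_assoc[symmetric])
    have "list_prod G gs = list_prod G (take n gs) \<otimes> gs ! n"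
      using list_prod_append[of "take n gs" "[gs ! n]"] cl gs'
      by (simp add: take_Suc_conv_app_nth[symmetric])
    then have n: "list_prod G (take n gs) \<otimes> (gs ! n \<otimes> a) = list_prod G gs \<otimes> a"
      using a cl by (simp add: m_assoc)
    have m: "pairing n f (chain_elt G a (merge_at G i gs)) = f (list_prod G gs \<otimes> a) (merge_at G i gs)"
      if "i \<in> {1..n}" for i
      using that cl(7)[of i] a gs' assms by (simp add: pairing_chain_elt list_prod_merge_at)
    show ?thesis
      unfolding cobd_eq_sum[OF gs'(2)] pairing_add pairing_scale pairing_sum 
      using a cl assms m n 0
      by (simp add: pairing_chain_elt del: drop_Suc)
  qed
  then show ?thesis
    unfolding ch_diff_def pairing_sum case_prod_unfold pairing_scale
    unfolding pairing_def[of "n + 1"] case_prod_unfold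
    by (intro sum.cong) auto
qed

definition class_bd :: "nat \<Rightarrow> ('a \<Rightarrow> 'a list \<Rightarrow> 'k::field) \<Rightarrow> 'a \<Rightarrow> 'a list \<Rightarrow> 'k"
  where "class_bd n d = (\<lambda>x. if x \<in> X then gch_diff (centralizer_group G x) n (d x) else 0)"

lemma gchain_elt_outside:
  assumes "set hs \<subseteq> carrier H" "length hs = n" "l \<notin> tuples H n"
  shows "gchain_elt H hs l = 0"
  using assms by (auto simp: gchain_elt_def basis_vec_def tuples_def)

lemma sum_gchain_elt:
  assumes "x \<in> X" "normalized_functional \<psi>" "set hs \<subseteq> centralizer G x" "length hs = n"
  shows "(\<Sum>l\<in>tuples (centralizer_group G x) n. gchain_elt (centralizer_group G x) hs l * \<psi> x l) = \<psi> x hs"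
proof (cases "\<one> \<in> set hs")
  case True
  then have "\<psi> x hs = 0"
    using assms centralizer_sub[of x] by (auto simp: normalized_functional_def)
  then show ?thesis using True by (simp add: gchain_elt_def)
next
  case False
  then have "hs \<in> tuples (centralizer_group G x) n" using assms by (auto simp: tuples_def)
  moreover have "(\<Sum>l\<in>tuples (centralizer_group G x) n. gchain_elt (centralizer_group G x) hs l * \<psi> x l) =
      (\<Sum>l\<in>tuples (centralizer_group G x) n. if l = hs then \<psi> x hs else 0)"
    using False by (intro sum.cong) (auto simp: gchain_elt_def basis_vec_def)
  ultimately show ?thesis
    using finite_centralizer[OF assms(1)] by (simp add: finite_tuples)
qed

lemma centralizer_faces:
  assumes "x \<in> X" "hs \<in> tuples (centralizer_group G x) (n + 1)"
  shows "set (drop 1 hs) \<subseteq> centralizer G x" "set (take n hs) \<subseteq> centralizer G x"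
    "length (drop 1 hs) = n" "length (take n hs) = n"
    "1 \<le> i \<Longrightarrow> i \<le> n \<Longrightarrow> set (merge_at (centralizer_group G x) i hs) \<subseteq> centralizer G x \<and>
      length (merge_at (centralizer_group G x) i hs) = n"
    "conj_by G x (hs ! 0) = x"
  using tuple_faces[OF assms(2)] centralizer_mult_closed[of x] assms(1)
  by (simp_all add: centralizer_eq X_closed)

lemma class_bd_closed:
  fixes d :: "'a \<Rightarrow> 'a list \<Rightarrow> 'k::field"
  shows "class_bd (n + 1) d \<in> class_cochains n"
proof -
  have "gch_diff (centralizer_group G x) (n + 1) e l = 0"
    if x: "x \<in> X" and l: "l \<notin> tuples (centralizer_group G x) n" for x l and e :: "'a list \<Rightarrow> 'k"
  proof -
    note out = gchain_elt_outside[OF _ _ l]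
    have "gchain_elt (centralizer_group G x) (drop 1 hs) l +
        (\<Sum>i=1..n + 1 - 1. (-1) ^ i * gchain_elt (centralizer_group G x) (merge_at (centralizer_group G x) i hs) l) +
        (-1) ^ (n + 1) * gchain_elt (centralizer_group G x) (take (n + 1 - 1) hs) l = (0::'k)"
      if hs: "hs \<in> tuples (centralizer_group G x) (n + 1)" for hs
    proof -
      note cl = centralizer_faces[OF x hs]
      have "gchain_elt (centralizer_group G x) (merge_at (centralizer_group G x) i hs) l = (0::'k)"
        if "i \<in> {1..n}" for i
        using cl(5)[of i] that by (intro out) auto
      moreover have "gchain_elt (centralizer_group G x) (drop 1 hs) l = (0::'k)"
        "gchain_elt (centralizer_group G x) (take n hs) l = (0::'k)"
        using cl(1-4) by (simp_all add: out)
      ultimately show ?thesis by simp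
    qed
    then show ?thesis
      unfolding gch_diff_def sum_fun_apply scale1_apply plus_fun_apply
      by (intro sum.neutral) simp
  qed
  then show ?thesis by (auto simp: class_cochains_def class_bd_def)
qed

lemma class_pairing_class_bd:
  assumes "normalized_functional \<psi>"
  shows "class_pairing n \<psi> (class_bd (n + 1) d) = class_pairing (n + 1) (cobd G \<psi>) d"
  unfolding class_pairing_def
proof (rule sum.cong[OF refl])
  fix x assume x: "x \<in> X"
  let ?H = "centralizer_group G x"
  have face: "(\<Sum>l\<in>tuples ?H n. (gchain_elt ?H (drop 1 hs) l
        + (\<Sum>i=1..n + 1 - 1. (-1) ^ i * gchain_elt ?H (merge_at ?H i hs) l)
        + (-1) ^ (n + 1) * gchain_elt ?H (take (n + 1 - 1) hs) l) * \<psi> x l) = cobd G \<psi> x hs"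
    if hs: "hs \<in> tuples ?H (n + 1)" for hs
  proof -
    note cl = centralizer_faces[OF x hs]
    have len: "length hs = n + 1" using hs by (simp add: tuples_def)
    have swap: "(\<Sum>l\<in>tuples ?H n. (\<Sum>i=1..n. (-1) ^ i * gchain_elt ?H (merge_at ?H i hs) l) * \<psi> x l) =
      (\<Sum>i=1..n. (-1) ^ i * (\<Sum>l\<in>tuples ?H n. gchain_elt ?H (merge_at ?H i hs) l * \<psi> x l))"
      unfolding sum_distrib_right sum_distrib_left mult.assoc by (rule sum.swap)
    also have "\<dots> = (\<Sum>i=1..n. (-1) ^ i * \<psi> x (merge_at G i hs))"
    proof (rule sum.cong[OF refl])
      fix i assume "i \<in> {1..n}"
      then show "(-1) ^ i * (\<Sum>l\<in>tuples ?H n. gchain_elt ?H (merge_at ?H i hs) l * \<psi> x l) =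
          (-1) ^ i * \<psi> x (merge_at G i hs)"
        using sum_gchain_elt[OF x assms, of "merge_at ?H i hs" n] cl(5)[of i]
        by (simp add: merge_at_def)
    qed
    finally show ?thesis
      unfolding cobd_eq_sum[OF len] cl(6) add_diff_cancel_right' distrib_right sum.distrib mult.assoc
        sum_distrib_left[symmetric]
      using sum_gchain_elt[OF x assms] cl(1-4) by simp
  qed
  have "(\<Sum>l\<in>tuples ?H n. class_bd (n + 1) d x l * \<psi> x l) =
    (\<Sum>l\<in>tuples ?H n. \<Sum>hs\<in>tuples ?H (n + 1). d x hs * ((gchain_elt ?H (drop 1 hs) l
        + (\<Sum>i=1..n + 1 - 1. (-1) ^ i * gchain_elt ?H (merge_at ?H i hs) l)
        + (-1) ^ (n + 1) * gchain_elt ?H (take (n + 1 - 1) hs) l) * \<psi> x l))"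
    using x by (simp add: class_bd_def gch_diff_def sum_fun_apply sum_distrib_right mult.assoc)
  also have "\<dots> = (\<Sum>hs\<in>tuples ?H (n + 1). d x hs * cobd G \<psi> x hs)"
    by (subst sum.swap) (use face in \<open>simp add: sum_distrib_left[symmetric]\<close>)
  finally show "(\<Sum>l\<in>tuples ?H n. class_bd (n + 1) d x l * \<psi> x l) =
    (\<Sum>hs\<in>tuples ?H (n + 1). d x hs * cobd G \<psi> x hs)" .
qed

lemma centralizer_tuple_sub:
  "x \<in> X \<Longrightarrow> hs \<in> tuples (centralizer_group G x) n \<Longrightarrow> set hs \<subseteq> carrier G \<and> length hs = n"
  using centralizer_sub[of x] by (auto simp: tuples_def)

lemma hom_iota_closed: "hom_iota G X n d \<in> chains G n"
  unfolding hom_iota_def hom_iota_x_def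
proof (intro chains_sum chains_subspace chain_elt_closed)
  fix x hs assume x: "x \<in> X" and "hs \<in> tuples (centralizer_group G x) n"
  then have hs: "set hs \<subseteq> carrier G" "length hs = n"
    using centralizer_tuple_sub by blast+
  then show "set hs \<subseteq> carrier G" "length hs = n" by auto
  show "list_inv_prod G hs \<otimes> x \<in> carrier G"
    using hs x by (simp add: list_inv_prod[OF is_group])
qed

lemma pairing_hom_iota:
  assumes "normalized_functional f"
  shows "pairing n f (hom_iota G X n d) = class_pairing n f d"
  unfolding hom_iota_def hom_iota_x_def pairing_sum pairing_scale class_pairing_def
proof (intro sum.cong refl)
  fix x hs assume x: "x \<in> X" and "hs \<in> tuples (centralizer_group G x) n"
  then have hs: "set hs \<subseteq> carrier G" "length hs = n"
    using centralizer_tuple_sub by blast+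
  then show "d x hs * pairing n f (chain_elt G (list_inv_prod G hs \<otimes> x) hs) = d x hs * f x hs"
    using x assms by (simp add: list_inv_prod[OF is_group] pairing_chain_elt m_assoc[symmetric])
qed

lemma ch_part_basis_eq:
  assumes "x \<in> X"
  shows "ch_part_basis G x n =
    {p \<in> carrier G \<times> tuples G n. class_rep (list_prod G (snd p) \<otimes> fst p) = x}"
proof -
  have sub: "p \<in> carrier G \<times> tuples G n" if "p \<in> ch_part_basis G x n" for p
    using ch_part_subset[OF is_group fin X assms] that by blast
  have "p \<in> ch_part_basis G x n \<longleftrightarrow> class_rep (list_prod G (snd p) \<otimes> fst p) = x"
    if "p \<in> carrier G \<times> tuples G n" for p
    using that mem_ch_part_basis_iff[OF is_group X_closed[OF assms], of "fst p" "snd p" n]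
      mem_conj_class_iff[OF assms] tuples_sub[of "snd p" n] by auto
  with sub show ?thesis by blast
qed

lemma sum_ch_part_basis:
  "(\<Sum>x\<in>X. \<Sum>p\<in>ch_part_basis G x n. F p) = (\<Sum>p\<in>carrier G \<times> tuples G n. F p)"
proof -
  have "(\<Sum>x\<in>X. \<Sum>p\<in>ch_part_basis G x n. F p) = (\<Sum>x\<in>X. sum F
      {p \<in> carrier G \<times> tuples G n. class_rep (list_prod G (snd p) \<otimes> fst p) = x})"
    by (intro sum.cong) (simp_all add: ch_part_basis_eq)
  also have "\<dots> = (\<Sum>p\<in>carrier G \<times> tuples G n. F p)"
    by (rule sum.group)
      (use fin_X fin tuples_sub class_rep_mem in \<open>auto simp: finite_tuples\<close>)
  finally show ?thesis .
qed

text \<open>The chosen \<open>g\<^sub>0\<close> enters \<open>\<rho>\<close> and \<open>s\<close> only through the index of \<open>u = g\<^sub>0\<^sup>-\<^sup>1 x g\<^sub>0\<close> and through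
  \<open>g\<^sub>n\<^sup>-\<^sup>1 \<cdots> g\<^sub>1\<^sup>-\<^sup>1 g\<^sub>0\<^sup>-\<^sup>1 x h\<close>, which equals \<open>a \<gamma>\<^sup>-\<^sup>1\<close>; neither depends on the choice.\<close>

lemma conjugator_props:
  assumes x: "x \<in> X" and p: "(a, gs) \<in> ch_part_basis G x n"
  defines "u \<equiv> list_prod G gs \<otimes> a"
  shows "a \<in> carrier G" "set gs \<subseteq> carrier G" "length gs = n" "gs \<in> tuples G n"
    "u \<in> carrier G" "class_rep u = x"
    "conjugator G x a gs \<in> carrier G" "conj_by G x (conjugator G x a gs) = u"
    "coset_decomp G N \<gamma> x (conjugator G x a gs) = (conjugator G x a gs \<otimes> inv (gam u), idx u)"
    "list_inv_prod G gs \<otimes> inv (conjugator G x a gs) \<otimes> x \<otimes> (conjugator G x a gs \<otimes> inv (gam u)) =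
      a \<otimes> inv (gam u)"
proof -
  show mem: "a \<in> carrier G" "set gs \<subseteq> carrier G" "length gs = n" "gs \<in> tuples G n"
    using p x by (auto simp: ch_part_basis_eq tuples_def)
  then show u: "u \<in> carrier G" by (simp add: u_def)
  show rep: "class_rep u = x" using p x by (simp add: ch_part_basis_eq u_def)
  let ?P = "\<lambda>g. g \<in> carrier G \<and> a = list_inv_prod G gs \<otimes> inv g \<otimes> x \<otimes> g"
  have a_iff: "a = list_inv_prod G gs \<otimes> inv g \<otimes> x \<otimes> g \<longleftrightarrow> conj_by G x g = u"
    if "g \<in> carrier G" for g
  proof -
    have "list_inv_prod G gs \<otimes> inv g \<otimes> x \<otimes> g = inv (list_prod G gs) \<otimes> conj_by G x g"
      using that mem x by (simp add: list_inv_prod[OF is_group] conj_by_def m_assoc)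
    then show ?thesis
      using that mem x u unfolding u_def
      by (metis X_closed conj_by_closed inv_solve_left list_prod_in)
  qed
  have "?P (gam u)"
    using a_iff[of "gam u"] conj_by_gam[OF u] gam_closed[OF u] rep by simp
  then have P: "?P (conjugator G x a gs)"
    unfolding conjugator_def by (rule someI)
  then show g: "conjugator G x a gs \<in> carrier G" by simp
  show cg: "conj_by G x (conjugator G x a gs) = u" using P a_iff[OF g] by blast
  have "conjugator G x a gs \<otimes> inv (gam u) \<in> centralizer G x"
    using cg conj_by_gam[OF u] rep g u x by (simp add: conj_by_eq_iff[symmetric])
  then have "coset_decomp G N \<gamma> x (conjugator G x a gs \<otimes> inv (gam u) \<otimes> \<gamma> x (idx u)) =
      (conjugator G x a gs \<otimes> inv (gam u), idx u)"
    using idx_mem[OF u] rep by (intro coset_decomp_eq x) auto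
  moreover have "conjugator G x a gs \<otimes> inv (gam u) \<otimes> \<gamma> x (idx u) = conjugator G x a gs"
    using g gam_closed[OF u] by (simp add: gam_def rep m_assoc)
  ultimately show "coset_decomp G N \<gamma> x (conjugator G x a gs) =
      (conjugator G x a gs \<otimes> inv (gam u), idx u)" by simp
  have "list_inv_prod G gs \<otimes> inv (conjugator G x a gs) \<otimes> x \<otimes> (conjugator G x a gs \<otimes> inv (gam u)) =
    (list_inv_prod G gs \<otimes> inv (conjugator G x a gs) \<otimes> x \<otimes> conjugator G x a gs) \<otimes> inv (gam u)"
    using mem g x u by (simp add: list_inv_prod[OF is_group] m_assoc)
  then show "list_inv_prod G gs \<otimes> inv (conjugator G x a gs) \<otimes> x \<otimes> (conjugator G x a gs \<otimes> inv (gam u)) =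
      a \<otimes> inv (gam u)" using P by metis
qed

lemma hom_rho_apply:
  assumes x: "x \<in> X"
  shows "hom_rho G X N \<gamma> n c x l = (\<Sum>(a, gs)\<in>ch_part_basis G x n. c gs a *
    gchain_elt (centralizer_group G x) (loops G gam (list_prod G gs \<otimes> a) gs) l)"
  unfolding hom_rho_def hom_rho_x_def if_P[OF x] sum_fun_apply
proof (intro sum.cong refl, clarify)
  fix a gs assume p: "(a, gs) \<in> ch_part_basis G x n"
  note c = conjugator_props[OF x p]
  have "h_tuple G N \<gamma> x (idx (list_prod G gs \<otimes> a)) gs = loops G gam (list_prod G gs \<otimes> a) gs"
    using h_tuple_eq_loops[OF c(5) c(2)] c(6) by simp
  then show "scale1 (ch_proj G x n c gs a) (let (h, i) = coset_decomp G N \<gamma> x (conjugator G x a gs) in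
      gchain_elt (centralizer_group G x) (h_tuple G N \<gamma> x i gs)) l =
    c gs a * gchain_elt (centralizer_group G x) (loops G gam (list_prod G gs \<otimes> a) gs) l"
    using p by (simp add: c(9) ch_proj_def)
qed

lemma hom_rho_closed:
  fixes c :: "'a list \<Rightarrow> 'a \<Rightarrow> 'k::field"
  shows "hom_rho G X N \<gamma> n c \<in> class_cochains n"
proof -
  have "hom_rho G X N \<gamma> n c x l = 0" if "x \<in> X" "l \<notin> tuples (centralizer_group G x) n" for x l
    unfolding hom_rho_apply[OF that(1)]
  proof (intro sum.neutral ballI, clarify)
    fix a gs assume p: "(a, gs) \<in> ch_part_basis G x n"
    note c = conjugator_props[OF that(1) p]
    have "gchain_elt (centralizer_group G x) (loops G gam (list_prod G gs \<otimes> a) gs) l = (0::'k)"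
      using loops_in_centralizer[OF c(5) c(2)] c(3,6) by (intro gchain_elt_outside[OF _ _ that(2)]) auto
    then show "c gs a * gchain_elt (centralizer_group G x) (loops G gam (list_prod G gs \<otimes> a) gs) l = 0"
      by simp
  qed
  moreover have "hom_rho G X N \<gamma> n c x l = 0" if "x \<notin> X" for x l
    using that by (simp add: hom_rho_def)
  ultimately show ?thesis unfolding class_cochains_def by blast
qed

lemma class_pairing_hom_rho:
  assumes "normalized_functional \<psi>"
  shows "class_pairing n \<psi> (hom_rho G X N \<gamma> n c) = pairing n (\<lambda>u gs. \<psi> (class_rep u) (loops G gam u gs)) c"
proof -
  have "(\<Sum>l\<in>tuples (centralizer_group G x) n. hom_rho G X N \<gamma> n c x l * \<psi> x l) =
    (\<Sum>(a, gs)\<in>ch_part_basis G x n. c gs a * \<psi> (class_rep (list_prod G gs \<otimes> a))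
      (loops G gam (list_prod G gs \<otimes> a) gs))" if x: "x \<in> X" for x
  proof -
    have "(\<Sum>l\<in>tuples (centralizer_group G x) n. hom_rho G X N \<gamma> n c x l * \<psi> x l) =
      (\<Sum>(a, gs)\<in>ch_part_basis G x n. c gs a * (\<Sum>l\<in>tuples (centralizer_group G x) n.
        gchain_elt (centralizer_group G x) (loops G gam (list_prod G gs \<otimes> a) gs) l * \<psi> x l))"
      unfolding hom_rho_apply[OF x] sum_distrib_right sum_distrib_left case_prod_unfold mult.assoc
      by (rule sum.swap)
    also have "\<dots> = (\<Sum>(a, gs)\<in>ch_part_basis G x n. c gs a * \<psi> (class_rep (list_prod G gs \<otimes> a))
      (loops G gam (list_prod G gs \<otimes> a) gs))"
    proof (intro sum.cong refl, clarify)
      fix a gs assume p: "(a, gs) \<in> ch_part_basis G x n"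
      note c = conjugator_props[OF x p]
      have "set (loops G gam (list_prod G gs \<otimes> a) gs) \<subseteq> centralizer G x"
        using loops_in_centralizer[OF c(5) c(2)] c(6) by simp
      then show "c gs a * (\<Sum>l\<in>tuples (centralizer_group G x) n.
          gchain_elt (centralizer_group G x) (loops G gam (list_prod G gs \<otimes> a) gs) l * \<psi> x l) =
        c gs a * \<psi> (class_rep (list_prod G gs \<otimes> a)) (loops G gam (list_prod G gs \<otimes> a) gs)"
        using sum_gchain_elt[OF x assms] c(3,6) by simp
    qed
    finally show ?thesis .
  qed
  then show ?thesis by (simp add: class_pairing_def pairing_def sum_ch_part_basis)
qed

lemma hom_s_eq:
  "hom_s G X N \<gamma> n c = (\<Sum>(a, gs)\<in>carrier G \<times> tuples G n. scale2 (c gs a)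
    (\<Sum>j=0..n. scale2 ((-1) ^ j) (chain_elt G (a \<otimes> inv (gam (list_prod G gs \<otimes> a)))
      (insert_tuple G N \<gamma> (class_rep (list_prod G gs \<otimes> a)) (idx (list_prod G gs \<otimes> a)) gs j))))"
  unfolding hom_s_def hom_s_x_def sum_ch_part_basis[symmetric]
proof (intro sum.cong refl, clarify)
  fix x a gs assume x: "x \<in> X" and p: "(a, gs) \<in> ch_part_basis G x n"
  note c = conjugator_props[OF x p]
  show "scale2 (ch_proj G x n c gs a) (let g\<^sub>0 = conjugator G x a gs; (h, i) = coset_decomp G N \<gamma> x g\<^sub>0
      in \<Sum>j=0..n. scale2 ((-1) ^ j) (chain_elt G (list_inv_prod G gs \<otimes> inv g\<^sub>0 \<otimes> x \<otimes> h)
        (insert_tuple G N \<gamma> x i gs j))) =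
    scale2 (c gs a) (\<Sum>j=0..n. scale2 ((-1) ^ j) (chain_elt G (a \<otimes> inv (gam (list_prod G gs \<otimes> a)))
      (insert_tuple G N \<gamma> (class_rep (list_prod G gs \<otimes> a)) (idx (list_prod G gs \<otimes> a)) gs j)))"
    using p by (simp add: Let_def c(6,9,10) ch_proj_def)
qed

lemma hom_s_closed: "hom_s G X N \<gamma> n c \<in> chains G (n + 1)"
  unfolding hom_s_eq case_prod_unfold
proof (intro chains_sum chains_subspace)
  fix p j assume "p \<in> carrier G \<times> tuples G n" and j: "j \<in> {0..n}"
  then have a: "fst p \<in> carrier G" and gs: "set (snd p) \<subseteq> carrier G" "length (snd p) = n"
    by (auto simp: tuples_def)
  let ?u = "list_prod G (snd p) \<otimes> fst p"
  have u: "?u \<in> carrier G" using a gs by simp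
  show "chain_elt G (fst p \<otimes> inv (gam ?u)) (insert_tuple G N \<gamma> (class_rep ?u) (idx ?u) (snd p) j)
      \<in> chains G (n + 1)"
    using insert_tuple_props[OF u gs(1), of j] a u gs j by (intro chain_elt_closed) auto
qed

text \<open>The inserted simplices lie over the representative of \<open>u\<close>, since \<open>\<gamma> u \<gamma>\<^sup>-\<^sup>1\<close> is that representative.\<close>

lemma pairing_hom_s:
  assumes "normalized_functional f"
  shows "pairing (n + 1) f (hom_s G X N \<gamma> n c) = pairing n (\<lambda>u. prism G gam (f (class_rep u)) u) c"
  unfolding hom_s_eq pairing_sum case_prod_unfold pairing_scale
  unfolding pairing_def[of n] case_prod_unfold
proof (intro sum.cong refl arg_cong2[where f="(*)"])
  fix p assume "p \<in> carrier G \<times> tuples G n"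
  then have a: "fst p \<in> carrier G" and gs: "set (snd p) \<subseteq> carrier G" "length (snd p) = n"
    by (auto simp: tuples_def)
  define u where "u = list_prod G (snd p) \<otimes> fst p"
  have u: "u \<in> carrier G" using a gs by (simp add: u_def)
  have "pairing (n + 1) f (chain_elt G (fst p \<otimes> inv (gam u)) (insert_tuple G N \<gamma> (class_rep u) (idx u) (snd p) j)) =
    f (class_rep u) (insert_tuple G N \<gamma> (class_rep u) (idx u) (snd p) j)" if j: "j \<in> {0..n}" for j
  proof -
    note ins = insert_tuple_props[OF u gs(1), of j]
    have "gam u \<otimes> list_prod G (snd p) \<otimes> (fst p \<otimes> inv (gam u)) = gam u \<otimes> u \<otimes> inv (gam u)"
      using a gs u by (simp add: u_def m_assoc)
    also have "\<dots> = conj_by G (conj_by G (class_rep u) (gam u)) (inv (gam u))"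
      using u by (simp add: conj_by_gam conj_by_def[of _ u])
    also have "\<dots> = class_rep u" using u by (simp add: conj_by_mult)
    finally show ?thesis
      using ins j gs a u by (simp add: pairing_chain_elt[OF assms])
  qed
  then show "(\<Sum>j=0..n. (-1) ^ j * pairing (n + 1) f (chain_elt G (fst p \<otimes> inv (gam (list_prod G (snd p) \<otimes> fst p)))
      (insert_tuple G N \<gamma> (class_rep (list_prod G (snd p) \<otimes> fst p)) (idx (list_prod G (snd p) \<otimes> fst p)) (snd p) j))) =
    prism G gam (f (class_rep (list_prod G (snd p) \<otimes> fst p))) (list_prod G (snd p) \<otimes> fst p) (snd p)"
    unfolding u_def[symmetric] prism_eq_sum[OF u gs(1)] gs(2) by (intro sum.cong) auto
qed

end


section \<open>Identities between chain maps\<close>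

text \<open>A map with a transpose on a separating family of functionals is linear.\<close>

lemma linear_map_on_dualI:
  fixes F :: "'v::ab_group_add \<Rightarrow> 'w::ab_group_add"
    and p :: "'f \<Rightarrow> 'w \<Rightarrow> 'k::field" and q :: "'f \<Rightarrow> 'v \<Rightarrow> 'k"
  assumes "\<And>v. F v \<in> W"
    and sep: "\<And>w w'. w \<in> W \<Longrightarrow> w' \<in> W \<Longrightarrow> (\<And>f. T f \<Longrightarrow> p f w = p f w') \<Longrightarrow> w = w'"
    and dual: "\<And>f v. T f \<Longrightarrow> p f (F v) = q f v"
    and "\<And>w w'. w \<in> W \<Longrightarrow> w' \<in> W \<Longrightarrow> w + w' \<in> W" "\<And>c w. w \<in> W \<Longrightarrow> scW c w \<in> W"
    and "\<And>f w w'. p f (w + w') = p f w + p f w'" "\<And>f c w. p f (scW c w) = c * p f w"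
    and "\<And>f v v'. q f (v + v') = q f v + q f v'" "\<And>f c v. q f (scV c v) = c * q f v"
  shows "linear_map_on scV scW V W F"
  unfolding linear_map_on_def
  by (intro conjI ballI allI sep assms) (simp_all add: assms)

context class_transversal
begin

lemma loops_X: "x \<in> X \<Longrightarrow> set hs \<subseteq> centralizer G x \<Longrightarrow> loops G gam x hs = hs"
  by (rule loops_eq_self) (auto simp: class_rep_X centralizer_eq)

lemma ch_diff_ch_diff:
  fixes c :: "'a list \<Rightarrow> 'a \<Rightarrow> 'k::field"
  shows "ch_diff G (n + 1) (ch_diff G (n + 2) c) = 0"
proof (rule chain_eqI[OF ch_diff_closed chains_subspace(1)])
  fix f :: "'a \<Rightarrow> 'a list \<Rightarrow> 'k" assume f: "normalized_functional f"
  have "pairing n f (ch_diff G (n + 1) (ch_diff G (n + 2) c)) = pairing (n + 2) (cobd G (cobd G f)) c"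
    using pairing_ch_diff[OF f, of n] pairing_ch_diff[OF normalized_cobd[OF f], of "n + 1" c] by simp
  also have "\<dots> = pairing (n + 2) (\<lambda>u gs. 0) c"
    by (intro pairing_cong cobd_cobd) auto
  finally show "pairing n f (ch_diff G (n + 1) (ch_diff G (n + 2) c)) = pairing n f 0"
    by (simp only: pairing_zero) (simp add: pairing_def)
qed

lemma class_bd_class_bd:
  fixes d :: "'a \<Rightarrow> 'a list \<Rightarrow> 'k::field"
  shows "class_bd (n + 1) (class_bd (n + 2) d) = 0"
proof (rule class_chain_eqI[OF class_bd_closed class_cochains_subspace(1)])
  fix \<psi> :: "'a \<Rightarrow> 'a list \<Rightarrow> 'k" assume \<psi>: "normalized_functional \<psi>"
  have "class_pairing n \<psi> (class_bd (n + 1) (class_bd (n + 2) d)) = class_pairing (n + 2) (cobd G (cobd G \<psi>)) d"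
    using class_pairing_class_bd[OF \<psi>, of n] class_pairing_class_bd[OF normalized_cobd[OF \<psi>], of "n + 1" d]
    by simp
  also have "\<dots> = class_pairing (n + 2) (\<lambda>u gs. 0) d"
    using centralizer_sub by (intro class_pairing_cong cobd_cobd) auto
  finally show "class_pairing n \<psi> (class_bd (n + 1) (class_bd (n + 2) d)) = class_pairing n \<psi> 0"
    by (simp only: class_pairing_zero) (simp add: class_pairing_def)
qed

lemma hom_iota_class_bd: "hom_iota G X n (class_bd (n + 1) d) = ch_diff G (n + 1) (hom_iota G X (n + 1) d)"
  by (rule chain_eqI[OF hom_iota_closed ch_diff_closed])
    (simp only: pairing_hom_iota pairing_ch_diff class_pairing_class_bd normalized_cobd)

lemma hom_rho_ch_diff:
  fixes c :: "'a list \<Rightarrow> 'a \<Rightarrow> 'k::field"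
  shows "hom_rho G X N \<gamma> n (ch_diff G (n + 1) c) = class_bd (n + 1) (hom_rho G X N \<gamma> (n + 1) c)"
proof (rule class_chain_eqI[OF hom_rho_closed class_bd_closed])
  fix \<psi> :: "'a \<Rightarrow> 'a list \<Rightarrow> 'k" assume \<psi>: "normalized_functional \<psi>"
  have "class_pairing n \<psi> (hom_rho G X N \<gamma> n (ch_diff G (n + 1) c)) =
      pairing (n + 1) (cobd G (\<lambda>u gs. \<psi> (class_rep u) (loops G gam u gs))) c"
    by (simp only: class_pairing_hom_rho[OF \<psi>] pairing_ch_diff normalized_loops[OF \<psi>])
  also have "\<dots> = pairing (n + 1) (\<lambda>u gs. cobd G \<psi> (class_rep u) (loops G gam u gs)) c"
    by (intro pairing_cong cobd_loops)
  also have "\<dots> = class_pairing n \<psi> (class_bd (n + 1) (hom_rho G X N \<gamma> (n + 1) c))"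
    by (simp only: class_pairing_hom_rho class_pairing_class_bd normalized_cobd \<psi>)
  finally show "class_pairing n \<psi> (hom_rho G X N \<gamma> n (ch_diff G (n + 1) c)) =
    class_pairing n \<psi> (class_bd (n + 1) (hom_rho G X N \<gamma> (n + 1) c))" .
qed

lemma hom_rho_hom_iota:
  fixes d :: "'a \<Rightarrow> 'a list \<Rightarrow> 'k::field"
  assumes "d \<in> class_cochains n"
  shows "hom_rho G X N \<gamma> n (hom_iota G X n d) = d"
proof (rule class_chain_eqI[OF hom_rho_closed assms])
  fix \<psi> :: "'a \<Rightarrow> 'a list \<Rightarrow> 'k" assume \<psi>: "normalized_functional \<psi>"
  have "class_pairing n \<psi> (hom_rho G X N \<gamma> n (hom_iota G X n d)) =
      class_pairing n (\<lambda>u gs. \<psi> (class_rep u) (loops G gam u gs)) d"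
    by (simp only: class_pairing_hom_rho pairing_hom_iota normalized_loops \<psi>)
  also have "\<dots> = class_pairing n \<psi> d"
    by (rule class_pairing_cong) (simp add: loops_X class_rep_X)
  finally show "class_pairing n \<psi> (hom_rho G X N \<gamma> n (hom_iota G X n d)) = class_pairing n \<psi> d" .
qed

text \<open>Transpose of \<open>cobd_prism\<close>. The value \<open>0\<close> of \<^const>\<open>cobd\<close> on the empty list accounts for the missing
  term in degree \<open>0\<close>.\<close>

lemma hom_homotopy:
  fixes c :: "'a list \<Rightarrow> 'a \<Rightarrow> 'k::field"
  assumes "c \<in> chains G n"
  shows "c - hom_iota G X n (hom_rho G X N \<gamma> n c) = ch_diff G (n + 1) (hom_s G X N \<gamma> n c) +
    (if n = 0 then 0 else hom_s G X N \<gamma> (n - 1) (ch_diff G n c))"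
    (is "?l = ?a + ?b")
proof (rule chain_eqI)
  show "?l \<in> chains G n"
    using assms hom_iota_closed unfolding chains_eq_cochains cochains_iff[OF fin] by simp
  have "?b \<in> chains G n"
    using hom_s_closed[of "n - 1"] chains_subspace(1) by (cases n) auto
  then show "?a + ?b \<in> chains G n" by (intro chains_subspace(2) ch_diff_closed)
  fix f :: "'a \<Rightarrow> 'a list \<Rightarrow> 'k" assume f: "normalized_functional f"
  let ?P = "\<lambda>u. prism G gam (f (class_rep u)) u"
  have l: "pairing n f ?l = pairing n f c - pairing n (\<lambda>u gs. f (class_rep u) (loops G gam u gs)) c"
    by (simp only: pairing_diff pairing_hom_iota[OF f] class_pairing_hom_rho[OF f])
  have a: "pairing n f ?a = pairing n (\<lambda>u. prism G gam (cobd G f (class_rep u)) u) c"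
    by (simp only: pairing_ch_diff[OF f] pairing_hom_s normalized_cobd[OF f])
  have b: "pairing n f ?b = pairing n (cobd G ?P) c"
  proof (cases n)
    case 0
    have "pairing 0 (cobd G ?P) c = pairing 0 (\<lambda>u gs. 0) c"
      by (rule pairing_cong) simp
    then show ?thesis unfolding 0 by (simp only: if_True pairing_zero) (simp add: pairing_def)
  next
    case (Suc m)
    then show ?thesis
      using pairing_hom_s[OF f, of m "ch_diff G n c"] pairing_ch_diff[OF normalized_prism[OF f], of m c]
      by simp
  qed
  have "pairing n f (?a + ?b) =
      pairing n (\<lambda>u gs. cobd G ?P u gs + prism G gam (cobd G f (class_rep u)) u gs) c"
    unfolding pairing_add a b pairing_functional_add by (rule add.commute)
  also have "\<dots> = pairing n (\<lambda>u gs. f u gs - f (class_rep u) (loops G gam u gs)) c"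
    by (intro pairing_cong cobd_prism)
  finally show "pairing n f ?l = pairing n f (?a + ?b)"
    by (simp only: l pairing_functional_diff)
qed

lemma linear_ch_diff: "linear_map_on scale2 scale2 V (chains G n) (ch_diff G (n + 1))"
  by (rule linear_map_on_dualI[where T = normalized_functional and p = "pairing n" and q = "\<lambda>f. pairing (n + 1) (cobd G f)"])
    (fact ch_diff_closed chain_eqI pairing_ch_diff chains_subspace pairing_add pairing_scale)+

lemma linear_class_bd: "linear_map_on scale2 scale2 V (class_cochains n) (class_bd (n + 1))"
  by (rule linear_map_on_dualI[where T = normalized_functional and p = "class_pairing n"
        and q = "\<lambda>f. class_pairing (n + 1) (cobd G f)"])
    (fact class_bd_closed class_chain_eqI class_pairing_class_bd class_cochains_subspace
      class_pairing_add class_pairing_scale)+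

lemma linear_hom_iota: "linear_map_on scale2 scale2 V (chains G n) (hom_iota G X n)"
  by (rule linear_map_on_dualI[where T = normalized_functional and p = "pairing n" and q = "class_pairing n"])
    (fact hom_iota_closed chain_eqI pairing_hom_iota chains_subspace pairing_add pairing_scale
      class_pairing_add class_pairing_scale)+

lemma linear_hom_rho: "linear_map_on scale2 scale2 V (class_cochains n) (hom_rho G X N \<gamma> n)"
  by (rule linear_map_on_dualI[where T = normalized_functional and p = "class_pairing n"
        and q = "\<lambda>f. pairing n (\<lambda>u gs. f (class_rep u) (loops G gam u gs))"])
    (fact hom_rho_closed class_chain_eqI class_pairing_hom_rho class_cochains_subspace
      pairing_add pairing_scale class_pairing_add class_pairing_scale)+

lemma linear_hom_s: "linear_map_on scale2 scale2 V (chains G (n + 1)) (hom_s G X N \<gamma> n)"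
  by (rule linear_map_on_dualI[where T = normalized_functional and p = "pairing (n + 1)"
        and q = "\<lambda>f. pairing n (\<lambda>u. prism G gam (f (class_rep u)) u)"])
    (fact hom_s_closed chain_eqI pairing_hom_s chains_subspace pairing_add pairing_scale)+

end


section \<open>The norm map\<close>

context class_transversal
begin

text \<open>The matrix of \<open>\<tau>\<close>: the coefficient of \<open>u\<close> in \<open>\<tau>(h)\<close>. Since it is constant on classes in both arguments,
  \<open>\<tau>\<close> composes to \<open>0\<close> with both neighbouring differentials.\<close>

definition conjugator_count :: "'a \<Rightarrow> 'a \<Rightarrow> 'k::field"
  where "conjugator_count u h = of_nat (card {g \<in> carrier G. conj_by G h g = u})"

lemma conjugator_count_conj_right:
  assumes "u \<in> carrier G" "h \<in> carrier G" "k \<in> carrier G"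
  shows "conjugator_count u (conj_by G h k) = conjugator_count u h"
proof -
  have "bij_betw (\<lambda>g. k \<otimes> g) {g \<in> carrier G. conj_by G (conj_by G h k) g = u}
      {g \<in> carrier G. conj_by G h g = u}"
    by (rule bij_betw_byWitness[where f' = "\<lambda>g. inv k \<otimes> g"])
      (use assms in \<open>auto simp: conj_by_mult m_assoc[symmetric]\<close>)
  then show ?thesis by (simp add: conjugator_count_def bij_betw_same_card)
qed

lemma conjugator_count_sym:
  assumes "u \<in> carrier G" "h \<in> carrier G"
  shows "conjugator_count u h = conjugator_count h u"
proof -
  have "bij_betw (\<lambda>g. inv g) {g \<in> carrier G. conj_by G h g = u} {g \<in> carrier G. conj_by G u g = h}"
    by (rule bij_betw_byWitness[where f' = "\<lambda>g. inv g"])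
      (use assms in \<open>auto simp: conj_by_mult\<close>)
  then show ?thesis by (simp add: conjugator_count_def bij_betw_same_card)
qed

lemma conjugator_count_conj_left:
  assumes "u \<in> carrier G" "h \<in> carrier G" "k \<in> carrier G"
  shows "conjugator_count (conj_by G u k) h = conjugator_count u h"
  using assms by (metis conj_by_closed conjugator_count_conj_right conjugator_count_sym)

text \<open>The elements conjugating \<open>x\<close> to \<open>u\<close> form a coset of the centralizer of \<open>x\<close>; its order is the norm factor
  of the Tate complex.\<close>

lemma conjugator_count_rep:
  assumes "x \<in> X" "u \<in> carrier G"
  shows "conjugator_count u x = (if class_rep u = x then of_nat (order (centralizer_group G x)) else 0)"
proof (cases "class_rep u = x")
  case True
  have cu: "conj_by G x (gam u) = u" using conj_by_gam[OF assms(2)] True by simp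
  have "conj_by G (conj_by G x (gam u)) (inv (gam u)) = x"
    using assms by (simp add: conj_by_mult)
  then have cu': "conj_by G u (inv (gam u)) = x" by (simp add: cu)
  have "bij_betw (\<lambda>g. g \<otimes> gam u) (centralizer G x) {g \<in> carrier G. conj_by G x g = u}"
    by (rule bij_betw_byWitness[where f' = "\<lambda>g. g \<otimes> inv (gam u)"])
      (use assms cu cu' in \<open>auto simp: centralizer_eq m_assoc conj_by_mult[symmetric]\<close>)
  then show ?thesis
    using True by (simp add: conjugator_count_def order_def bij_betw_same_card)
next
  case False
  then have "{g \<in> carrier G. conj_by G x g = u} = {}"
    using class_rep_eq[OF assms(1)] by auto
  then show ?thesis
    unfolding conjugator_count_def by (simp only: card.empty of_nat_0 False if_False)
qed

text \<open>The restriction to the empty list makes this a normalized functional and is invisible to the pairing in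
  degree \<open>0\<close>.\<close>

definition count_functional :: "'a \<Rightarrow> 'a \<Rightarrow> 'a list \<Rightarrow> 'k::field"
  where "count_functional u h l = (if l = [] then conjugator_count u h else 0)"

lemma normalized_count: "normalized_functional (count_functional u)"
  by (auto simp: normalized_functional_def count_functional_def)

lemma tuples_0: "tuples H 0 = {[]}"
  by (auto simp: tuples_def)

lemma trace_map_apply:
  fixes c :: "'a list \<Rightarrow> 'a \<Rightarrow> 'k::field"
  assumes "u \<in> carrier G"
  shows "trace_map G c [] u = pairing 0 (count_functional u) c"
proof -
  have "(\<Sum>g\<in>carrier G. basis_vec (g \<otimes> h \<otimes> inv g) u) = (conjugator_count u h :: 'k)"
    if "h \<in> carrier G" for h
  proof -
    have "(\<Sum>g\<in>carrier G. basis_vec (g \<otimes> h \<otimes> inv g) u) =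
      (\<Sum>g\<in>carrier G. if conj_by G h g = u then 1 else (0::'k))"
      by (rule sum.reindex_bij_witness[where i = "\<lambda>g. inv g" and j = "\<lambda>g. inv g"])
        (auto simp: basis_vec_def conj_by_def)
    then show ?thesis using fin by (simp add: conjugator_count_def sum.If_cases Int_def)
  qed
  then show ?thesis
    by (simp add: trace_map_def sum_fun_apply pairing_def tuples_0 count_functional_def
        sum.cartesian_product[symmetric])
qed

lemma trace_map_closed:
  fixes c :: "'a list \<Rightarrow> 'a \<Rightarrow> 'k::field"
  shows "trace_map G c \<in> cochains G 0"
proof -
  have "trace_map G c gs u = 0" if "gs \<notin> tuples G 0 \<or> u \<notin> carrier G" for gs u
  proof (cases "gs = []")
    case True
    then have "u \<notin> carrier G" using that by (simp add: tuples_0)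
    then have "basis_vec (g \<otimes> h \<otimes> inv g) u = (0::'k)" if "g \<in> carrier G" "h \<in> carrier G" for g h
      using that by (auto simp: basis_vec_def)
    then show ?thesis by (simp add: trace_map_def sum_fun_apply)
  qed (simp add: trace_map_def)
  then show ?thesis by (auto simp: cochains_iff[OF fin])
qed

lemma cochain0_eqI:
  assumes "\<phi> \<in> cochains G 0" "\<phi>' \<in> cochains G 0" "\<And>u. u \<in> carrier G \<Longrightarrow> \<phi> [] u = \<phi>' [] u"
  shows "\<phi> = \<phi>'"
  by (rule cochain_eqI[OF fin assms(1,2)]) (simp add: gpd_coord_def assms(3))

lemma linear_trace_map: "linear_map_on scale2 scale2 V (cochains G 0) (trace_map G)"
  unfolding linear_map_on_def
proof (intro conjI ballI allI trace_map_closed)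
  show "trace_map G (v + v') = trace_map G v + trace_map G v'" for v v'
    by (rule cochain0_eqI[OF trace_map_closed cochains_subspace(2)[OF trace_map_closed trace_map_closed]])
      (simp add: trace_map_apply pairing_add[unfolded plus_fun_def] plus_fun_def)
  show "trace_map G (scale2 c v) = scale2 c (trace_map G v)" for c v
    by (rule cochain0_eqI[OF trace_map_closed cochains_subspace(3)[OF trace_map_closed]])
      (simp add: trace_map_apply pairing_scale)
qed

lemma trace_map_ch_diff: "trace_map G (ch_diff G 1 c) = 0"
proof (rule cochain0_eqI[OF trace_map_closed cochains_subspace(1)])
  fix u assume u: "u \<in> carrier G"
  have "trace_map G (ch_diff G 1 c) [] u = pairing 1 (cobd G (count_functional u)) c"
    using pairing_ch_diff[OF normalized_count, of 0 u c] u by (simp add: trace_map_apply)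
  also have "\<dots> = pairing 1 (\<lambda>h l. 0) c"
  proof (rule pairing_cong)
    fix h gs assume h: "h \<in> carrier G" "set gs \<subseteq> carrier G" "length gs = 1"
    then obtain g where "gs = [g]" by (auto simp: length_Suc_conv)
    then show "cobd G (count_functional u) h gs = 0"
      using u h by (simp add: count_functional_def conjugator_count_conj_right)
  qed
  finally show "trace_map G (ch_diff G 1 c) [] u = 0 [] u" by (simp add: pairing_def)
qed

lemma coch_diff_trace_map:
  fixes c :: "'a list \<Rightarrow> 'a \<Rightarrow> 'k::field"
  shows "coch_diff G 0 (trace_map G c) = 0"
proof (rule cochain_eqI[OF fin coch_diff_closed[OF fin trace_map_closed] cochains_subspace(1)])
  fix u gs assume u: "u \<in> carrier G" "set gs \<subseteq> carrier G" "length gs = 0 + 1"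
  then obtain g where g: "gs = [g]" "g \<in> carrier G" by (auto simp: length_Suc_conv)
  have "pairing 0 (count_functional (conj_by G u g)) c = pairing 0 (count_functional u) c"
    by (rule pairing_cong) (use u g in \<open>simp add: count_functional_def conjugator_count_conj_left\<close>)
  then have "cobd G (gpd_coord G (trace_map G c)) u gs = 0"
    using u g by (simp add: gpd_coord_def trace_map_apply)
  then show "gpd_coord G (coch_diff G 0 (trace_map G c)) u gs = gpd_coord G 0 u gs"
    using gpd_coord_coch_diff[OF fin trace_map_closed u, of c] by (simp add: gpd_coord_def)
qed

definition class_norm :: "('a \<Rightarrow> 'a list \<Rightarrow> 'k::field) \<Rightarrow> 'a \<Rightarrow> 'a list \<Rightarrow> 'k"
  where "class_norm d =
    (\<lambda>x. if x \<in> X then scale1 (of_nat (order (centralizer_group G x))) (d x) else 0)"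

lemma class_norm_closed: "d \<in> class_cochains n \<Longrightarrow> class_norm d \<in> class_cochains n"
  by (auto simp: class_cochains_def class_norm_def)

lemma linear_class_norm:
  "linear_map_on scale2 scale2 (class_cochains n) (class_cochains n) class_norm"
  unfolding linear_map_on_def
  by (auto simp: class_norm_closed) (auto simp: class_norm_def fun_eq_iff algebra_simps)

lemma class_cobd_class_norm:
  assumes "d \<in> class_cochains 0"
  shows "class_cobd 0 (class_norm d) = 0"
proof (rule class_cochain_eqI[OF class_cobd_closed class_cochains_subspace(1)])
  fix x hs assume x: "x \<in> X" and hs: "set hs \<subseteq> centralizer G x" "length hs = 0 + 1"
  then obtain h where h: "hs = [h]" "conj_by G x h = x"
    by (auto simp: length_Suc_conv centralizer_eq)
  then have "cobd G (class_norm d) x hs = 0" by simp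
  then show "class_cobd 0 (class_norm d) x hs = 0 x hs"
    using class_cobd_eq[OF class_norm_closed[OF assms] x hs] by simp
qed

lemma class_norm_class_bd:
  fixes d :: "'a \<Rightarrow> 'a list \<Rightarrow> 'k::field"
  shows "class_norm (class_bd 1 d) = 0"
proof -
  have "class_bd 1 d = 0"
  proof (rule class_chain_eqI[OF _ class_cochains_subspace(1)])
    show "class_bd 1 d \<in> class_cochains 0" using class_bd_closed[of 0 d] by simp
    fix \<psi> :: "'a \<Rightarrow> 'a list \<Rightarrow> 'k" assume \<psi>: "normalized_functional \<psi>"
    have "class_pairing 0 \<psi> (class_bd 1 d) = class_pairing 1 (cobd G \<psi>) d"
      using class_pairing_class_bd[OF \<psi>, of 0 d] by simp
    also have "\<dots> = class_pairing 1 (\<lambda>x hs. 0) d"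
    proof (rule class_pairing_cong)
      fix x hs assume "x \<in> X" "set hs \<subseteq> centralizer G x" "length hs = 1"
      then show "cobd G \<psi> x hs = 0" by (auto simp: length_Suc_conv centralizer_eq)
    qed
    finally show "class_pairing 0 \<psi> (class_bd 1 d) = class_pairing 0 \<psi> 0"
      by (simp add: class_pairing_def)
  qed
  then show ?thesis by (simp add: class_norm_def fun_eq_iff)
qed

lemma trace_map_hom_iota:
  assumes "d \<in> class_cochains 0"
  shows "trace_map G (hom_iota G X 0 d) = coh_rho G X N \<gamma> 0 (class_norm d)"
proof (rule cochain0_eqI[OF trace_map_closed coh_rho_closed])
  fix u assume u: "u \<in> carrier G"
  have "trace_map G (hom_iota G X 0 d) [] u = (\<Sum>x\<in>X. d x [] * conjugator_count u x)"
    using u by (simp add: trace_map_apply pairing_hom_iota normalized_count class_pairing_def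
        tuples_0 count_functional_def)
  also have "\<dots> = (\<Sum>x\<in>X. if x = class_rep u then class_norm d x [] else 0)"
    by (rule sum.cong) (auto simp: conjugator_count_rep u class_norm_def)
  also have "\<dots> = class_norm d (class_rep u) []"
    using fin_X class_rep_mem[OF u] by simp
  also have "\<dots> = coh_rho G X N \<gamma> 0 (class_norm d) [] u"
    using gpd_coord_coh_rho[OF class_norm_closed[OF assms] u, of "[]"] u by (simp add: gpd_coord_def)
  finally show "trace_map G (hom_iota G X 0 d) [] u = coh_rho G X N \<gamma> 0 (class_norm d) [] u" .
qed

lemma coh_iota_trace_map:
  fixes c :: "'a list \<Rightarrow> 'a \<Rightarrow> 'k::field"
  shows "coh_iota G X 0 (trace_map G c) = class_norm (hom_rho G X N \<gamma> 0 c)"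
proof (rule class_cochain_eqI[OF coh_iota_closed class_norm_closed[OF hom_rho_closed]])
  fix x hs assume x: "x \<in> X" and hs: "set hs \<subseteq> centralizer G x" "length hs = 0"
  let ?\<psi> = "\<lambda>y l. if y = x \<and> l = [] then 1 else (0::'k)"
  have \<psi>: "normalized_functional ?\<psi>" by (auto simp: normalized_functional_def)
  have "class_pairing 0 ?\<psi> (hom_rho G X N \<gamma> 0 c) = (\<Sum>y\<in>X. if y = x then hom_rho G X N \<gamma> 0 c x [] else 0)"
    unfolding class_pairing_def tuples_0 by (intro sum.cong) auto
  then have "hom_rho G X N \<gamma> 0 c x [] = pairing 0 (\<lambda>u gs. ?\<psi> (class_rep u) (loops G gam u gs)) c"
    using class_pairing_hom_rho[OF \<psi>, of 0 c] x fin_X by simp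
  then have "class_norm (hom_rho G X N \<gamma> 0 c) x [] =
      pairing 0 (\<lambda>u gs. of_nat (order (centralizer_group G x)) * ?\<psi> (class_rep u) (loops G gam u gs)) c"
    using x by (simp add: class_norm_def pairing_def sum_distrib_left case_prod_unfold mult.left_commute)
  also have "\<dots> = pairing 0 (count_functional x) c"
    by (rule pairing_cong) (use x in \<open>auto simp: count_functional_def conjugator_count_sym[of x] conjugator_count_rep\<close>)
  finally show "coh_iota G X 0 (trace_map G c) x hs = class_norm (hom_rho G X N \<gamma> 0 c) x hs"
    using x hs by (simp add: coh_iota_apply[OF x trace_map_closed] gpd_coord_def trace_map_apply)
qed


end


section \<open>All degrees together\<close>

context class_transversal
begin

text \<open>The two halves of the grading. As constants they are moved only by the rules \<open>degree_shift\<close>, and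
  integer arithmetic does not rearrange them.\<close>

definition cochain_degree :: "nat \<Rightarrow> int" where "cochain_degree n = int n"

definition chain_degree :: "nat \<Rightarrow> int" where "chain_degree n = - int n - 1"

lemma degree_cases: obtains n where "m = cochain_degree n" | n where "m = chain_degree n"
proof (cases "m \<ge> 0")
  case True
  then show ?thesis using that(1)[of "nat m"] by (simp add: cochain_degree_def)
next
  case False
  then show ?thesis using that(2)[of "nat (- m - 1)"] by (simp add: chain_degree_def)
qed

lemma degree_shift:
  "cochain_degree n + 1 = cochain_degree (n + 1)" "chain_degree 0 + 1 = cochain_degree 0" "chain_degree (n + 1) + 1 = chain_degree n"
  "cochain_degree (n + 1) - 1 = cochain_degree n" "cochain_degree 0 - 1 = chain_degree 0" "chain_degree n - 1 = chain_degree (n + 1)"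
  by (simp_all add: cochain_degree_def chain_degree_def)

lemma nat_degree: "nat (cochain_degree n) = n" "nat (- chain_degree n - 1) = n" "cochain_degree n \<ge> 0" "\<not> chain_degree n \<ge> 0"
  "chain_degree n = -1 \<longleftrightarrow> n = 0"
  by (simp_all add: cochain_degree_def chain_degree_def)

lemma D_space_eq: "D_space G (cochain_degree n) = cochains G n" "D_space G (chain_degree n) = chains G n"
  by (simp_all only: D_space_def nat_degree if_True if_False)

lemma D_diff_eq: "D_diff G (cochain_degree n) = coch_diff G n" "D_diff G (chain_degree 0) = trace_map G"
  "D_diff G (chain_degree (n + 1)) = ch_diff G (n + 1)"
  by (simp_all only: D_diff_def nat_degree if_True if_False) auto

lemma hat_eq:
  "iota_hat G X N \<gamma> (cochain_degree n) = coh_rho G X N \<gamma> n" "iota_hat G X N \<gamma> (chain_degree n) = hom_iota G X n"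
  "rho_hat G X N \<gamma> (cochain_degree n) = coh_iota G X n" "rho_hat G X N \<gamma> (chain_degree n) = hom_rho G X N \<gamma> n"
  "s_hat G X N \<gamma> (cochain_degree n) = coh_s G X N \<gamma> n" "s_hat G X N \<gamma> (chain_degree n) = hom_s G X N \<gamma> n"
  by (simp_all only: iota_hat_def rho_hat_def s_hat_def nat_degree if_True if_False)

abbreviation "Tate_space \<equiv> dsum_space X (\<lambda>x. tate_space (centralizer_group G x))"

abbreviation "Tate_diff \<equiv> dsum_diff X (\<lambda>x. tate_diff (centralizer_group G x))"

lemma Tate_space_eq:
  "Tate_space (cochain_degree n) = (class_cochains n :: ('a \<Rightarrow> 'a list \<Rightarrow> 'k::field) set)" (is ?cochain_degree)
  "Tate_space (chain_degree n) = (class_cochains n :: ('a \<Rightarrow> 'a list \<Rightarrow> 'k::field) set)" (is ?chain_degree)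
proof -
  have "(\<psi> \<in> Tate_space (cochain_degree n) \<longleftrightarrow> \<psi> \<in> class_cochains n) \<and> (\<psi> \<in> Tate_space (chain_degree n) \<longleftrightarrow> \<psi> \<in> class_cochains n)"
    for \<psi> :: "'a \<Rightarrow> 'a list \<Rightarrow> 'k"
  proof -
    let ?off = "\<forall>x. x \<notin> X \<longrightarrow> \<psi> x = 0"
    let ?on = "\<forall>x\<in>X. \<forall>l. l \<notin> tuples (centralizer_group G x) n \<longrightarrow> \<psi> x l = 0"
    have cc: "\<psi> \<in> class_cochains n \<longleftrightarrow> ?off \<and> ?on"
      by (auto simp: class_cochains_def fun_eq_iff)
    have fs: "finite {x. \<psi> x \<noteq> 0}" if ?off
      by (rule finite_subset[OF _ fin_X]) (use that in blast)
    have ft: "finite {l. \<psi> x l \<noteq> 0}" if "x \<in> X" ?on for x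
      by (rule finite_subset[OF _ finite_tuples[OF finite_centralizer[OF that(1)], of n]])
        (use that in blast)
    show ?thesis
      unfolding cc unfolding dsum_space_def tate_space_def gcochains_def gchains_def free_space_def
        nat_degree mem_Collect_eq
      using fs ft by (simp only: nat_degree if_True if_False mem_Collect_eq) blast
  qed
  then show ?cochain_degree ?chain_degree by blast+
qed

lemma Tate_diff_eq: "Tate_diff (cochain_degree n) = class_cobd n" "Tate_diff (chain_degree 0) = class_norm"
  "Tate_diff (chain_degree (n + 1)) = class_bd (n + 1)"
  by (simp_all only: dsum_diff_def tate_diff_def nat_degree if_True if_False fun_eq_iff
      class_cobd_def class_norm_def class_bd_def) simp_all

lemma vector_space_scale2: "vector_space (scale2 :: 'k::field \<Rightarrow> ('s \<Rightarrow> 't \<Rightarrow> 'k) \<Rightarrow> 's \<Rightarrow> 't \<Rightarrow> 'k)"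
  by unfold_locales (auto simp: fun_eq_iff algebra_simps)

lemma cochain_complexI:
  fixes C :: "int \<Rightarrow> ('s \<Rightarrow> 't \<Rightarrow> 'k::field) set"
  assumes "\<And>m. 0 \<in> C m" "\<And>m v w. v \<in> C m \<Longrightarrow> w \<in> C m \<Longrightarrow> v + w \<in> C m"
    and "\<And>m c v. v \<in> C m \<Longrightarrow> scale2 c v \<in> C m"
    and "\<And>m. linear_map_on scale2 scale2 (C m) (C (m + 1)) (d m)"
    and "\<And>m v. v \<in> C m \<Longrightarrow> d (m + 1) (d m v) = 0"
  shows "cochain_complex scale2 C d"
proof -
  interpret vector_space "scale2 :: 'k \<Rightarrow> ('s \<Rightarrow> 't \<Rightarrow> 'k) \<Rightarrow> _" by (rule vector_space_scale2)
  show ?thesis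
    by unfold_locales (use assms in \<open>auto simp: subspace_def\<close>)
qed

lemma differential_cases: obtains n where "m = cochain_degree n" | "m = chain_degree 0" | n where "m = chain_degree (n + 1)"
proof (cases rule: degree_cases[of m])
  case (2 n)
  then show ?thesis using that(2) that(3)[of "n - 1"] by (cases n) auto
qed (use that in blast)

lemma D_complex: "cochain_complex scale2 (D_space G :: int \<Rightarrow> ('a list \<Rightarrow> 'a \<Rightarrow> 'k::field) set) (D_diff G)"
proof (rule cochain_complexI)
  fix m :: int and c :: 'k and v w :: "'a list \<Rightarrow> 'a \<Rightarrow> 'k"
  have D: "D_space G m = cochains G (if m \<ge> 0 then nat m else nat (- m - 1))"
    by (simp add: D_space_def chains_eq_cochains)
  show "(0 :: 'a list \<Rightarrow> 'a \<Rightarrow> 'k) \<in> D_space G m" "v \<in> D_space G m \<Longrightarrow> w \<in> D_space G m \<Longrightarrow> v + w \<in> D_space G m"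
    "v \<in> D_space G m \<Longrightarrow> scale2 c v \<in> D_space G m"
    unfolding D by (rule cochains_subspace; assumption)+
  show "linear_map_on scale2 scale2 (D_space G m :: ('a list \<Rightarrow> 'a \<Rightarrow> 'k) set) (D_space G (m + 1)) (D_diff G m)"
    by (cases rule: differential_cases[of m])
      (simp_all only: degree_shift D_space_eq D_diff_eq linear_coch_diff linear_trace_map linear_ch_diff)
  assume v: "v \<in> D_space G m"
  show "D_diff G (m + 1) (D_diff G m v) = 0"
  proof (cases rule: differential_cases[of m])
    case (1 n)
    then show ?thesis
      using v coch_diff_coch_diff by (simp only: degree_shift D_space_eq D_diff_eq)
  next
    case 2
    then show ?thesis
      by (simp only: degree_shift D_diff_eq coch_diff_trace_map)
  next
    case (3 n)
    show ?thesis
    proof (cases n)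
      case 0
      have eq: "m = chain_degree (0 + 1)" using 3 0 by simp
      show ?thesis
        using trace_map_ch_diff[of v] unfolding eq degree_shift D_diff_eq by simp
    next
      case (Suc k)
      have eq: "m = chain_degree (k + 1 + 1)" using 3 Suc by simp
      show ?thesis
        using ch_diff_ch_diff[of k v] unfolding eq degree_shift D_diff_eq by simp
    qed
  qed
qed

lemma Tate_complex: "cochain_complex scale2 (Tate_space :: int \<Rightarrow> ('a \<Rightarrow> 'a list \<Rightarrow> 'k::field) set) Tate_diff"
proof (rule cochain_complexI)
  fix m :: int and c :: 'k and v w :: "'a \<Rightarrow> 'a list \<Rightarrow> 'k"
  obtain k where T: "Tate_space m = (class_cochains k :: ('a \<Rightarrow> 'a list \<Rightarrow> 'k) set)"
    by (cases rule: degree_cases[of m]) (auto simp: Tate_space_eq)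
  show "(0 :: 'a \<Rightarrow> 'a list \<Rightarrow> 'k) \<in> Tate_space m" "v \<in> Tate_space m \<Longrightarrow> w \<in> Tate_space m \<Longrightarrow> v + w \<in> Tate_space m"
    "v \<in> Tate_space m \<Longrightarrow> scale2 c v \<in> Tate_space m"
    unfolding T by (rule class_cochains_subspace; assumption)+
  show "linear_map_on scale2 scale2 (Tate_space m :: ('a \<Rightarrow> 'a list \<Rightarrow> 'k) set) (Tate_space (m + 1)) (Tate_diff m)"
    by (cases rule: differential_cases[of m])
      (simp_all only: degree_shift Tate_space_eq Tate_diff_eq linear_class_cobd linear_class_norm
        linear_class_bd)
  assume v: "v \<in> Tate_space m"
  show "Tate_diff (m + 1) (Tate_diff m v) = 0"
  proof (cases rule: differential_cases[of m])
    case (1 n)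
    then show ?thesis
      using v class_cobd_class_cobd by (simp only: degree_shift Tate_space_eq Tate_diff_eq)
  next
    case 2
    then show ?thesis
      using v class_cobd_class_norm by (simp only: degree_shift Tate_space_eq Tate_diff_eq)
  next
    case (3 n)
    show ?thesis
    proof (cases n)
      case 0
      have eq: "m = chain_degree (0 + 1)" using 3 0 by simp
      show ?thesis
        using class_norm_class_bd[of v] unfolding eq degree_shift Tate_diff_eq by simp
    next
      case (Suc k)
      have eq: "m = chain_degree (k + 1 + 1)" using 3 Suc by simp
      show ?thesis
        using class_bd_class_bd[of k v] unfolding eq degree_shift Tate_diff_eq by simp
    qed
  qed
qed

lemma rho_hat_morphism:
  "complex_morphism scale2 (D_space G) (D_diff G) scale2 Tate_space Tate_diff
    (rho_hat G X N \<gamma> :: int \<Rightarrow> ('a list \<Rightarrow> 'a \<Rightarrow> 'k::field) \<Rightarrow> _)"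
  unfolding complex_morphism_def
proof (intro conjI allI ballI)
  fix m
  show "linear_map_on scale2 scale2 (D_space G m) (Tate_space m)
      (rho_hat G X N \<gamma> m :: ('a list \<Rightarrow> 'a \<Rightarrow> 'k) \<Rightarrow> _)"
    by (cases rule: degree_cases[of m])
      (simp_all only: D_space_eq Tate_space_eq hat_eq linear_coh_iota linear_hom_rho)
  fix v :: "'a list \<Rightarrow> 'a \<Rightarrow> 'k" assume v: "v \<in> D_space G m"
  show "rho_hat G X N \<gamma> (m + 1) (D_diff G m v) = Tate_diff m (rho_hat G X N \<gamma> m v)"
    using v by (cases rule: differential_cases[of m])
      (simp_all only: degree_shift D_space_eq D_diff_eq Tate_diff_eq hat_eq coh_iota_coch_diff
        coh_iota_trace_map hom_rho_ch_diff)
qed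

lemma iota_hat_morphism:
  "complex_morphism scale2 Tate_space Tate_diff scale2 (D_space G) (D_diff G)
    (iota_hat G X N \<gamma> :: int \<Rightarrow> ('a \<Rightarrow> 'a list \<Rightarrow> 'k::field) \<Rightarrow> _)"
  unfolding complex_morphism_def
proof (intro conjI allI ballI)
  fix m
  show "linear_map_on scale2 scale2 (Tate_space m) (D_space G m)
      (iota_hat G X N \<gamma> m :: ('a \<Rightarrow> 'a list \<Rightarrow> 'k) \<Rightarrow> _)"
    by (cases rule: degree_cases[of m])
      (simp_all only: D_space_eq Tate_space_eq hat_eq linear_coh_rho linear_hom_iota)
  fix v :: "'a \<Rightarrow> 'a list \<Rightarrow> 'k" assume v: "v \<in> Tate_space m"
  show "iota_hat G X N \<gamma> (m + 1) (Tate_diff m v) = D_diff G m (iota_hat G X N \<gamma> m v)"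
    using v by (cases rule: differential_cases[of m])
      (simp_all only: degree_shift Tate_space_eq D_diff_eq Tate_diff_eq hat_eq coh_rho_class_cobd
        trace_map_hom_iota hom_iota_class_bd)
qed

lemma linear_s_hat:
  "linear_map_on scale2 scale2 (D_space G m) (D_space G (m - 1))
    (s_hat G X N \<gamma> m :: ('a list \<Rightarrow> 'a \<Rightarrow> 'k::field) \<Rightarrow> _)"
proof (cases rule: degree_cases[of m])
  case (1 n)
  show ?thesis
  proof (cases n)
    case 0
    have "linear_map_on scale2 scale2 V (chains G 0)
        (coh_s G X N \<gamma> 0 :: ('a list \<Rightarrow> 'a \<Rightarrow> 'k) \<Rightarrow> _)" for V
      by (simp add: linear_map_on_def coh_s_zero chains_subspace fun_eq_iff)
    then show ?thesis
      unfolding 1 0 by (simp only: degree_shift D_space_eq hat_eq)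
  next
    case (Suc k)
    have eq: "m = cochain_degree (k + 1)" using 1 Suc by simp
    show ?thesis
      unfolding eq degree_shift D_space_eq hat_eq using linear_coh_s[of k] by simp
  qed
next
  case (2 n)
  then show ?thesis by (simp only: degree_shift D_space_eq hat_eq linear_hom_s)
qed

lemma homotopy_hat:
  assumes v: "v \<in> D_space G m"
  shows "(v :: 'a list \<Rightarrow> 'a \<Rightarrow> 'k::field) - iota_hat G X N \<gamma> m (rho_hat G X N \<gamma> m v) =
    D_diff G (m - 1) (s_hat G X N \<gamma> m v) + s_hat G X N \<gamma> (m + 1) (D_diff G m v)"
proof (cases rule: degree_cases[of m])
  case (1 n)
  have "v \<in> cochains G n" using v by (simp only: 1 D_space_eq)
  note h = coh_homotopy[OF this]
  show ?thesis
  proof (cases n)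
    case 0
    have "trace_map G (0 :: 'a list \<Rightarrow> 'a \<Rightarrow> 'k) = 0"
      by (simp add: trace_map_def fun_eq_iff sum_fun_apply)
    then show ?thesis
      using h[unfolded 0] unfolding 1 0 degree_shift D_diff_eq hat_eq coh_s_zero by simp
  next
    case (Suc k)
    have eq: "m = cochain_degree (k + 1)" "n = k + 1" using 1 Suc by simp_all
    show ?thesis
      using h unfolding eq degree_shift D_diff_eq hat_eq by simp
  qed
next
  case (2 n)
  have "v \<in> chains G n" using v by (simp only: 2 D_space_eq)
  note h = hom_homotopy[OF this]
  show ?thesis
  proof (cases n)
    case 0
    show ?thesis
      using h[unfolded 0] unfolding 2 0 degree_shift D_diff_eq hat_eq coh_s_zero by simp
  next
    case (Suc k)
    have eq: "m = chain_degree (k + 1)" "n = k + 1" using 2 Suc by simp_all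
    show ?thesis
      using h unfolding eq degree_shift D_diff_eq hat_eq by simp
  qed
qed

theorem deformation_retract:
  "homotopy_deformation_retract scale2 (D_space G) (D_diff G) scale2 Tate_space Tate_diff
    (rho_hat G X N \<gamma>) (iota_hat G X N \<gamma>) (s_hat G X N \<gamma> :: int \<Rightarrow> ('a list \<Rightarrow> 'a \<Rightarrow> 'k::field) \<Rightarrow> _)"
  unfolding homotopy_deformation_retract_def
proof (intro conjI allI ballI D_complex Tate_complex rho_hat_morphism iota_hat_morphism
    linear_s_hat homotopy_hat)
  fix m and w :: "'a \<Rightarrow> 'a list \<Rightarrow> 'k" assume "w \<in> Tate_space m"
  then show "rho_hat G X N \<gamma> m (iota_hat G X N \<gamma> m w) = w"
    by (cases rule: degree_cases[of m])
      (simp_all only: Tate_space_eq hat_eq coh_iota_coh_rho hom_rho_hom_iota)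
qed

end


section \<open>The deformation retract\<close>

theorem mainTheorem8:
  fixes G :: "('a, 'b) monoid_scheme" and X :: "'a set"
    and N :: "'a \<Rightarrow> nat" and \<gamma> :: "'a \<Rightarrow> nat \<Rightarrow> 'a"
  assumes "group G" and "finite (carrier G)"
    and "conj_class_reps G X"
    and "\<And>x. x \<in> X \<Longrightarrow> right_coset_reps G (centralizer G x) (N x) (\<gamma> x)"
  shows "homotopy_deformation_retract
    (scale2 :: 'k::field \<Rightarrow> ('a list \<Rightarrow> 'a \<Rightarrow> 'k) \<Rightarrow> 'a list \<Rightarrow> 'a \<Rightarrow> 'k)
    (D_space G) (D_diff G)
    (scale2 :: 'k \<Rightarrow> ('a \<Rightarrow> 'a list \<Rightarrow> 'k) \<Rightarrow> 'a \<Rightarrow> 'a list \<Rightarrow> 'k)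
    (dsum_space X (\<lambda>x. tate_space (centralizer_group G x)))
    (dsum_diff X (\<lambda>x. tate_diff (centralizer_group G x)))
    (rho_hat G X N \<gamma>) (iota_hat G X N \<gamma>) (s_hat G X N \<gamma>)"
proof -
  interpret class_transversal G X N \<gamma>
    by (rule class_transversal.intro) (use assms in \<open>auto simp: class_transversal_axioms_def\<close>)
  show ?thesis by (rule deformation_retract)
qed

end
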